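(* Let $N\in\mathbb N$ and let $\phi_1,\dots,\phi_N:\mathbb N\to\mathbb Z$ be asymptotically independent sequences. Then there exists a strictly increasing sequence $(n_k)_{k\in\mathbb N}$ in $\mathbb N$ such that for any $\vec\xi=(\xi_1,\dots,\xi_N)\in\{0,1\}^N$ there exists a weakly mixing $T_{\vec\xi}\in\mathrm{Aut}([0,1],\mathcal B,\mu)$ with the property that for each $j\in\{1,\dots,N\}$ and any $A,B\in\mathcal B$, $$\lim_{k\to\infty}\mu(A\cap T_{\vec\xi}^{-\phi_j(n_k)}B)=(1-\xi_j)\mu(A\cap B)+\xi_j\mu(A)\mu(B).$$
   Context: $\mathbb N=\{1,2,\dots\}$. $\mathcal B$ is the Borel $\sigma$-algebra of $[0,1]$ and $\mu$ is Lebesgue measure. $\mathrm{Aut}([0,1],\mathcal B,\mu)$ is the set of invertible $\mu$-preserving transformations $T:[0,1]\to[0,1]$ (as usual identified when they agree $\mu$-a.e.). Sequences $\phi_1,\dots,\phi_N:\mathbb N\to\mathbb Z$ are asymptotically (linearly) independent if for every $(a_1,\dots,a_N)\in\mathbb Z^N\setminus\{\vec 0\}$, $\lim_{n\to\infty}\left|\sum_{j=1}^Na_j\phi_j(n)\right|=\infty$. A measure preserving transformation $T$ of a probability space $(X,\mathcal F,\nu)$ is weakly mixing if for any $A,B\in\mathcal F$, $\lim_{M\to\infty}\frac1M\sum_{n=1}^M|\nu(A\cap T^{-n}B)-\nu(A)\nu(B)|=0$. *)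

theory Defs
  imports "HOL-Analysis.Analysis"
begin

definition unit_measure :: "real measure" where
  "unit_measure = restrict_space lborel {0..1}"

text \<open>
  Transformations are represented by functions that are genuinely bijective on the space; two
  elements that agree almost everywhere stand for the same automorphism. Values outside
  \<^term>\<open>space M\<close> are irrelevant. Preservation of the measure by the inverse follows.
\<close>

definition Aut :: "'a measure \<Rightarrow> ('a \<Rightarrow> 'a) set" where
  "Aut M = {T. bij_betw T (space M) (space M) \<and> T \<in> measurable M M \<and>
      inv_into (space M) T \<in> measurable M M \<and> distr M M T = M}"

text \<open>Integer iterates; negative ones iterate the inverse of \<open>T\<close> on \<^term>\<open>space M\<close>.\<close>

definition int_iter :: "'a measure \<Rightarrow> ('a \<Rightarrow> 'a) \<Rightarrow> int \<Rightarrow> 'a \<Rightarrow> 'a" where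
  "int_iter M T i =
    (if 0 \<le> i then T ^^ nat i else inv_into (space M) T ^^ nat (- i))"

text \<open>\<open>T\<^sup>-\<^sup>i B\<close> is the preimage of \<open>B\<close> under \<open>T\<^sup>i\<close>, for \<open>i\<close> of either sign.\<close>

definition iter_vimage :: "'a measure \<Rightarrow> ('a \<Rightarrow> 'a) \<Rightarrow> int \<Rightarrow> 'a set \<Rightarrow> 'a set" where
  "iter_vimage M T i B = int_iter M T i -` B \<inter> space M"

definition weakly_mixing :: "'a measure \<Rightarrow> ('a \<Rightarrow> 'a) \<Rightarrow> bool" where
  "weakly_mixing M T \<longleftrightarrow> (\<forall>A\<in>sets M. \<forall>B\<in>sets M.
    (\<lambda>m. (1 / real m) * (\<Sum>n=1..m. \<bar>measure M (A \<inter> ((T ^^ n) -` B \<inter> space M))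
        - measure M A * measure M B\<bar>)) \<longlonglongrightarrow> 0)"

text \<open>
  The sequences are \<open>\<phi> 1, \<dots>, \<phi> N\<close>, indexed by positive integers; the value \<open>\<phi> j 0\<close> plays no role.
\<close>

definition asymptotically_independent :: "nat \<Rightarrow> (nat \<Rightarrow> nat \<Rightarrow> int) \<Rightarrow> bool" where
  "asymptotically_independent N \<phi> \<longleftrightarrow> (\<forall>a :: nat \<Rightarrow> int. (\<exists>j\<in>{1..N}. a j \<noteq> 0) \<longrightarrow>
    filterlim (\<lambda>n. \<bar>\<Sum>j=1..N. a j * \<phi> j n\<bar>) at_top sequentially)"

end

theory Submission
  imports Defs
begin

text \<open>
  The transformations are built by approximation with cyclic permutations of equal intervals, a form of
  cutting and stacking. Suppose that \<open>S\<close> permutes \<open>q\<close> equal intervals of \<open>[0,1)\<close> in a single cycle, by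
  translations. Labelled along the cycle, the intervals become arcs of a circle and \<open>S\<close> is seen as the rotation
  by \<open>1/q\<close>. A rotation by a number \<open>x\<close> slightly larger than \<open>1/q\<close> moves almost every point as \<open>S\<close> does, but
  its \<open>m\<close>-th power is the rotation by \<open>m x\<close>, and for large \<open>m\<close> this bears no relation to \<open>S\<^sup>m\<close>. Asymptotic
  independence says that for large \<open>n\<close> the numbers \<open>\<phi>\<^sub>1(n) x, \<dots>, \<phi>\<^sub>N(n) x\<close> take every prescribed
  position modulo 1, up to a small error, as \<open>x\<close> runs through a short interval
  (\<open>simultaneous_approximation\<close>). Hence for each \<open>s < q\<close> there is \<open>x\<^sub>s\<close> near \<open>1/q\<close> such that \<open>\<phi>\<^sub>j(n) x\<^sub>s\<close>
  is close to \<open>\<xi>\<^sub>j s / q\<close> modulo 1 for all \<open>j\<close>.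

  Let \<open>S'\<close> follow the rotation by \<open>x\<^sub>0\<close> for a long time, then the rotation by \<open>x\<^sub>1\<close>, and so on up to \<open>x\<^bsub>q-1\<^esub>\<close>. On
  the \<open>s\<close>-th stretch the power of \<open>S'\<close> with exponent \<open>\<phi>\<^sub>j(n)\<close> acts on the \<open>q\<close> intervals almost like the power of
  \<open>S\<close> with exponent \<open>\<xi>\<^sub>j s\<close>. If \<open>\<xi>\<^sub>j = 0\<close> this is the identity. If \<open>\<xi>\<^sub>j = 1\<close>, averaging over \<open>s\<close> spreads every
  interval evenly over all \<open>q\<close>, since \<open>S\<close> is a single cycle. So on the \<open>q\<close> intervals the required relation holds
  approximately (\<open>drift_coding\<close>). Moreover \<open>S'\<close> can be realised as a single cycle of a refined partition
  into equal intervals which agrees with \<open>S\<close> off a set of small measure (\<open>refine_enumeration\<close>,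
  \<open>cyclic_refinement_step\<close>).

  This step is iterated (\<open>cyclic_refinement_chain\<close>). The time \<open>n\<^sub>k\<close> is chosen before the \<open>k\<close>-th transformation is
  constructed, and all later changes are made on sets so small, compared with \<open>1 / \<bar>\<phi>\<^sub>j(n\<^sub>k)\<bar>\<close>, that the
  behaviour at time \<open>\<phi>\<^sub>j(n\<^sub>k)\<close> survives. The limit is an automorphism
  (\<open>aut_of_stabilising_actions\<close>), and the relation passes from intervals to Borel sets
  (\<open>limit_along_refinements\<close>). For each of the finitely many \<open>\<xi>\<close> the step only asks that \<open>n\<close> be large, so one
  sequence \<open>(n\<^sub>k)\<close> serves all of them.

  Weak mixing is obtained at no extra cost: a rapidly growing sequence \<open>\<phi>\<^bsub>N+1\<^esub>\<close> keeps the family independent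
  (\<open>asymptotically_independent_extend\<close>), and it is always given the mixing behaviour. A transformation that is
  mixing along some sequence of times is weakly mixing by Bessel's inequality
  (\<open>weakly_mixing_of_mixing_times\<close>).
\<close>

section \<open>Simultaneous approximation by multiples of a number in a short interval\<close>

lemma cos_power_eq_cis_sum:
  fixes u :: real
  shows "of_real (cos (pi * u) ^ (2 * e))
    = (\<Sum>k\<le>2*e. of_real (of_nat (2*e choose k) / 4 ^ e) * cis (2 * pi * (real k - real e) * u))"
proof -
  have "complex_of_real (2 * cos (pi * u)) = cis (pi * u) + cis (- (pi * u))"
    by (simp add: complex_eq_iff)
  hence "complex_of_real ((2 * cos (pi * u)) ^ (2 * e)) = (cis (pi * u) + cis (- (pi * u))) ^ (2 * e)"
    by (simp only: of_real_power)
  also have "\<dots> = (\<Sum>k\<le>2*e. of_nat (2*e choose k) * cis (pi * u) ^ k * cis (- (pi * u)) ^ (2*e - k))"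
    by (rule binomial_ring)
  also have "\<dots> = (\<Sum>k\<le>2*e. of_nat (2*e choose k) * cis (2 * pi * (real k - real e) * u))"
  proof (rule sum.cong[OF refl])
    fix k assume k: "k \<in> {..2*e}"
    have "cis (pi * u) ^ k * cis (- (pi * u)) ^ (2*e - k)
        = cis (real k * (pi * u) + real (2*e - k) * (- (pi * u)))"
      by (simp only: Complex.DeMoivre cis_mult)
    also have "real k * (pi * u) + real (2*e - k) * (- (pi * u)) = 2 * pi * (real k - real e) * u"
      using k by (simp add: of_nat_diff algebra_simps)
    finally show "of_nat (2*e choose k) * cis (pi * u) ^ k * cis (- (pi * u)) ^ (2*e - k)
        = of_nat (2*e choose k) * cis (2 * pi * (real k - real e) * u)"
      by (simp add: mult.assoc)
  qed
  finally have eq: "complex_of_real ((2 * cos (pi * u)) ^ (2 * e))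
      = (\<Sum>k\<le>2*e. of_nat (2*e choose k) * cis (2 * pi * (real k - real e) * u))" .
  have "cos (pi * u) ^ (2 * e) = (2 * cos (pi * u)) ^ (2 * e) / 4 ^ e"
    by (simp add: power_mult power_mult_distrib)
  hence "complex_of_real (cos (pi * u) ^ (2 * e)) = complex_of_real ((2 * cos (pi * u)) ^ (2 * e)) / 4 ^ e"
    by (metis of_real_divide of_real_power of_real_numeral)
  also have "\<dots> = (\<Sum>k\<le>2*e. of_real (of_nat (2*e choose k) / 4 ^ e) * cis (2 * pi * (real k - real e) * u))"
    unfolding eq sum_divide_distrib by simp
  finally show ?thesis .
qed

lemma prod_cis: "finite A \<Longrightarrow> (\<Prod>j\<in>A. cis (f j)) = cis (\<Sum>j\<in>A. f j)"
  by (induction A rule: finite_induct) (simp_all add: cis_mult)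

lemma complex_Re_of_real_mult: "Re (complex_of_real r * z) = r * Re z"
  by simp

text \<open>
  As a linear form in \<open>u\<close> the frequency vanishes only for \<open>\<kappa> = E\<close>, so the constant term of this trigonometric polynomial is a
  product of normalised central binomial coefficients.
\<close>

lemma prod_cos_power_eq_cos_sum:
  fixes u :: "nat \<Rightarrow> real" and E :: "nat \<Rightarrow> nat"
  assumes "finite A"
  shows "(\<Prod>j\<in>A. cos (pi * u j) ^ (2 * E j))
    = (\<Sum>\<kappa>\<in>(\<Pi>\<^sub>E j\<in>A. {..2 * E j}). (\<Prod>j\<in>A. of_nat (2 * E j choose \<kappa> j) / 4 ^ E j)
        * cos (2 * pi * (\<Sum>j\<in>A. (real (\<kappa> j) - real (E j)) * u j)))"
    (is "?l = ?r")
proof -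
  have "complex_of_real ?l = (\<Prod>j\<in>A. \<Sum>k\<le>2*E j. of_real (of_nat (2*E j choose k) / 4 ^ E j)
      * cis (2 * pi * (real k - real (E j)) * u j))"
    unfolding of_real_prod cos_power_eq_cis_sum ..
  also have "\<dots> = (\<Sum>\<kappa>\<in>(\<Pi>\<^sub>E j\<in>A. {..2 * E j}). \<Prod>j\<in>A. of_real (of_nat (2*E j choose \<kappa> j) / 4 ^ E j)
      * cis (2 * pi * (real (\<kappa> j) - real (E j)) * u j))"
    by (rule prod_sum_PiE) (use assms in auto)
  also have "\<dots> = (\<Sum>\<kappa>\<in>(\<Pi>\<^sub>E j\<in>A. {..2 * E j}).
      of_real (\<Prod>j\<in>A. of_nat (2 * E j choose \<kappa> j) / 4 ^ E j)
        * cis (2 * pi * (\<Sum>j\<in>A. (real (\<kappa> j) - real (E j)) * u j)))"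
    by (simp only: prod.distrib prod_cis[OF assms] of_real_prod sum_distrib_left mult.assoc)
  finally have "Re (complex_of_real ?l) = Re \<dots>" by (rule arg_cong)
  also have "\<dots> = ?r" by (simp only: Re_sum complex_Re_of_real_mult cis.sel)
  finally show ?thesis by (simp only: Re_complex_of_real)
qed

lemma has_integral_cos_affine:
  fixes l t a b :: real
  assumes "a \<le> b" "l \<noteq> 0"
  shows "((\<lambda>x. cos (l * x - t)) has_integral ((sin (l * b - t) - sin (l * a - t)) / l)) {a..b}"
proof -
  have "((\<lambda>x. cos (l * x - t)) has_integral (sin (l * b - t) / l - sin (l * a - t) / l)) {a..b}"
    by (rule fundamental_theorem_of_calculus)
       (use assms in \<open>auto intro!: derivative_eq_intros
          simp flip: has_real_derivative_iff_has_vector_derivative\<close>)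
  thus ?thesis by (simp add: diff_divide_distrib)
qed

text \<open>
  Along \<open>x \<mapsto> (\<phi>\<^sub>1(n) x, \<dots>, \<phi>\<^sub>N(n) x)\<close> a non-constant character becomes an oscillation whose frequency is
  an integer combination of the \<open>\<phi>\<^sub>j(n)\<close>. By asymptotic independence these frequencies tend to infinity, so the
  integral over a fixed interval tends to the constant term. The bound does not depend on the phases \<open>\<beta>\<close>, which is
  why \<open>\<beta>\<close> is quantified inside the filter.
\<close>

lemma integral_prod_cos_power_limit:
  fixes a b \<epsilon> :: real and E :: "nat \<Rightarrow> nat"
  assumes ind: "asymptotically_independent N \<phi>" and ab: "a \<le> b" and eps: "\<epsilon> > 0"
  shows "\<forall>\<^sub>F n in sequentially. \<forall>\<beta>. \<exists>I.
    ((\<lambda>x. \<Prod>j\<in>{1..N}. cos (pi * (x * of_int (\<phi> j n) - \<beta> j)) ^ (2 * E j)) has_integral I) {a..b}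
    \<and> \<bar>I - (b - a) * (\<Prod>j\<in>{1..N}. of_nat (2 * E j choose E j) / 4 ^ E j)\<bar> \<le> \<epsilon>"
proof -
  let ?K = "\<Pi>\<^sub>E j\<in>{1..N}. {..2 * E j}"
  let ?E = "restrict E {1..N}"
  define w where "w \<kappa> = (\<Prod>j\<in>{1..N}. real (2 * E j choose \<kappa> j) / 4 ^ E j)" for \<kappa> :: "nat \<Rightarrow> nat"
  define l where "l \<kappa> n = 2 * pi * of_int (\<Sum>j\<in>{1..N}. (int (\<kappa> j) - int (E j)) * \<phi> j n)" for \<kappa> n
  have finK: "finite ?K" by (rule finite_PiE) auto
  have EK: "?E \<in> ?K" by auto
  define S where "S = (\<Sum>\<kappa>\<in>?K. w \<kappa>)"
  have w0: "w \<kappa> \<ge> 0" for \<kappa> unfolding w_def by (intro prod_nonneg) auto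
  have S0: "S \<ge> 0" unfolding S_def using w0 by (intro sum_nonneg) auto
  define C where "C = nat \<lceil>2 * (S + 1) / \<epsilon>\<rceil> + 1"
  have C: "real C \<ge> 2 * (S + 1) / \<epsilon>" "C > 0"
    unfolding C_def using S0 eps by linarith+
  have "\<forall>\<^sub>F n in sequentially. \<forall>\<kappa>\<in>?K - {?E}. \<bar>\<Sum>j\<in>{1..N}. (int (\<kappa> j) - int (E j)) * \<phi> j n\<bar> \<ge> int C"
  proof (rule eventually_ball_finite)
    show "finite (?K - {?E})" using finK by simp
    show "\<forall>\<kappa>\<in>?K - {?E}. \<forall>\<^sub>F n in sequentially. \<bar>\<Sum>j\<in>{1..N}. (int (\<kappa> j) - int (E j)) * \<phi> j n\<bar> \<ge> int C"
    proof
      fix \<kappa> assume k: "\<kappa> \<in> ?K - {?E}"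
      have "\<exists>j\<in>{1..N}. \<kappa> j \<noteq> E j"
      proof (rule ccontr)
        assume "\<not> ?thesis"
        hence "\<kappa> = ?E" using k by (intro PiE_ext[where k="{1..N}" and s="\<lambda>j. {..2*E j}"]) auto
        thus False using k by auto
      qed
      hence "\<exists>j\<in>{1..N}. int (\<kappa> j) - int (E j) \<noteq> 0" by auto
      hence "filterlim (\<lambda>n. \<bar>\<Sum>j\<in>{1..N}. (int (\<kappa> j) - int (E j)) * \<phi> j n\<bar>) at_top sequentially"
        using ind[unfolded asymptotically_independent_def, rule_format, of "\<lambda>j. int (\<kappa> j) - int (E j)"]
        by blast
      thus "\<forall>\<^sub>F n in sequentially. \<bar>\<Sum>j\<in>{1..N}. (int (\<kappa> j) - int (E j)) * \<phi> j n\<bar> \<ge> int C"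
        unfolding filterlim_at_top by blast
    qed
  qed
  thus ?thesis
  proof (rule eventually_mono, intro allI)
    fix n and \<beta> :: "nat \<Rightarrow> real"
    assume big: "\<forall>\<kappa>\<in>?K - {?E}. \<bar>\<Sum>j\<in>{1..N}. (int (\<kappa> j) - int (E j)) * \<phi> j n\<bar> \<ge> int C"
    define t where "t \<kappa> = 2 * pi * (\<Sum>j\<in>{1..N}. (real (\<kappa> j) - real (E j)) * \<beta> j)" for \<kappa> :: "nat \<Rightarrow> nat"
    define i where "i \<kappa> = (if \<kappa> = ?E then b - a else (sin (l \<kappa> n * b - t \<kappa>) - sin (l \<kappa> n * a - t \<kappa>)) / l \<kappa> n)" for \<kappa>
    have large: "\<bar>l \<kappa> n\<bar> \<ge> real C" if "\<kappa> \<in> ?K - {?E}" for \<kappa>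
    proof -
      have "real C \<le> \<bar>real_of_int (\<Sum>j\<in>{1..N}. (int (\<kappa> j) - int (E j)) * \<phi> j n)\<bar>" (is "_ \<le> \<bar>?z\<bar>")
      proof -
        have "real_of_int (int C) \<le> real_of_int \<bar>\<Sum>j\<in>{1..N}. (int (\<kappa> j) - int (E j)) * \<phi> j n\<bar>"
          by (subst of_int_le_iff) (use big that in blast)
        thus ?thesis by (simp only: of_int_abs of_int_of_nat_eq)
      qed
      also have "\<dots> \<le> 2 * pi * \<bar>?z\<bar>" using pi_ge_two mult_right_mono[of 1 "2*pi" "\<bar>?z\<bar>"] by simp
      also have "\<dots> = \<bar>l \<kappa> n\<bar>" unfolding l_def by (simp add: abs_mult)
      finally show ?thesis .
    qed
    have fi: "((\<lambda>x. cos (l \<kappa> n * x - t \<kappa>)) has_integral i \<kappa>) {a..b}" if k: "\<kappa> \<in> ?K" for \<kappa>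
    proof (cases "\<kappa> = ?E")
      case True
      hence "l \<kappa> n = 0" "t \<kappa> = 0" unfolding l_def t_def by auto
      thus ?thesis using True has_integral_const_real[of "1::real" a b] ab by (simp add: i_def)
    next
      case False
      hence "l \<kappa> n \<noteq> 0" using large[of \<kappa>] k C by auto
      thus ?thesis using has_integral_cos_affine[OF ab] False by (simp add: i_def)
    qed
    have eq: "(\<Prod>j\<in>{1..N}. cos (pi * (x * of_int (\<phi> j n) - \<beta> j)) ^ (2 * E j))
        = (\<Sum>\<kappa>\<in>?K. w \<kappa> * cos (l \<kappa> n * x - t \<kappa>))" for x
    proof -
      have "2 * pi * (\<Sum>j\<in>{1..N}. (real (\<kappa> j) - real (E j)) * (x * of_int (\<phi> j n) - \<beta> j)) = l \<kappa> n * x - t \<kappa>"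
        for \<kappa> unfolding l_def t_def
        by (simp add: algebra_simps sum_subtractf sum.distrib sum_distrib_left sum_distrib_right)
      thus ?thesis unfolding w_def by (subst prod_cos_power_eq_cos_sum) auto
    qed
    let ?I = "\<Sum>\<kappa>\<in>?K. w \<kappa> * i \<kappa>"
    have int: "((\<lambda>x. \<Prod>j\<in>{1..N}. cos (pi * (x * of_int (\<phi> j n) - \<beta> j)) ^ (2 * E j)) has_integral ?I) {a..b}"
      unfolding eq by (intro has_integral_sum finK has_integral_mult_right fi)
    have "?I = w ?E * i ?E + (\<Sum>\<kappa>\<in>?K-{?E}. w \<kappa> * i \<kappa>)"
      using finK EK by (subst sum.remove[of _ ?E]) auto
    moreover have "w ?E * i ?E = (b - a) * (\<Prod>j\<in>{1..N}. of_nat (2 * E j choose E j) / 4 ^ E j)"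
      unfolding w_def i_def by (simp add: mult.commute)
    ultimately have "\<bar>?I - (b - a) * (\<Prod>j\<in>{1..N}. of_nat (2 * E j choose E j) / 4 ^ E j)\<bar>
        = \<bar>\<Sum>\<kappa>\<in>?K-{?E}. w \<kappa> * i \<kappa>\<bar>" by simp
    also have "\<dots> \<le> (\<Sum>\<kappa>\<in>?K-{?E}. \<bar>w \<kappa> * i \<kappa>\<bar>)" by (rule sum_abs)
    also have "\<dots> \<le> (\<Sum>\<kappa>\<in>?K-{?E}. w \<kappa> * (2 / real C))"
    proof (rule sum_mono)
      fix \<kappa> assume k: "\<kappa> \<in> ?K-{?E}"
      have "\<bar>i \<kappa>\<bar> = \<bar>sin (l \<kappa> n * b - t \<kappa>) - sin (l \<kappa> n * a - t \<kappa>)\<bar> / \<bar>l \<kappa> n\<bar>"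
        using k unfolding i_def by auto
      also have "\<dots> \<le> 2 / real C"
      proof (rule frac_le)
        show "\<bar>sin (l \<kappa> n * b - t \<kappa>) - sin (l \<kappa> n * a - t \<kappa>)\<bar> \<le> 2"
          using abs_sin_le_one[of "l \<kappa> n * b - t \<kappa>"] abs_sin_le_one[of "l \<kappa> n * a - t \<kappa>"] by linarith
      qed (use large[OF k] C in auto)
      finally show "\<bar>w \<kappa> * i \<kappa>\<bar> \<le> w \<kappa> * (2 / real C)"
        using mult_left_mono[OF _ w0[of \<kappa>]] w0[of \<kappa>] by (simp only: abs_mult abs_of_nonneg)
    qed
    also have "\<dots> \<le> (\<Sum>\<kappa>\<in>?K. w \<kappa> * (2 / real C))"
      using finK w0 by (intro sum_mono2) auto
    also have "\<dots> = 2 * S / real C" unfolding S_def sum_distrib_right[symmetric] by simp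
    also have "\<dots> \<le> \<epsilon>"
    proof -
      have "2 * (S + 1) \<le> real C * \<epsilon>" using C eps by (simp add: field_simps)
      thus ?thesis using C by (simp add: field_simps)
    qed
    finally show "\<exists>I. ((\<lambda>x. \<Prod>j\<in>{1..N}. cos (pi * (x * of_int (\<phi> j n) - \<beta> j)) ^ (2 * E j)) has_integral I) {a..b}
      \<and> \<bar>I - (b - a) * (\<Prod>j\<in>{1..N}. of_nat (2 * E j choose E j) / 4 ^ E j)\<bar> \<le> \<epsilon>"
      using int by blast
  qed
qed

text \<open>
  The ratio of consecutive means tends to 1: under the weight \<open>cos\<^bsup>2L\<^esup>(\<pi> u)\<close> the mean of \<open>sin\<^sup>2(\<pi> u)\<close> is
  \<open>1 / (2 L + 2)\<close>, so for large \<open>L\<close> the weight concentrates at the integers.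
\<close>

lemma central_binomial_ratio:
  "real (2 * Suc L choose Suc L) / 4 ^ Suc L = (2 * real L + 1) / (2 * real L + 2) * (real (2 * L choose L) / 4 ^ L)"
proof -
  define A where "A = (2 * Suc L choose Suc L)"
  define B where "B = (2 * L choose L)"
  have "A * Suc L = 2 * (2 * L + 1) * B"
    unfolding A_def B_def
    using Suc_times_binomial[of L "2*L"] Suc_times_binomial[of L "Suc (2*L)"]
      binomial_symmetric[of L "Suc (2 * L)"] by (auto simp: algebra_simps)
  hence "real (A * Suc L) = real (2 * (2 * L + 1) * B)" by (simp only:)
  hence "real A * (real L + 1) = 2 * (2 * real L + 1) * real B"
    by (simp add: algebra_simps)
  hence "real A = 2 * (2 * real L + 1) * real B / (real L + 1)" by (simp add: eq_divide_eq)
  also have "\<dots> / 4 ^ Suc L = (2 * real L + 1) / (2 * real L + 2) * (real B / 4 ^ L)"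
    by (simp add: divide_simps) (simp add: algebra_simps)
  finally show ?thesis unfolding A_def B_def .
qed

lemma dist_int_le_sin:
  fixes u :: real
  shows "\<exists>z::int. \<bar>u - of_int z\<bar> \<le> \<bar>sin (pi * u)\<bar>"
proof -
  define z where "z = round u"
  define v where "v = \<bar>u - of_int z\<bar>"
  have v: "0 \<le> v" "v \<le> 1/2" unfolding v_def z_def
    using of_int_round_abs_le[of u] by (auto simp: abs_minus_commute)
  have sz: "sin (pi * of_int z) = 0" by (simp add: sin_times_pi_eq_0 mult.commute)
  hence "\<bar>cos (pi * of_int z)\<bar> = 1" using sin_cos_squared_add[of "pi * of_int z"] by (simp add: power2_eq_1_iff)
  hence "\<bar>sin (pi * u)\<bar> = \<bar>sin (pi * (u - of_int z))\<bar>"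
    by (simp add: right_diff_distrib sin_diff sz abs_mult)
  also have "\<dots> = \<bar>sin (pi * v)\<bar>" 
  proof (cases "u \<ge> of_int z")
    case False
    hence "v = - (u - of_int z)" unfolding v_def by simp
    thus ?thesis by (metis abs_minus_cancel mult_minus_right sin_minus)
  qed (simp add: v_def)
  finally have s: "\<bar>sin (pi * u)\<bar> = \<bar>sin (pi * v)\<bar>" .
  have "v \<le> sin (pi * v)"
  proof -
    have "concave_on {0..pi/2} sin"
      by (rule f''_le0_imp_concave[where f' = cos and f'' = "\<lambda>x. - sin x"])
         (auto intro!: derivative_eq_intros sin_ge_zero)
    hence "(1 - 2 * v) * sin 0 + (2 * v) * sin (pi / 2) \<le> sin ((1 - 2 * v) *\<^sub>R 0 + (2 * v) *\<^sub>R (pi / 2))"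
      using v by (intro concave_onD) auto
    thus ?thesis using v by (simp add: mult.commute)
  qed
  thus ?thesis using s unfolding v_def by (intro exI[of _ z]) linarith
qed

text \<open>
  If at every \<open>x\<close> some \<open>x \<phi>\<^sub>j(n) - \<beta>\<^sub>j\<close> were far from the integers, then \<open>\<Sum>\<^sub>j sin\<^sup>2(\<pi> (x \<phi>\<^sub>j(n) - \<beta>\<^sub>j))\<close> would be bounded
  below on the whole interval. But its mean with respect to the weight \<open>\<Prod>\<^sub>j cos\<^bsup>2L\<^esup>(\<pi> (x \<phi>\<^sub>j(n) - \<beta>\<^sub>j))\<close> is about
  \<open>N / (2 L + 2)\<close>, which is small for large \<open>L\<close>.
\<close>

lemma simultaneous_approximation:
  fixes a b \<delta> :: real
  assumes ind: "asymptotically_independent N \<phi>" and ab: "a < b" and del: "\<delta> > 0"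
  shows "\<forall>\<^sub>F n in sequentially. \<forall>\<beta>. \<exists>x\<in>{a..b}. \<forall>j\<in>{1..N}. \<exists>z::int.
    \<bar>x * of_int (\<phi> j n) - \<beta> j - of_int z\<bar> \<le> \<delta>"
proof -
  define \<eta> where "\<eta> = \<delta>\<^sup>2"
  have eta: "\<eta> > 0" unfolding \<eta>_def using del by simp
  define L where "L = nat \<lceil>real N / \<eta>\<rceil>"
  have "real N / \<eta> \<le> real L" unfolding L_def by linarith
  hence "real N \<le> real L * \<eta>" using eta by (simp add: field_simps)
  hence NL: "real N < \<eta> * (2 * real L + 2)" using eta by (simp add: algebra_simps)
  define c where "c = real (2 * L choose L) / 4 ^ L"
  have c0: "c > 0" unfolding c_def by simp
  define \<rho> where "\<rho> = (2 * real L + 1) / (2 * real L + 2)"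
  have "real N * (1 - \<rho>) < \<eta>" using NL unfolding \<rho>_def by (simp add: field_simps)
  hence G0: "c ^ N * (\<eta> - real N * (1 - \<rho>)) * (b - a) > 0" (is "?G > 0") using c0 ab by simp
  define \<epsilon> where "\<epsilon> = ?G / (2 * (2 * real N + \<eta>))"
  have den: "2 * (2 * real N + \<eta>) > 0" using eta by simp
  have eps: "\<epsilon> > 0" unfolding \<epsilon>_def using G0 den by (rule divide_pos_pos)
  have small: "(2 * real N + \<eta>) * \<epsilon> < ?G"
  proof -
    have "(2 * (2 * real N + \<eta>)) * \<epsilon> = ?G" unfolding \<epsilon>_def using den by simp
    thus ?thesis using G0 by linarith
  qed
  \<comment> \<open>Since \<open>sin\<^sup>2 = 1 - cos\<^sup>2\<close>, weighted means of \<open>sin\<^sup>2\<close> only involve the exponents \<open>L\<close> and, in one place, \<open>L + 1\<close>.\<close>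
  define E0 where "E0 = (\<lambda>j::nat. L)"
  define E1 where "E1 i = (\<lambda>j::nat. if j = i then Suc L else L)" for i
  have p0: "(\<Prod>j\<in>{1..N}. real (2 * E0 j choose E0 j) / 4 ^ E0 j) = c ^ N"
    unfolding E0_def c_def by simp
  have p1: "(\<Prod>j\<in>{1..N}. real (2 * E1 i j choose E1 i j) / 4 ^ E1 i j) = \<rho> * c ^ N" if i: "i \<in> {1..N}" for i
  proof -
    have "(\<Prod>j\<in>{1..N}. real (2 * E1 i j choose E1 i j) / 4 ^ E1 i j)
        = (\<Prod>j\<in>{1..N}. (if j = i then \<rho> else 1) * c)"
      by (rule prod.cong[OF refl])
         (simp only: E1_def c_def \<rho>_def central_binomial_ratio mult_1 if_True if_False split: if_split, blast)
    also have "\<dots> = \<rho> * c ^ N" using i by (simp add: prod.distrib)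
    finally show ?thesis .
  qed
  have "\<forall>\<^sub>F n in sequentially. \<forall>E\<in>insert E0 (E1 ` {1..N}). \<forall>\<beta>. \<exists>I.
    ((\<lambda>x. \<Prod>j\<in>{1..N}. cos (pi * (x * of_int (\<phi> j n) - \<beta> j)) ^ (2 * E j)) has_integral I) {a..b}
    \<and> \<bar>I - (b - a) * (\<Prod>j\<in>{1..N}. real (2 * E j choose E j) / 4 ^ E j)\<bar> \<le> \<epsilon>"
    by (rule eventually_ball_finite) (use integral_prod_cos_power_limit[OF ind _ eps] ab in auto)
  thus ?thesis
  proof (rule eventually_mono, intro allI)
    fix n and \<beta> :: "nat \<Rightarrow> real"
    assume A: "\<forall>E\<in>insert E0 (E1 ` {1..N}). \<forall>\<beta>. \<exists>I.
      ((\<lambda>x. \<Prod>j\<in>{1..N}. cos (pi * (x * of_int (\<phi> j n) - \<beta> j)) ^ (2 * E j)) has_integral I) {a..b}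
      \<and> \<bar>I - (b - a) * (\<Prod>j\<in>{1..N}. real (2 * E j choose E j) / 4 ^ E j)\<bar> \<le> \<epsilon>"
    define u where "u j x = x * of_int (\<phi> j n) - \<beta> j" for j x
    define W where "W E x = (\<Prod>j\<in>{1..N}. cos (pi * u j x) ^ (2 * E j))" for E :: "nat \<Rightarrow> nat" and x
    obtain I0 where I0: "(W E0 has_integral I0) {a..b}" "\<bar>I0 - (b - a) * c ^ N\<bar> \<le> \<epsilon>"
      using A[rule_format, of E0 \<beta>] unfolding p0 W_def[abs_def] u_def by auto
    have "\<forall>i\<in>{1..N}. \<exists>I. (W (E1 i) has_integral I) {a..b} \<and> \<bar>I - (b - a) * (\<rho> * c ^ N)\<bar> \<le> \<epsilon>"
    proof
      fix i assume i: "i \<in> {1..N}"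
      show "\<exists>I. (W (E1 i) has_integral I) {a..b} \<and> \<bar>I - (b - a) * (\<rho> * c ^ N)\<bar> \<le> \<epsilon>"
        using A[rule_format, of "E1 i" \<beta>] i unfolding p1[OF i] W_def[abs_def] u_def by auto
    qed
    then obtain J where J: "\<And>i. i \<in> {1..N} \<Longrightarrow> (W (E1 i) has_integral J i) {a..b}"
      "\<And>i. i \<in> {1..N} \<Longrightarrow> \<bar>J i - (b - a) * (\<rho> * c ^ N)\<bar> \<le> \<epsilon>" by metis
    have W1: "W (E1 i) x = cos (pi * u i x) ^ 2 * W E0 x" if "i \<in> {1..N}" for i x
    proof -
      have "W (E1 i) x = (\<Prod>j\<in>{1..N}. (if j = i then cos (pi * u i x) ^ 2 else 1) * cos (pi * u j x) ^ (2 * L))"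
        unfolding W_def by (rule prod.cong[OF refl]) (auto simp: E1_def power2_eq_square)
      also have "\<dots> = cos (pi * u i x) ^ 2 * W E0 x"
        using that unfolding W_def E0_def by (simp add: prod.distrib)
      finally show ?thesis .
    qed
    have W0: "W E0 x \<ge> 0" for x unfolding W_def by (intro prod_nonneg) (auto simp: power_mult)
    let ?g = "\<lambda>x. (real N - \<eta>) * W E0 x - (\<Sum>i\<in>{1..N}. W (E1 i) x)"
    let ?s = "\<lambda>x. \<Sum>i\<in>{1..N}. sin (pi * u i x) ^ 2"
    have g: "?g x = (?s x - \<eta>) * W E0 x" for x
    proof -
      have "(\<Sum>i\<in>{1..N}. W (E1 i) x) = (\<Sum>i\<in>{1..N}. cos (pi * u i x) ^ 2 * W E0 x)"
        by (rule sum.cong[OF refl]) (simp only: W1)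
      also have "\<dots> = (\<Sum>i\<in>{1..N}. 1 - sin (pi * u i x) ^ 2) * W E0 x"
        by (simp add: sum_distrib_right cos_squared_eq)
      also have "\<dots> = (real N - ?s x) * W E0 x" by (simp add: sum_subtractf)
      finally show ?thesis by (simp add: algebra_simps)
    qed
    have int: "(?g has_integral ((real N - \<eta>) * I0 - (\<Sum>i\<in>{1..N}. J i))) {a..b}"
      by (intro has_integral_diff has_integral_mult_right has_integral_sum I0 J) auto
    have "\<exists>x\<in>{a..b}. ?s x < \<eta>"
    proof (rule ccontr)
      assume "\<not> ?thesis"
      hence "?g x \<ge> 0" if "x \<in> {a..b}" for x unfolding g using that W0[of x] by (auto simp: not_less)
      hence nn: "(real N - \<eta>) * I0 - (\<Sum>i\<in>{1..N}. J i) \<ge> 0" by (rule has_integral_nonneg[OF int])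
      have "(real N - \<eta>) * I0 \<le> (real N - \<eta>) * ((b - a) * c ^ N) + (real N + \<eta>) * \<epsilon>"
      proof -
        have "(real N - \<eta>) * (I0 - (b - a) * c ^ N) \<le> \<bar>real N - \<eta>\<bar> * \<bar>I0 - (b - a) * c ^ N\<bar>"
          using abs_ge_self[of "(real N - \<eta>) * (I0 - (b - a) * c ^ N)"] by (simp add: abs_mult)
        also have "\<dots> \<le> (real N + \<eta>) * \<epsilon>" using eta eps I0(2) by (intro mult_mono) auto
        finally show ?thesis by (simp add: algebra_simps)
      qed
      moreover have "(\<Sum>i\<in>{1..N}. J i) \<ge> (\<Sum>i\<in>{1..N}. (b - a) * (\<rho> * c ^ N) - \<epsilon>)"
        using J(2) by (intro sum_mono) (force simp: abs_le_iff)
      ultimately have "0 \<le> (real N - \<eta>) * ((b - a) * c ^ N) + (real N + \<eta>) * \<epsilon>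
          - real N * ((b - a) * (\<rho> * c ^ N) - \<epsilon>)" using nn by simp
      also have "\<dots> = (2 * real N + \<eta>) * \<epsilon> - ?G" by (simp add: algebra_simps)
      finally show False using small by linarith
    qed
    then obtain x where x: "x \<in> {a..b}" "?s x < \<eta>" by blast
    have "\<exists>z::int. \<bar>u j x - of_int z\<bar> \<le> \<delta>" if j: "j \<in> {1..N}" for j
    proof -
      have "sin (pi * u j x) ^ 2 \<le> ?s x" using j by (intro member_le_sum) auto
      hence "sin (pi * u j x) ^ 2 \<le> \<delta> ^ 2" using x unfolding \<eta>_def by linarith
      hence "\<bar>sin (pi * u j x)\<bar> \<le> \<delta>" using del by (simp add: abs_le_square_iff[symmetric])
      thus ?thesis using dist_int_le_sin[of "u j x"] by (meson order_trans)
    qed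
    thus "\<exists>x\<in>{a..b}. \<forall>j\<in>{1..N}. \<exists>z::int. \<bar>x * of_int (\<phi> j n) - \<beta> j - of_int z\<bar> \<le> \<delta>"
      using x unfolding u_def by blast
  qed
qed

section \<open>Random rotations read through a coarse partition\<close>

lemma int_div_less:
  fixes y q R :: int
  assumes "R > 0" "y < q * R"
  shows "y div R < q"
proof (rule ccontr)
  assume "\<not> y div R < q"
  hence "q * R \<le> y div R * R" using assms by (intro mult_right_mono) auto
  also have "\<dots> \<le> y" using assms by (simp add: minus_mod_eq_div_mult[symmetric])
  finally show False using assms by simp
qed

text \<open>
  An index \<open>i < q Q L\<close> is read in mixed radix as \<open>(s, w, t)\<close>, with \<open>s < q\<close> the number of the stretch, \<open>w < Q\<close> an
  initial phase and \<open>t < L\<close> a time. Within a run of \<open>L\<close> consecutive indices the phase starts at \<open>w\<close> and is rotated by \<open>p s\<close>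
  in the cycle of length \<open>Q\<close> at each step. Letting \<open>w\<close> run through all phases makes the distribution of the
  phase exactly uniform, whatever the rotation numbers are.
\<close>

definition stretch :: "int \<Rightarrow> int \<Rightarrow> int \<Rightarrow> int" where
  "stretch Q L i = i div L div Q"

definition phase :: "int \<Rightarrow> int \<Rightarrow> (int \<Rightarrow> int) \<Rightarrow> int \<Rightarrow> int" where
  "phase Q L p i = (i div L mod Q + (i mod L) * p (stretch Q L i)) mod Q"

lemma shift_within_stretch:
  fixes i L m Q :: int
  assumes "L > 0" "0 \<le> i mod L + m" "i mod L + m < L"
  shows "(i + m) div L = i div L" "stretch Q L (i + m) = stretch Q L i"
    "phase Q L p (i + m) = (phase Q L p i + m * p (stretch Q L i)) mod Q"
proof -
  have eq: "i + m = (i mod L + m) + L * (i div L)" by simp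
  show d: "(i + m) div L = i div L" by (subst eq, subst div_mult_self2) (use assms in auto)
  have md: "(i + m) mod L = i mod L + m" by (subst eq, subst mod_mult_self2) (use assms in auto)
  show s: "stretch Q L (i + m) = stretch Q L i" unfolding stretch_def d ..
  show "phase Q L p (i + m) = (phase Q L p i + m * p (stretch Q L i)) mod Q"
    unfolding phase_def s d md mod_add_left_eq distrib_right add.assoc ..
qed

lemma card_stretch_phase:
  fixes q Q L s :: int
  assumes pos: "Q > 0" "L > 0" and s: "0 \<le> s" "s < q" and Y: "Y \<subseteq> {0..<Q}"
  shows "card {i\<in>{0..<q * Q * L}. stretch Q L i = s \<and> phase Q L p i \<in> Y} = nat L * card Y"
proof -
  define G where "G = (\<lambda>(t, y). (s * Q + (y - t * p s) mod Q) * L + t)"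
  have G: "G (t, y) div L = s * Q + (y - t * p s) mod Q" "G (t, y) mod L = t"
    if "t \<in> {0..<L}" for t y
    using that pos unfolding G_def by auto
  have G2: "stretch Q L (G (t, y)) = s" "phase Q L p (G (t, y)) = y"
    if "t \<in> {0..<L}" "y \<in> Y" for t y
  proof -
    have y: "y mod Q = y" using that Y by auto
    show st: "stretch Q L (G (t, y)) = s" unfolding stretch_def G[OF that(1)]
      using pos by (simp add: div_add1_eq)
    show "phase Q L p (G (t, y)) = y" unfolding phase_def st G[OF that(1)]
      using y by (simp add: mod_add_left_eq)
  qed
  have "bij_betw G ({0..<L} \<times> Y) {i\<in>{0..<q * Q * L}. stretch Q L i = s \<and> phase Q L p i \<in> Y}"
  proof (rule bij_betw_byWitness[where f' = "\<lambda>i. (i mod L, phase Q L p i)"])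
    show "\<forall>a\<in>{0..<L} \<times> Y. (G a mod L, phase Q L p (G a)) = a" using G G2 by auto
    show "\<forall>i\<in>{i \<in> {0..<q * Q * L}. stretch Q L i = s \<and> phase Q L p i \<in> Y}. G (i mod L, phase Q L p i) = i"
    proof safe
      fix i assume i: "s = stretch Q L i"
      have "(phase Q L p i - i mod L * p (stretch Q L i)) mod Q = i div L mod Q"
        unfolding phase_def by (simp add: mod_diff_left_eq)
      moreover have "stretch Q L i * Q + i div L mod Q = i div L"
        unfolding stretch_def by simp
      ultimately show "G (i mod L, phase Q L p i) = i" unfolding G_def i by simp
    qed
    show "G ` ({0..<L} \<times> Y) \<subseteq> {i \<in> {0..<q * Q * L}. stretch Q L i = s \<and> phase Q L p i \<in> Y}"
    proof safe
      fix t y assume ty: "t \<in> {0..<L}" "y \<in> Y"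
      have c: "0 \<le> (y - t * p s) mod Q" "(y - t * p s) mod Q < Q" using pos by auto
      have c': "(y - t * p s) mod Q + 1 \<le> Q" using c by linarith
      have "(s * Q + (y - t * p s) mod Q) * L + t < (s * Q + (y - t * p s) mod Q + 1) * L"
        using ty by (simp add: algebra_simps)
      also have "\<dots> \<le> ((s + 1) * Q) * L" using c' pos by (intro mult_right_mono) (auto simp: distrib_right)
      also have "\<dots> \<le> (q * Q) * L" using s pos by (intro mult_right_mono) auto
      finally show "G (t, y) \<in> {0..<q * Q * L}" using c s ty pos unfolding G_def by auto
      show "stretch Q L (G (t, y)) = s" "phase Q L p (G (t, y)) \<in> Y" using G2 ty by auto
    qed
    show "(\<lambda>i. (i mod L, phase Q L p i)) ` {i \<in> {0..<q * Q * L}. stretch Q L i = s \<and> phase Q L p i \<in> Y}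
        \<subseteq> {0..<L} \<times> Y" using pos by auto
  qed
  hence "card {i\<in>{0..<q * Q * L}. stretch Q L i = s \<and> phase Q L p i \<in> Y} = card ({0..<L} \<times> Y)"
    by (simp add: bij_betw_same_card)
  thus ?thesis by (simp add: card_cartesian_product)
qed

lemma stretch_bounds:
  fixes q Q L i :: int
  assumes "Q > 0" "L > 0" "i \<in> {0..<q * Q * L}"
  shows "stretch Q L i \<in> {0..<q}" "phase Q L p i \<in> {0..<Q}"
proof -
  have "i div L < q * Q" using assms by (simp add: int_div_less)
  hence "i div L div Q < q" using assms by (simp add: int_div_less)
  thus "stretch Q L i \<in> {0..<q}" unfolding stretch_def using assms by (simp add: pos_imp_zdiv_nonneg_iff)
  show "phase Q L p i \<in> {0..<Q}" unfolding phase_def using assms by simp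
qed

lemma card_residue_in:
  fixes R q :: int
  assumes "R > 0" "q \<ge> 0" "B \<subseteq> {0..<R}"
  shows "card {y\<in>{0..<q * R}. y mod R \<in> B} = nat q * card B"
proof -
  have "bij_betw (\<lambda>(a, b). a * R + b) ({0..<q} \<times> B) {y\<in>{0..<q * R}. y mod R \<in> B}"
  proof (rule bij_betw_byWitness[where f' = "\<lambda>y. (y div R, y mod R)"])
    show "\<forall>a\<in>{0..<q} \<times> B. ((case a of (a, b) \<Rightarrow> a * R + b) div R, (case a of (a, b) \<Rightarrow> a * R + b) mod R) = a"
      using assms by auto
    show "\<forall>y\<in>{y \<in> {0..<q * R}. y mod R \<in> B}. (case (y div R, y mod R) of (a, b) \<Rightarrow> a * R + b) = y" by simp
    show "(\<lambda>(a, b). a * R + b) ` ({0..<q} \<times> B) \<subseteq> {y \<in> {0..<q * R}. y mod R \<in> B}"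
    proof safe
      fix a b assume ab: "a \<in> {0..<q}" "b \<in> B"
      have b: "0 \<le> b" "b < R" using ab assms by auto
      have "a * R + b < (a + 1) * R" using b by (simp add: algebra_simps)
      also have "\<dots> \<le> q * R" using ab assms by (intro mult_right_mono) auto
      finally show "a * R + b \<in> {0..<q * R}" using ab b assms by auto
      show "(a * R + b) mod R \<in> B" using b ab by simp
    qed
    show "(\<lambda>y. (y div R, y mod R)) ` {y \<in> {0..<q * R}. y mod R \<in> B} \<subseteq> {0..<q} \<times> B"
      using assms by (auto simp: int_div_less pos_imp_zdiv_nonneg_iff)
  qed
  hence "card {y\<in>{0..<q * R}. y mod R \<in> B} = card ({0..<q} \<times> B)" by (simp add: bij_betw_same_card)
  thus ?thesis by (simp add: card_cartesian_product)
qed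

lemma card_stretch_block:
  fixes q R L s a :: int
  assumes "R > 0" "L > 0" "0 \<le> s" "s < q" "0 \<le> a" "a < q"
  shows "card {i\<in>{0..<q * (q * R) * L}. stretch (q * R) L i = s \<and> phase (q * R) L p i div R = a}
    = nat L * nat R"
proof -
  have eq: "y div R = a \<longleftrightarrow> y \<in> {a * R..<(a + 1) * R}" for y
  proof
    assume "y div R = a"
    hence "y = a * R + y mod R" using div_mult_mod_eq[of y R] by simp
    moreover have "0 \<le> y mod R" "y mod R < R" using assms by auto
    ultimately show "y \<in> {a * R..<(a + 1) * R}" unfolding distrib_right by auto
  next
    assume y: "y \<in> {a * R..<(a + 1) * R}"
    show "y div R = a"
      by (rule int_div_pos_eq[of _ _ _ "y - a * R"]) (use y in \<open>auto simp: algebra_simps\<close>)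
  qed
  have sub: "{a * R..<(a + 1) * R} \<subseteq> {0..<q * R}"
  proof -
    have "(a + 1) * R \<le> q * R" using assms by (intro mult_right_mono) auto
    moreover have "0 \<le> a * R" using assms by simp
    ultimately show ?thesis by auto
  qed
  have "card {a * R..<(a + 1) * R} = nat R" by (simp add: algebra_simps)
  thus ?thesis unfolding eq
    using card_stretch_phase[OF _ assms(2,3,4) sub, of p] assms by simp
qed

lemma phase_div_less:
  fixes q R y :: int
  assumes "R > 0" "y \<in> {0..<q * R}"
  shows "y div R \<in> {0..<q}"
  using assms by (simp add: int_div_less pos_imp_zdiv_nonneg_iff)

lemma card_vimage_eq_sum:
  assumes "finite S" "finite Z"
  shows "card {i\<in>S. g i \<in> Z} = (\<Sum>z\<in>Z. card {i\<in>S. g i = z})"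
proof -
  have "{i\<in>S. g i \<in> Z} = (\<Union>z\<in>Z. {i\<in>S. g i = z})" by auto
  also have "card \<dots> = (\<Sum>z\<in>Z. card {i\<in>S. g i = z})"
    using assms by (intro card_UN_disjoint) auto
  finally show ?thesis .
qed

lemma card_stretch_block_pred:
  fixes q R L :: int
  assumes "q > 0" "R > 0" "L > 0" "Z \<subseteq> {0..<q} \<times> {0..<q}"
  shows "card {i\<in>{0..<q * (q * R) * L}. (stretch (q * R) L i, phase (q * R) L p i div R) \<in> Z}
    = nat L * nat R * card Z"
proof -
  let ?g = "\<lambda>i. (stretch (q * R) L i, phase (q * R) L p i div R)"
  have finZ: "finite Z" using assms(4) by (rule finite_subset) simp
  have "card {i\<in>{0..<q * (q * R) * L}. ?g i \<in> Z} = (\<Sum>z\<in>Z. card {i\<in>{0..<q * (q * R) * L}. ?g i = z})"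
    by (rule card_vimage_eq_sum[OF finite_atLeastLessThan_int finZ])
  also have "\<dots> = (\<Sum>z\<in>Z. nat L * nat R)"
  proof (rule sum.cong[OF refl])
    fix z assume "z \<in> Z"
    then obtain s a where z: "z = (s, a)" "s \<in> {0..<q}" "a \<in> {0..<q}" using assms(4) by blast
    show "card {i\<in>{0..<q * (q * R) * L}. ?g i = z} = nat L * nat R"
      unfolding z(1) prod.inject by (rule card_stretch_block) (use z assms in auto)
  qed
  finally show ?thesis by simp
qed

text \<open>
  Adding an amount close to \<open>v\<close> blocks moves a position by exactly \<open>v\<close> blocks unless it lies near the end of
  its block.
\<close>

lemma shift_block:
  fixes y q R D c v z :: int
  assumes "R > 0" "q > 0" "\<bar>c - v * R - z * (q * R)\<bar> \<le> D" "D \<le> y mod R" "y mod R < R - D"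
  shows "((y + c) mod (q * R)) div R = (y div R + v) mod q"
proof -
  define e where "e = c - v * R - z * (q * R)"
  have e: "0 \<le> y mod R + e" "y mod R + e < R" using assms unfolding e_def by linarith+
  have "y + c = (y div R * R + y mod R) + (e + v * R + z * (q * R))" unfolding e_def by simp
  also have "\<dots> = (y mod R + e) + R * (y div R + v + z * q)" by (simp add: algebra_simps)
  finally have yc: "y + c = (y mod R + e) + R * (y div R + v + z * q)" .
  have "(y + c) div R = y div R + v + z * q"
    by (subst yc, subst div_mult_self2) (use e assms in auto)
  moreover have "((y + c) mod (q * R)) div R = ((y + c) div R) mod q"
    using zmod_zmult2_eq[of q "y + c" R] assms by (simp add: mult.commute)
  ultimately show ?thesis by simp
qed

text \<open>
  The two terms count the indices whose shift by \<open>m\<close> leaves the current run of length \<open>L\<close>, and those whose phase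
  lies within \<open>D\<close> of the boundary of a block.
\<close>

lemma card_bad_shift:
  fixes q R L m D :: int
  assumes pos: "q > 0" "R > 0" "L > 0" and D: "D \<ge> 0"
    and close: "\<And>s. s \<in> {0..<q} \<Longrightarrow> \<exists>z. \<bar>m * p s - v s * R - z * (q * R)\<bar> \<le> D"
  defines "Q \<equiv> q * R" and "q' \<equiv> q * (q * R) * L"
  shows "int (card {i\<in>{0..<q'}. phase Q L p ((i + m) mod q') div R
      \<noteq> (phase Q L p i div R + v (stretch Q L i)) mod q}) \<le> \<bar>m\<bar> * (q * Q) + 2 * D * (q * q * L)"
proof -
  have Q: "Q > 0" unfolding Q_def using pos by simp
  have q': "q' = q * Q * L" unfolding Q_def q'_def by simp
  define T where "T = {t\<in>{0..<L}. \<not> (0 \<le> t + m \<and> t + m < L)}"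
  define E where "E = {b\<in>{0..<R}. \<not> (D \<le> b \<and> b < R - D)}"
  define Y where "Y = {y\<in>{0..<Q}. y mod R \<in> E}"
  define B1 where "B1 = {i\<in>{0..<q * Q * L}. i mod L \<in> T}"
  define B2 where "B2 s = {i\<in>{0..<q * Q * L}. stretch Q L i = s \<and> phase Q L p i \<in> Y}" for s
  have fin1: "finite B1" unfolding B1_def by (rule finite_subset[of _ "{0..<q * Q * L}"]) auto
  have fin2: "finite (B2 s)" for s unfolding B2_def by (rule finite_subset[of _ "{0..<q * Q * L}"]) auto
  have "card T \<le> nat \<bar>m\<bar>"
  proof -
    have "T \<subseteq> (if m \<ge> 0 then {L - m..<L} else {0..<- m})" unfolding T_def by auto
    hence "card T \<le> card (if m \<ge> 0 then {L - m..<L} else {0..<- m})" by (intro card_mono) auto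
    thus ?thesis by (auto split: if_splits)
  qed
  moreover have "card B1 = nat (q * Q) * card T" unfolding B1_def
    by (rule card_residue_in) (use pos Q in \<open>auto simp: T_def\<close>)
  ultimately have "card B1 \<le> nat (q * Q) * nat \<bar>m\<bar>" by simp
  hence "int (card B1) \<le> int (nat (q * Q) * nat \<bar>m\<bar>)" by (simp only: of_nat_le_iff)
  hence b1: "int (card B1) \<le> \<bar>m\<bar> * (q * Q)" using pos Q by (simp add: mult.commute)
  have "card E \<le> nat (2 * D)"
  proof -
    have "E \<subseteq> {0..<D} \<union> {R - D..<R}" unfolding E_def by auto
    hence "card E \<le> card ({0..<D} \<union> {R - D..<R})" by (intro card_mono) auto
    also have "\<dots> \<le> card {0..<D} + card {R - D..<R}" by (rule card_Un_le)
    finally show ?thesis using D by simp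
  qed
  moreover have "card Y = nat q * card E" unfolding Y_def Q_def
    by (rule card_residue_in) (use pos in \<open>auto simp: E_def\<close>)
  ultimately have cY: "card Y \<le> nat q * nat (2 * D)" by simp
  have cB2: "int (card (B2 s)) \<le> L * (q * (2 * D))" if "s \<in> {0..<q}" for s
  proof -
    have "card (B2 s) = nat L * card Y" unfolding B2_def
      by (rule card_stretch_phase) (use that Q pos in \<open>auto simp: Y_def\<close>)
    hence "card (B2 s) \<le> nat L * (nat q * nat (2 * D))" using cY by simp
    hence "int (card (B2 s)) \<le> int (nat L * (nat q * nat (2 * D)))" by (simp only: of_nat_le_iff)
    thus ?thesis using pos D by simp
  qed
  have "{i\<in>{0..<q'}. phase Q L p ((i + m) mod q') div R
      \<noteq> (phase Q L p i div R + v (stretch Q L i)) mod q} \<subseteq> B1 \<union> (\<Union>s\<in>{0..<q}. B2 s)"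
  proof
    fix i assume "i \<in> {i\<in>{0..<q'}. phase Q L p ((i + m) mod q') div R
      \<noteq> (phase Q L p i div R + v (stretch Q L i)) mod q}"
    hence i': "i \<in> {0..<q'}" and ne: "phase Q L p ((i + m) mod q') div R
      \<noteq> (phase Q L p i div R + v (stretch Q L i)) mod q" by blast+
    have i: "i \<in> {0..<q * Q * L}" using i' by (simp only: q')
    note sb = stretch_bounds[OF Q pos(3) i]
    show "i \<in> B1 \<union> (\<Union>s\<in>{0..<q}. B2 s)"
    proof (rule ccontr)
      assume n: "i \<notin> B1 \<union> (\<Union>s\<in>{0..<q}. B2 s)"
      hence t: "0 \<le> i mod L + m" "i mod L + m < L" using i pos unfolding B1_def T_def by auto
      have "phase Q L p i \<notin> Y" using n i sb unfolding B2_def by auto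
      hence y: "D \<le> phase Q L p i mod R" "phase Q L p i mod R < R - D"
        using sb(2)[of p] pos unfolding Y_def E_def by auto
      note sh = shift_within_stretch[OF pos(3) t]
      have "i div L < q * Q" using i pos by (simp add: int_div_less)
      hence "(i + m) div L < q * Q" "(i + m) div L \<ge> 0"
        using sh(1) i pos by (simp_all add: pos_imp_zdiv_nonneg_iff)
      hence "i + m \<in> {0..<q'}"
      proof -
        assume h: "(i + m) div L < q * Q" "(i + m) div L \<ge> 0"
        have "i + m = (i + m) div L * L + (i + m) mod L" "(i + m) mod L < L" using pos by simp_all
        hence "i + m < ((i + m) div L + 1) * L" unfolding distrib_right by linarith
        also have "\<dots> \<le> q * Q * L" using h pos by (intro mult_right_mono) auto
        finally show ?thesis using h pos unfolding q' by (simp add: pos_imp_zdiv_nonneg_iff)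
      qed
      hence md: "(i + m) mod q' = i + m" by simp
      obtain z where z: "\<bar>m * p (stretch Q L i) - v (stretch Q L i) * R - z * (q * R)\<bar> \<le> D"
        using close[OF sb(1)] by blast
      have "phase Q L p ((i + m) mod q') div R = (phase Q L p i div R + v (stretch Q L i)) mod q"
        unfolding md sh(3)[where Q=Q and p=p]
        by (rule shift_block[OF pos(2,1) z y, folded Q_def])
      thus False using ne by simp
    qed
  qed
  hence "card {i\<in>{0..<q'}. phase Q L p ((i + m) mod q') div R
      \<noteq> (phase Q L p i div R + v (stretch Q L i)) mod q} \<le> card (B1 \<union> (\<Union>s\<in>{0..<q}. B2 s))"
    by (rule card_mono[rotated]) (use fin1 fin2 in blast)
  also have "\<dots> \<le> card B1 + card (\<Union>s\<in>{0..<q}. B2 s)" by (rule card_Un_le)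
  also have "\<dots> \<le> card B1 + (\<Sum>s\<in>{0..<q}. card (B2 s))"
    by (intro add_left_mono card_UN_le finite_atLeastLessThan_int)
  finally have "int (card {i\<in>{0..<q'}. phase Q L p ((i + m) mod q') div R
      \<noteq> (phase Q L p i div R + v (stretch Q L i)) mod q}) \<le> int (card B1 + (\<Sum>s\<in>{0..<q}. card (B2 s)))"
    by (simp only: of_nat_le_iff)
  also have "\<dots> = int (card B1) + (\<Sum>s\<in>{0..<q}. int (card (B2 s)))"
    by (simp only: of_nat_sum of_nat_add)
  finally have 1: "int (card {i\<in>{0..<q'}. phase Q L p ((i + m) mod q') div R
      \<noteq> (phase Q L p i div R + v (stretch Q L i)) mod q}) \<le> int (card B1) + (\<Sum>s\<in>{0..<q}. int (card (B2 s)))" .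
  have "(\<Sum>s\<in>{0..<q}. int (card (B2 s))) \<le> (\<Sum>s\<in>{0..<q}. L * (q * (2 * D)))"
    by (intro sum_mono cB2)
  also have "\<dots> = 2 * D * (q * q * L)" using pos by simp
  finally show ?thesis using b1 1 by linarith
qed

lemma card_diff_le:
  assumes "finite S" "\<And>i. i \<in> S \<Longrightarrow> P i \<noteq> P' i \<Longrightarrow> Bd i"
  shows "\<bar>real (card {i\<in>S. P i}) - real (card {i\<in>S. P' i})\<bar> \<le> real (card {i\<in>S. Bd i})"
proof -
  have a: "card {i\<in>S. P i} \<le> card {i\<in>S. P' i} + card {i\<in>S. Bd i}"
    if "\<And>i. i \<in> S \<Longrightarrow> P i \<noteq> P' i \<Longrightarrow> Bd i" for P P'
  proof -
    have "card {i\<in>S. P i} \<le> card ({i\<in>S. P' i} \<union> {i\<in>S. Bd i})"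
      using assms(1) that by (intro card_mono) auto
    also have "\<dots> \<le> card {i\<in>S. P' i} + card {i\<in>S. Bd i}" by (rule card_Un_le)
    finally show ?thesis .
  qed
  from a[of P P'] a[of P' P] assms(2) show ?thesis by fastforce
qed

lemma card_rotated_pairs:
  fixes q :: int
  assumes "q > 0" "A \<subseteq> {0..<q}" "B \<subseteq> {0..<q}"
  shows "card {(s, a). s \<in> {0..<q} \<and> a \<in> A \<and> (a + s) mod q \<in> B} = card A * card B"
proof -
  have "bij_betw (\<lambda>(a, b). ((b - a) mod q, a)) (A \<times> B)
      {(s, a). s \<in> {0..<q} \<and> a \<in> A \<and> (a + s) mod q \<in> B}"
  proof (rule bij_betw_byWitness[where f' = "\<lambda>(s, a). (a, (a + s) mod q)"])
    show "\<forall>z\<in>A \<times> B. (case case z of (a, b) \<Rightarrow> ((b - a) mod q, a) of (s, a) \<Rightarrow> (a, (a + s) mod q)) = z"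
      using assms by (auto simp: mod_add_right_eq)
    show "\<forall>z\<in>{(s, a). s \<in> {0..<q} \<and> a \<in> A \<and> (a + s) mod q \<in> B}.
        (case case z of (s, a) \<Rightarrow> (a, (a + s) mod q) of (a, b) \<Rightarrow> ((b - a) mod q, a)) = z"
      using assms by (auto simp: mod_diff_left_eq)
    show "(\<lambda>(a, b). ((b - a) mod q, a)) ` (A \<times> B)
        \<subseteq> {(s, a). s \<in> {0..<q} \<and> a \<in> A \<and> (a + s) mod q \<in> B}"
      using assms by (auto simp: mod_add_right_eq)
    show "(\<lambda>(s, a). (a, (a + s) mod q)) ` {(s, a). s \<in> {0..<q} \<and> a \<in> A \<and> (a + s) mod q \<in> B} \<subseteq> A \<times> B"
      by auto
  qed
  from bij_betw_same_card[OF this] show ?thesis by (simp add: card_cartesian_product)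
qed

text \<open>
  Here \<open>\<pi> i\<close> is the arc containing the \<open>i\<close>-th point of the concatenated rotations by \<open>x s\<close>. A shift by \<open>m j\<close> advances the
  arc by \<open>\<xi> j * s\<close> except on few indices, where \<open>s\<close> is the stretch of the index. As arc and stretch are jointly uniform, the pair of
  arcs at distance \<open>m j\<close> is either nearly diagonal or nearly independent. A shift by 1 advances the arc by 1,
  since \<open>x s\<close> is near \<open>1 / q\<close>; this is the same counting with the constant advance 1.
\<close>

lemma drift_coding:
  fixes q C :: int and m \<xi> :: "nat \<Rightarrow> int" and x :: "int \<Rightarrow> real" and \<epsilon> \<delta> :: real
  assumes q: "q > 0" and eps: "\<epsilon> > 0" and del: "\<delta> > 0"
    and xi: "\<And>j. j \<in> {1..N} \<Longrightarrow> \<xi> j \<in> {0, 1}"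
    and x: "\<And>s. s \<in> {0..<q} \<Longrightarrow> 1 / q \<le> x s \<and> x s \<le> (1 + \<epsilon>) / q"
    and close: "\<And>s j. s \<in> {0..<q} \<Longrightarrow> j \<in> {1..N} \<Longrightarrow> \<exists>z::int. \<bar>x s * m j - \<xi> j * s / q - z\<bar> \<le> \<delta>"
  obtains r \<pi> where "r > 0" "q * r \<ge> C" "\<And>i. i \<in> {0..<q * r} \<Longrightarrow> \<pi> i \<in> {0..<q}"
    "\<And>a. a \<in> {0..<q} \<Longrightarrow> card {i\<in>{0..<q * r}. \<pi> i = a} = nat r"
    "card {i\<in>{0..<q * r}. \<pi> ((i + 1) mod (q * r)) \<noteq> (\<pi> i + 1) mod q} \<le> 3 * \<epsilon> * (q * r)"
    "\<And>j A B. j \<in> {1..N} \<Longrightarrow> A \<subseteq> {0..<q} \<Longrightarrow> B \<subseteq> {0..<q} \<Longrightarrow>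
      \<bar>card {i\<in>{0..<q * r}. \<pi> i \<in> A \<and> \<pi> ((i + m j) mod (q * r)) \<in> B} / (q * r)
        - (if \<xi> j = 0 then card (A \<inter> B) / q else (card A / q) * (card B / q))\<bar> \<le> 5 * \<delta> * q"
proof -
  \<comment> \<open>\<open>R\<close> is large enough that rounding \<open>x s\<close> to a multiple of \<open>1 / (q R)\<close> changes \<open>x s * m j\<close> by at most \<open>\<delta>\<close>, and
    \<open>L\<close> is large enough that few indices lie within \<open>\<bar>m j\<bar>\<close> of the end of a run.\<close>
  define M where "M = 1 + (\<Sum>j\<in>{1..N}. \<bar>m j\<bar>)"
  have M: "\<bar>m j\<bar> \<le> M" if "j \<in> {1..N}" for j
    using member_le_sum[OF that, of "\<lambda>j. \<bar>m j\<bar>"] unfolding M_def by auto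
  have M1: "M \<ge> 1" unfolding M_def by (simp add: sum_nonneg)
  define R where "R = \<lceil>M / \<delta>\<rceil>"
  have R: "M \<le> \<delta> * R" unfolding R_def using del
    by (metis le_of_int_ceiling mult.commute pos_divide_le_eq)
  have R0: "R > 0" unfolding R_def using M1 del by simp
  define L where "L = max C (max \<lceil>M / \<delta>\<rceil> \<lceil>1 / \<epsilon>\<rceil>)"
  have "real_of_int \<lceil>M / \<delta>\<rceil> \<le> L" "real_of_int \<lceil>1 / \<epsilon>\<rceil> \<le> L" unfolding L_def by linarith+
  hence "M / \<delta> \<le> L" "1 / \<epsilon> \<le> L" by linarith+
  hence L: "M \<le> \<delta> * L" "1 \<le> \<epsilon> * L" using eps del by (simp_all add: field_simps)
  have L0: "L > 0" "L \<ge> C" unfolding L_def using M1 del by (simp_all add: less_max_iff_disj)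
  define p where "p s = \<lfloor>x s * (q * R)\<rfloor>" for s
  define \<pi> where "\<pi> i = phase (q * R) L p i div R" for i
  define r where "r = q * R * L"
  have q': "q * (q * R) * L = q * r" unfolding r_def by simp
  have r0: "r > 0" unfolding r_def using q R0 L0 by simp
  have QR: "R \<le> q * R" using q R0 by simp
  have QRr: "real_of_int R \<le> q * R" using QR by (metis of_int_le_iff of_int_mult)
  have pix: "\<pi> i \<in> {0..<q}" if "i \<in> {0..<q * r}" for i
    unfolding \<pi>_def using that q R0 L0 phase_div_less[OF R0] stretch_bounds(2)[of "q * R" L i q p] q' by auto
  have count: "card {i\<in>{0..<q * r}. (stretch (q * R) L i, \<pi> i) \<in> Z} = nat L * nat R * card Z"
    if "Z \<subseteq> {0..<q} \<times> {0..<q}" for Z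
    using card_stretch_block_pred[OF q R0 L0(1) that, of p] unfolding q' \<pi>_def .
  have strip: "stretch (q * R) L i \<in> {0..<q}" if "i \<in> {0..<q * r}" for i
    using stretch_bounds(1)[of "q * R" L i q] that q R0 L0 q' by auto
  have fib: "card {i\<in>{0..<q * r}. \<pi> i = a} = nat r" if a: "a \<in> {0..<q}" for a
  proof -
    have eq: "{i\<in>{0..<q * r}. \<pi> i = a} = {i\<in>{0..<q * r}. (stretch (q * R) L i, \<pi> i) \<in> {0..<q} \<times> {a}}"
      using strip by auto
    have "card {i\<in>{0..<q * r}. \<pi> i = a} = nat L * nat R * card ({0..<q} \<times> {a})"
      unfolding eq by (rule count) (use a in auto)
    also have "\<dots> = nat r" unfolding r_def using q R0 L0 by (simp add: card_cartesian_product nat_mult_distrib)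
    finally show ?thesis .
  qed
  have bad: "real (card {i\<in>{0..<q * r}. \<pi> ((i + k) mod (q * r)) \<noteq> (\<pi> i + v (stretch (q * R) L i)) mod q})
      \<le> real_of_int \<bar>k\<bar> * real_of_int (q * (q * R)) + 2 * real_of_int \<lfloor>D\<rfloor> * real_of_int (q * q * L)"
    if D0: "D \<ge> 0" and Dc: "\<And>s. s \<in> {0..<q} \<Longrightarrow> \<exists>z. \<bar>real_of_int (k * p s - v s * R - z * (q * R))\<bar> \<le> D" for k v D
  proof -
    have "\<exists>z. \<bar>k * p s - v s * R - z * (q * R)\<bar> \<le> \<lfloor>D\<rfloor>" if sq: "s \<in> {0..<q}" for s
    proof -
      obtain z where "\<bar>real_of_int (k * p s - v s * R - z * (q * R))\<bar> \<le> D" using Dc[OF sq] by blast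
      hence "real_of_int \<bar>k * p s - v s * R - z * (q * R)\<bar> \<le> D" by (simp only: of_int_abs)
      thus ?thesis unfolding le_floor_iff by blast
    qed
    from card_bad_shift[OF q R0 L0(1) _ this] D0
    have "int (card {i\<in>{0..<q * r}. \<pi> ((i + k) mod (q * r)) \<noteq> (\<pi> i + v (stretch (q * R) L i)) mod q})
      \<le> \<bar>k\<bar> * (q * (q * R)) + 2 * \<lfloor>D\<rfloor> * (q * q * L)" unfolding q' \<pi>_def by simp
    hence "real_of_int (int (card {i\<in>{0..<q * r}. \<pi> ((i + k) mod (q * r)) \<noteq> (\<pi> i + v (stretch (q * R) L i)) mod q}))
      \<le> real_of_int (\<bar>k\<bar> * (q * (q * R)) + 2 * \<lfloor>D\<rfloor> * (q * q * L))" by (simp only: of_int_le_iff)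
    thus ?thesis by simp
  qed
  have qqR: "real_of_int (q * (q * R)) \<ge> 0" "real_of_int (q * q * L) \<ge> 0" using q R0 L0 by simp_all
  have pb: "x s * (q * R) - 1 < p s" "p s \<le> x s * (q * R)" for s
    unfolding p_def by linarith+
  show ?thesis
  proof (rule that[of r \<pi>])
    show "r > 0" by (rule r0)
    have "1 * C \<le> q * q * R * L \<or> C \<le> 0"
    proof (cases "C \<le> 0")
      case False
      have "1 \<le> q * q * R" using q R0 by (simp add: int_one_le_iff_zero_less)
      hence "1 * L \<le> q * q * R * L" using L0 by (intro mult_right_mono) auto
      thus ?thesis using L0 by linarith
    qed simp
    thus "C \<le> q * r" unfolding r_def using q R0 L0
      by (smt (verit) mult.assoc mult_1 mult_pos_pos)
    show "\<pi> i \<in> {0..<q}" if "i \<in> {0..<q * r}" for i by (rule pix[OF that])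
    show "card {i\<in>{0..<q * r}. \<pi> i = a} = nat r" if "a \<in> {0..<q}" for a by (rule fib[OF that])
    show "card {i\<in>{0..<q * r}. \<pi> ((i + 1) mod (q * r)) \<noteq> (\<pi> i + 1) mod q} \<le> 3 * \<epsilon> * (q * r)"
    proof -
      have "\<exists>z. \<bar>real_of_int (1 * p s - 1 * R - z * (q * R))\<bar> \<le> \<epsilon> * R" if s: "s \<in> {0..<q}" for s
      proof (intro exI[of _ 0])
        have "real_of_int (q * R) \<ge> 0" using q R0 by simp
        hence "1 / q * (q * R) \<le> x s * (q * R)" "x s * (q * R) \<le> (1 + \<epsilon>) / q * (q * R)"
          using x[OF s] by (blast intro: mult_right_mono)+
        moreover have "1 / q * (q * R) = R" "(1 + \<epsilon>) / q * (q * R) = (1 + \<epsilon>) * R" using q by simp_all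
        ultimately have xs: "R \<le> x s * (q * R)" "x s * (q * R) \<le> (1 + \<epsilon>) * R" by simp_all
        have "R \<le> p s" unfolding p_def using xs(1) by (simp add: le_floor_iff)
        moreover have "real_of_int (p s) \<le> (1 + \<epsilon>) * R" using pb[of s] xs(2) by linarith
        ultimately show "\<bar>real_of_int (1 * p s - 1 * R - 0 * (q * R))\<bar> \<le> \<epsilon> * R"
          by (simp add: distrib_right)
      qed
      from bad[OF _ this] have "real (card {i\<in>{0..<q * r}. \<pi> ((i + 1) mod (q * r)) \<noteq> (\<pi> i + 1) mod q})
        \<le> 1 * real_of_int (q * (q * R)) + 2 * real_of_int \<lfloor>\<epsilon> * R\<rfloor> * real_of_int (q * q * L)" using eps R0 by simp
      also have "\<dots> \<le> (\<epsilon> * L) * real_of_int (q * (q * R)) + 2 * (\<epsilon> * R) * real_of_int (q * q * L)"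
        using L(2) qqR by (intro add_mono mult_right_mono mult_left_mono) auto
      also have "\<dots> = 3 * \<epsilon> * (q * r)" unfolding r_def by (simp add: algebra_simps)
      finally show ?thesis .
    qed
    fix j A B assume j: "j \<in> {1..N}" and AB: "A \<subseteq> {0..<q}" "B \<subseteq> {0..<q}"
    let ?S = "{0..<q * r}"
    let ?st = "stretch (q * R) L"
    have "\<exists>z. \<bar>real_of_int (m j * p s - (\<xi> j * s) * R - z * (q * R))\<bar> \<le> 2 * \<delta> * (q * R)" if s: "s \<in> {0..<q}" for s
    proof -
      obtain z :: int where z: "\<bar>x s * m j - \<xi> j * s / q - z\<bar> \<le> \<delta>" using close[OF s j] by blast
      define \<theta> where "\<theta> = x s * (q * R) - p s"
      have th: "0 \<le> \<theta>" "\<theta> \<le> 1" using pb[of s] unfolding \<theta>_def by auto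
      have e: "real_of_int (m j * p s - (\<xi> j * s) * R - z * (q * R))
          = (x s * m j - \<xi> j * s / q - z) * (q * R) - m j * \<theta>"
        unfolding \<theta>_def using q by (simp add: field_simps)
      have "\<bar>\<dots>\<bar> \<le> \<bar>x s * m j - \<xi> j * s / q - z\<bar> * (q * R) + \<bar>m j\<bar> * \<theta>"
        using abs_triangle_ineq4[of "(x s * m j - \<xi> j * s / q - z) * (q * R)" "m j * \<theta>"] th q R0
        by (simp add: abs_mult)
      also have "\<dots> \<le> \<delta> * (q * R) + real_of_int M * 1"
      proof (intro add_mono mult_right_mono mult_mono)
        show "real_of_int \<bar>m j\<bar> \<le> M" using M[OF j] by linarith
      qed (use z th q R0 M1 in auto)
      also have "real_of_int M * 1 \<le> \<delta> * (q * R)"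
        using R mult_left_mono[OF QRr, of \<delta>] del by linarith
      finally show ?thesis unfolding e[symmetric] by (intro exI[of _ z]) (simp add: mult.assoc mult.commute mult.left_commute)
    qed
    from bad[OF _ this] have "real (card {i\<in>?S. \<pi> ((i + m j) mod (q * r)) \<noteq> (\<pi> i + \<xi> j * ?st i) mod q})
      \<le> real_of_int \<bar>m j\<bar> * real_of_int (q * (q * R)) + 2 * real_of_int \<lfloor>2 * \<delta> * (q * R)\<rfloor> * real_of_int (q * q * L)" using del q R0 by simp
    also have "\<dots> \<le> (\<delta> * L) * real_of_int (q * (q * R)) + 2 * (2 * \<delta> * (q * R)) * real_of_int (q * q * L)"
    proof (intro add_mono mult_right_mono mult_left_mono)
      show "real_of_int \<bar>m j\<bar> \<le> \<delta> * L" using M[OF j] L(1) by linarith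
    qed (use qqR in auto)
    also have "\<dots> = \<delta> * (q * r) + 4 * \<delta> * q * (q * r)" unfolding r_def by (simp add: algebra_simps)
    also have "\<dots> \<le> \<delta> * q * (q * r) + 4 * \<delta> * q * (q * r)"
    proof (intro add_right_mono mult_right_mono)
      have "\<delta> * 1 \<le> \<delta> * q" using q del by (intro mult_left_mono) auto
      thus "\<delta> \<le> \<delta> * q" by simp
    qed (use q r0 in auto)
    finally have bd: "real (card {i\<in>?S. \<pi> ((i + m j) mod (q * r)) \<noteq> (\<pi> i + \<xi> j * ?st i) mod q})
      \<le> 5 * \<delta> * q * (q * r)" by simp
    have "\<bar>real (card {i\<in>?S. \<pi> i \<in> A \<and> \<pi> ((i + m j) mod (q * r)) \<in> B})
        - real (card {i\<in>?S. \<pi> i \<in> A \<and> (\<pi> i + \<xi> j * ?st i) mod q \<in> B})\<bar> \<le> 5 * \<delta> * q * (q * r)"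
      by (rule order_trans[OF card_diff_le bd]) auto
    also have "card {i\<in>?S. \<pi> i \<in> A \<and> (\<pi> i + \<xi> j * ?st i) mod q \<in> B}
       = (if \<xi> j = 0 then card (A \<inter> B) / q else (card A / q) * (card B / q)) * (q * r)"
    proof -
      define Z where "Z = {(s, a). s \<in> {0..<q} \<and> a \<in> A \<and> (a + \<xi> j * s) mod q \<in> B}"
      have "Z \<subseteq> {0..<q} \<times> {0..<q}" using AB unfolding Z_def by auto
      moreover have "{i\<in>?S. \<pi> i \<in> A \<and> (\<pi> i + \<xi> j * ?st i) mod q \<in> B} = {i\<in>?S. (?st i, \<pi> i) \<in> Z}"
        unfolding Z_def using strip by auto
      ultimately have c: "card {i\<in>?S. \<pi> i \<in> A \<and> (\<pi> i + \<xi> j * ?st i) mod q \<in> B} = nat L * nat R * card Z"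
        using count by simp
      show ?thesis
      proof (cases "\<xi> j = 0")
        case True
        have am: "a mod q = a" if "a \<in> A" for a using that AB(1) by auto
        have "Z = {0..<q} \<times> (A \<inter> B)" unfolding Z_def using True am by auto
        hence "card Z = nat q * card (A \<inter> B)" by (simp add: card_cartesian_product)
        thus ?thesis unfolding c unfolding r_def using True q R0 L0 by simp
      next
        case False
        hence "\<xi> j = 1" using xi[OF j] by auto
        hence "card Z = card A * card B" unfolding Z_def using card_rotated_pairs[OF q AB] by simp
        thus ?thesis unfolding c unfolding r_def using False q R0 L0 by simp
      qed
    qed
    finally have "\<bar>real (card {i\<in>?S. \<pi> i \<in> A \<and> \<pi> ((i + m j) mod (q * r)) \<in> B})
        - (if \<xi> j = 0 then card (A \<inter> B) / q else (card A / q) * (card B / q)) * (q * r)\<bar> \<le> 5 * \<delta> * q * (q * r)"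
      (is "\<bar>?c - ?t * _\<bar> \<le> _") .
    moreover have qr: "real_of_int (q * r) > 0" using q r0 by simp
    ultimately have "\<bar>?c - ?t * (q * r)\<bar> / (q * r) \<le> 5 * \<delta> * q" by (simp only: pos_divide_le_eq)
    moreover have "\<bar>?c - ?t * (q * r)\<bar> / (q * r) = \<bar>?c / (q * r) - ?t\<bar>"
    proof -
      have "?c / real_of_int (q * r) - ?t = (?c - ?t * (q * r)) / real_of_int (q * r)"
        using q r0 by (subst diff_divide_distrib, subst nonzero_mult_div_cancel_right) simp_all
      thus ?thesis using qr by (simp only: abs_divide abs_of_pos)
    qed
    ultimately show "\<bar>?c / (q * r) - ?t\<bar> \<le> 5 * \<delta> * q" by simp
  qed
qed

section \<open>Aligning a coding with a refined cycle\<close>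

lemma extend_partial_bij:
  assumes "finite A" "finite B" "card A = card B" "D \<subseteq> A" "inj_on f D" "f ` D \<subseteq> B"
  obtains g where "bij_betw g A B" "\<And>x. x \<in> D \<Longrightarrow> g x = f x"
proof -
  have "card (A - D) = card (B - f ` D)"
    using assms by (simp add: card_Diff_subset finite_subset card_image)
  then obtain h where h: "bij_betw h (A - D) (B - f ` D)"
    using assms by (metis finite_Diff finite_same_card_bij)
  define g where "g x = (if x \<in> D then f x else h x)" for x
  have "bij_betw g D (f ` D)" using assms(5) unfolding g_def
    by (auto simp: bij_betw_def inj_on_def)
  moreover have "bij_betw g (A - D) (B - f ` D)" using h unfolding g_def
    by (subst bij_betw_cong[where g = h]) auto
  ultimately have "bij_betw g (D \<union> (A - D)) (f ` D \<union> (B - f ` D))"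
    by (rule bij_betw_combine) auto
  moreover have "D \<union> (A - D) = A" "f ` D \<union> (B - f ` D) = B" using assms(4,6) by blast+
  ultimately have "bij_betw g A B" by (simp only:)
  thus ?thesis by (rule that) (simp add: g_def)
qed

text \<open>
  The labels are chosen fibre by fibre: on the fibre over \<open>n\<close> the requirement prescribes an injective partial
  labelling, inherited from the fibre over \<open>n - 1\<close>, and any such labelling extends to a bijection because the
  fibres have equal size. Nothing can be asked of the transition from the last fibre back to the first.
\<close>

lemma aligned_fibre_labels:
  fixes q r :: int and \<pi> :: "int \<Rightarrow> int"
  assumes q: "q > 0" and r: "r > 0"
    and pix: "\<And>i. i \<in> {0..<q * r} \<Longrightarrow> \<pi> i \<in> {0..<q}"
    and fib: "\<And>a. a \<in> {0..<q} \<Longrightarrow> card {i\<in>{0..<q * r}. \<pi> i = a} = nat r"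
    and n: "int n \<le> q"
  shows "\<exists>\<rho>. (\<forall>a\<in>{0..<int n}. bij_betw \<rho> {i\<in>{0..<q * r}. \<pi> i = a} {0..<r}) \<and>
     (\<forall>i\<in>{0..<q * r}. i + 1 < q * r \<longrightarrow> \<pi> (i + 1) = \<pi> i + 1 \<longrightarrow> \<pi> (i + 1) < int n \<longrightarrow> \<rho> (i + 1) = \<rho> i)"
  using n
proof (induction n)
  case 0
  have "\<not> \<pi> (i + 1) < 0" if "i \<in> {0..<q * r}" "i + 1 < q * r" for i using pix[of "i + 1"] that by auto
  thus ?case by (auto intro!: exI[of _ "\<lambda>_. 0"])
next
  case (Suc n)
  define F where "F a = {i\<in>{0..<q * r}. \<pi> i = a}" for a
  have "int n \<le> q" using Suc.prems by simp
  from Suc.IH[OF this] obtain \<rho> where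
    R1: "\<forall>a\<in>{0..<int n}. bij_betw \<rho> {i\<in>{0..<q * r}. \<pi> i = a} {0..<r}" and
    R2: "\<forall>i\<in>{0..<q * r}. i + 1 < q * r \<longrightarrow> \<pi> (i + 1) = \<pi> i + 1 \<longrightarrow> \<pi> (i + 1) < int n \<longrightarrow> \<rho> (i + 1) = \<rho> i"
    by (elim exE conjE)
  have r1: "bij_betw \<rho> (F a) {0..<r}" if "a \<in> {0..<int n}" for a
    using R1 that unfolding F_def by blast
  note r2 = R2[rule_format]
  define D where "D = {i\<in>F (int n). i - 1 \<in> F (int n - 1)}"
  have sub: "D \<subseteq> F (int n)" unfolding D_def by auto
  have inj: "inj_on (\<lambda>i. \<rho> (i - 1)) D \<and> (\<lambda>i. \<rho> (i - 1)) ` D \<subseteq> {0..<r}"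
  proof (cases "n = 0")
    case True
    have "D = {}" using pix True unfolding D_def F_def by fastforce
    thus ?thesis by simp
  next
    case False
    hence b: "bij_betw \<rho> (F (int n - 1)) {0..<r}" using r1 by simp
    have "inj_on \<rho> (F (int n - 1))" using b by (simp add: bij_betw_def)
    hence "inj_on (\<lambda>i. \<rho> (i - 1)) D" unfolding inj_on_def D_def by force
    moreover have "\<rho> ` F (int n - 1) = {0..<r}" using b by (simp add: bij_betw_def)
    hence "(\<lambda>i. \<rho> (i - 1)) ` D \<subseteq> {0..<r}" unfolding D_def by auto
    ultimately show ?thesis by simp
  qed
  have c: "card (F (int n)) = card {0..<r}" using fib[of "int n"] Suc.prems unfolding F_def by simp
  have "finite (F (int n))" unfolding F_def by (rule finite_subset[of _ "{0..<q * r}"]) auto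
  then obtain g where g: "bij_betw g (F (int n)) {0..<r}" "\<And>i. i \<in> D \<Longrightarrow> g i = \<rho> (i - 1)"
    using extend_partial_bij[OF _ _ c sub conjunct1[OF inj] conjunct2[OF inj]] by blast
  define \<rho>' where "\<rho>' i = (if \<pi> i = int n then g i else \<rho> i)" for i
  have "bij_betw \<rho>' (F a) {0..<r}" if a: "a \<in> {0..<int (Suc n)}" for a
  proof (cases "a = int n")
    case True
    show ?thesis unfolding True by (subst bij_betw_cong[of _ _ g]) (use g in \<open>auto simp: \<rho>'_def F_def\<close>)
  next
    case False
    hence "bij_betw \<rho> (F a) {0..<r}" using r1[of a] a by simp
    thus ?thesis by (subst bij_betw_cong[of _ _ \<rho>]) (use False in \<open>auto simp: \<rho>'_def F_def\<close>)
  qed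
  moreover have "\<rho>' (i + 1) = \<rho>' i" if i: "i \<in> {0..<q * r}" "i + 1 < q * r" "\<pi> (i + 1) = \<pi> i + 1" "\<pi> (i + 1) < int (Suc n)" for i
  proof (cases "\<pi> (i + 1) = int n")
    case True
    hence "i + 1 \<in> D" using i unfolding D_def F_def by auto
    hence "g (i + 1) = \<rho> i" using g(2)[of "i + 1"] by simp
    thus ?thesis using True i unfolding \<rho>'_def by simp
  next
    case False
    thus ?thesis using i r2[of i] unfolding \<rho>'_def by auto
  qed
  ultimately show ?case unfolding F_def by (intro exI[of _ \<rho>']) blast
qed

text \<open>
  The coarse interval \<open>c (\<pi> i)\<close> is cut into \<open>r\<close> equal pieces and the piece with the label of \<open>i\<close> becomes \<open>c' i\<close>.
  Equality of the remainders makes the translation from \<open>c' i\<close> to \<open>c' (i + 1)\<close> coincide with the translation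
  between the coarse intervals, so the two transformations agree pointwise there, not merely up to the coarse
  partition.
\<close>

lemma refine_enumeration:
  fixes q r :: int and c \<pi> :: "int \<Rightarrow> int"
  assumes q: "q > 0" and r: "r > 0" and c: "bij_betw c {0..<q} {0..<q}"
    and pix: "\<And>i. i \<in> {0..<q * r} \<Longrightarrow> \<pi> i \<in> {0..<q}"
    and fib: "\<And>a. a \<in> {0..<q} \<Longrightarrow> card {i\<in>{0..<q * r}. \<pi> i = a} = nat r"
  obtains c' where "bij_betw c' {0..<q * r} {0..<q * r}"
    "\<And>i. i \<in> {0..<q * r} \<Longrightarrow> c' i div r = c (\<pi> i)"
    "\<And>i. i \<in> {0..<q * r} \<Longrightarrow> i + 1 < q * r \<Longrightarrow> \<pi> (i + 1) = \<pi> i + 1 \<Longrightarrow> c' (i + 1) mod r = c' i mod r"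
proof -
  have nq0: "int (nat q) \<le> q" using q by simp
  obtain \<rho> where
    R1: "\<forall>a\<in>{0..<int (nat q)}. bij_betw \<rho> {i\<in>{0..<q * r}. \<pi> i = a} {0..<r}" and
    R2: "\<forall>i\<in>{0..<q * r}. i + 1 < q * r \<longrightarrow> \<pi> (i + 1) = \<pi> i + 1 \<longrightarrow> \<pi> (i + 1) < int (nat q)
      \<longrightarrow> \<rho> (i + 1) = \<rho> i"
    using aligned_fibre_labels[where \<pi> = \<pi>, OF q r _ _ nq0] pix fib by blast
  have nq: "int (nat q) = q" using q by simp
  note r1 = R1[unfolded nq, rule_format] and r2 = R2[unfolded nq, rule_format]
  have rho: "\<rho> i \<in> {0..<r}" if "i \<in> {0..<q * r}" for i
    using bij_betwE[OF r1[OF pix[OF that]]] that by blast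
  define c' where "c' i = c (\<pi> i) * r + \<rho> i" for i
  have dm: "c' i div r = c (\<pi> i)" "c' i mod r = \<rho> i" if "i \<in> {0..<q * r}" for i
    using rho[OF that] r unfolding c'_def by auto
  have ran: "c' i \<in> {0..<q * r}" if i: "i \<in> {0..<q * r}" for i
  proof -
    have ci: "c (\<pi> i) \<in> {0..<q}" using bij_betwE[OF c] pix[OF i] by blast
    have "c' i < (c (\<pi> i) + 1) * r" unfolding c'_def using rho[OF i] by (simp add: distrib_right)
    also have "\<dots> \<le> q * r" using ci r by (intro mult_right_mono) auto
    finally show ?thesis using ci rho[OF i] r unfolding c'_def by auto
  qed
  have "inj_on c' {0..<q * r}"
  proof (rule inj_onI)
    fix i j assume ij: "i \<in> {0..<q * r}" "j \<in> {0..<q * r}" "c' i = c' j"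
    have "c (\<pi> i) = c (\<pi> j)" using dm(1)[OF ij(1)] dm(1)[OF ij(2)] ij(3) by simp
    hence p: "\<pi> i = \<pi> j" using c pix ij by (meson bij_betw_imp_inj_on inj_onD)
    have eq: "\<rho> i = \<rho> j" using dm(2)[OF ij(1)] dm(2)[OF ij(2)] ij(3) by simp
    have inj: "inj_on \<rho> {k\<in>{0..<q * r}. \<pi> k = \<pi> j}"
      using r1[OF pix[OF ij(2)]] by (simp add: bij_betw_def)
    show "i = j" by (rule inj_onD[OF inj eq]) (use p ij in simp_all)
  qed
  moreover have "c' ` {0..<q * r} = {0..<q * r}"
    by (rule endo_inj_surj[OF finite_atLeastLessThan_int _ calculation]) (use ran in blast)
  ultimately have "bij_betw c' {0..<q * r} {0..<q * r}" by (simp add: bij_betw_def)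
  moreover have "c' (i + 1) mod r = c' i mod r"
    if i: "i \<in> {0..<q * r}" "i + 1 < q * r" "\<pi> (i + 1) = \<pi> i + 1" for i
  proof -
    have i1: "i + 1 \<in> {0..<q * r}" using i by simp
    have "\<pi> (i + 1) < q" using pix[OF i1] by simp
    hence "\<rho> (i + 1) = \<rho> i" by (rule r2[OF i])
    thus ?thesis unfolding dm(2)[OF i(1)] dm(2)[OF i1] .
  qed
  ultimately show ?thesis using dm(1) by (intro that[of c'])
qed

section \<open>Mixing along a sequence of times\<close>

lemma measure_vimage_preserving:
  assumes "f \<in> measurable M M" "distr M M f = M" "A \<in> sets M"
  shows "measure M (f -` A \<inter> space M) = measure M A"
  using assms measure_distr[OF assms(1), of A] by simp

lemma funpow_preserving:
  assumes T: "T \<in> measurable M M" "distr M M T = M"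
  shows "T ^^ n \<in> measurable M M" "distr M M (T ^^ n) = M"
proof (induction n)
  case (Suc n)
  have eq: "T ^^ Suc n = T \<circ> T ^^ n" by simp
  { case 1 show ?case unfolding eq using Suc T by (auto intro: measurable_comp) }
  { case 2 show ?case unfolding eq using distr_distr[OF T(1) Suc(1)] Suc T by (simp add: o_def) }
qed (simp_all add: id_def distr_id)

text \<open>
  Bessel's inequality for the almost orthogonal functions \<open>1\<^bsub>B i\<^esub> - b\<close>: with \<open>S = \<Sum>\<^sub>i c\<^sub>i (1\<^bsub>B i\<^esub> - b)\<close>, where
  \<open>c\<^sub>i\<close> are the correlations with \<open>A\<close>, expand \<open>\<integral> (1\<^sub>A - S / (1 + \<delta> K))\<^sup>2 \<ge> 0\<close>.
\<close>

lemma (in finite_measure) bessel_events: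
  fixes B :: "nat \<Rightarrow> 'a set" and K :: nat and b \<delta> :: real
  assumes A: "A \<in> sets M" and tot: "measure M (space M) = 1" and B: "\<And>i. i < K \<Longrightarrow> B i \<in> sets M"
    and mB: "\<And>i. i < K \<Longrightarrow> measure M (B i) = b" and del: "\<delta> \<ge> 0"
    and cor: "\<And>i j. i < K \<Longrightarrow> j < K \<Longrightarrow> i \<noteq> j \<Longrightarrow> \<bar>measure M (B i \<inter> B j) - b\<^sup>2\<bar> \<le> \<delta>"
  shows "(\<Sum>i<K. (measure M (A \<inter> B i) - measure M A * b)\<^sup>2) \<le> 1 + \<delta> * K"
proof -
  define c where "c i = measure M (A \<inter> B i) - measure M A * b" for i
  define l where "l = 1 + \<delta> * K"
  have l: "l > 0" unfolding l_def using del by (simp add: add_pos_nonneg)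
  define w where "w i = c i / l" for i
  define v where "v i x = indicator (B i) x - b" for i x
  define \<gamma> where "\<gamma> i j = measure M (B i \<inter> B j) - b\<^sup>2" for i j
  have ind: "integrable M (indicator S :: 'a \<Rightarrow> real)" if "S \<in> sets M" for S
    using that by (simp add: integrable_real_indicator less_top[symmetric])
  have Av: "integrable M (\<lambda>x. indicator A x * v i x)" "(\<integral>x. indicator A x * v i x \<partial>M) = c i" if i: "i < K" for i
  proof -
    have e: "indicator A x * v i x = indicator (A \<inter> B i) x - b * indicator A x" for x
      unfolding v_def by (simp add: indicator_inter_arith algebra_simps)
    show "integrable M (\<lambda>x. indicator A x * v i x)" unfolding e using A B[OF i] ind by auto
    show "(\<integral>x. indicator A x * v i x \<partial>M) = c i" unfolding e c_def using A B[OF i] ind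
      by (subst Bochner_Integration.integral_diff) auto
  qed
  have vv: "integrable M (\<lambda>x. v i x * v j x)" "(\<integral>x. v i x * v j x \<partial>M) = \<gamma> i j" if i: "i < K" "j < K" for i j
  proof -
    have e: "v i x * v j x = indicator (B i \<inter> B j) x - b * indicator (B i) x - b * indicator (B j) x + b\<^sup>2" for x
      unfolding v_def by (simp add: indicator_inter_arith algebra_simps power2_eq_square)
    note s = B[OF i(1)] B[OF i(2)]
    show "integrable M (\<lambda>x. v i x * v j x)" unfolding e using s ind by auto
    have "(\<integral>x. v i x * v j x \<partial>M) = measure M (B i \<inter> B j) - b * measure M (B i) - b * measure M (B j) + b\<^sup>2"
      unfolding e using s tot ind by (simp add: Bochner_Integration.integral_add Bochner_Integration.integral_diff)
    thus "(\<integral>x. v i x * v j x \<partial>M) = \<gamma> i j" unfolding \<gamma>_def mB[OF i(1)] mB[OF i(2)]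
      by (simp add: power2_eq_square)
  qed
  let ?S = "\<lambda>x. \<Sum>i<K. w i * v i x"
  have sq: "(indicator A x - ?S x)\<^sup>2 = indicator A x - 2 * (\<Sum>i<K. w i * (indicator A x * v i x))
      + (\<Sum>i<K. \<Sum>j<K. w i * w j * (v i x * v j x))" for x
  proof -
    have "(\<Sum>i<K. \<Sum>j<K. w i * w j * (v i x * v j x)) = ?S x * ?S x"
      by (simp add: sum_product algebra_simps)
    moreover have "(\<Sum>i<K. w i * (indicator A x * v i x)) = indicator A x * ?S x"
      by (simp add: sum_distrib_left algebra_simps)
    moreover have "(indicator A x)\<^sup>2 = (indicator A x :: real)" by (simp add: indicator_def)
    moreover have "(indicator A x - ?S x)\<^sup>2 = (indicator A x)\<^sup>2 - 2 * (indicator A x * ?S x) + ?S x * ?S x"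
      by (simp only: power2_eq_square) (simp add: algebra_simps)
    ultimately show ?thesis by simp
  qed
  have "0 \<le> (\<integral>x. (indicator A x - ?S x)\<^sup>2 \<partial>M)" by (rule integral_nonneg_AE) simp
  also have "\<dots> = measure M A - 2 * (\<Sum>i<K. w i * c i) + (\<Sum>i<K. \<Sum>j<K. w i * w j * \<gamma> i j)"
  proof -
    have i1: "integrable M (\<lambda>x. \<Sum>i<K. w i * (indicator A x * v i x))"
      by (intro Bochner_Integration.integrable_sum integrable_mult_right Av) simp
    have e1: "(\<integral>x. (\<Sum>i<K. w i * (indicator A x * v i x)) \<partial>M) = (\<Sum>i<K. w i * c i)"
      by (subst Bochner_Integration.integral_sum) (use Av in auto)
    have i2: "integrable M (\<lambda>x. \<Sum>j<K. w i * w j * (v i x * v j x))" if "i < K" for i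
      by (intro Bochner_Integration.integrable_sum integrable_mult_right vv) (use that in simp_all)
    have e2: "(\<integral>x. (\<Sum>j<K. w i * w j * (v i x * v j x)) \<partial>M) = (\<Sum>j<K. w i * w j * \<gamma> i j)" if "i < K" for i
      by (subst Bochner_Integration.integral_sum) (use vv[OF that] in auto)
    have i3: "integrable M (\<lambda>x. \<Sum>i<K. \<Sum>j<K. w i * w j * (v i x * v j x))"
      by (intro Bochner_Integration.integrable_sum i2) simp
    have e3: "(\<integral>x. (\<Sum>i<K. \<Sum>j<K. w i * w j * (v i x * v j x)) \<partial>M) = (\<Sum>i<K. \<Sum>j<K. w i * w j * \<gamma> i j)"
      by (subst Bochner_Integration.integral_sum) (use i2 e2 in auto)
    have i4: "integrable M (\<lambda>x. 2 * (\<Sum>i<K. w i * (indicator A x * v i x)))"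
      by (intro integrable_mult_right i1)
    show ?thesis unfolding sq
      by (subst Bochner_Integration.integral_add[OF Bochner_Integration.integrable_diff[OF ind[OF A] i4] i3],
          subst Bochner_Integration.integral_diff[OF ind[OF A] i4]) (use A in \<open>simp add: e1 e3\<close>)
  qed
  also have "(\<Sum>i<K. \<Sum>j<K. w i * w j * \<gamma> i j) \<le> l * (\<Sum>i<K. (w i)\<^sup>2)"
  proof -
    have g: "w i * w j * \<gamma> i j \<le> (if i = j then (w i)\<^sup>2 else 0) + \<delta> * (((w i)\<^sup>2 + (w j)\<^sup>2) / 2)" if "i < K" "j < K" for i j
    proof (cases "i = j")
      case True
      have "\<gamma> i i \<le> 1" unfolding \<gamma>_def
        using bounded_measure[of "B i \<inter> B i"] tot zero_le_power2[of b] by linarith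
      hence "(w i)\<^sup>2 * \<gamma> i i \<le> (w i)\<^sup>2 * 1" by (intro mult_left_mono) auto
      moreover have "0 \<le> \<delta> * (w i)\<^sup>2" using del by simp
      ultimately show ?thesis using True by (simp add: power2_eq_square)
    next
      case False
      have "w i * w j * \<gamma> i j \<le> \<bar>w i * w j\<bar> * \<bar>\<gamma> i j\<bar>" by (metis abs_ge_self abs_mult)
      also have "\<dots> \<le> \<bar>w i * w j\<bar> * \<delta>" using cor[OF that False] unfolding \<gamma>_def by (intro mult_left_mono) auto
      also have "\<bar>w i * w j\<bar> \<le> ((w i)\<^sup>2 + (w j)\<^sup>2) / 2"
        using sum_squares_bound[of "\<bar>w i\<bar>" "\<bar>w j\<bar>"] by (simp add: abs_mult)
      finally show ?thesis using False del by (simp add: mult.commute mult_left_mono mult_right_mono)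
    qed
    have "(\<Sum>i<K. \<Sum>j<K. w i * w j * \<gamma> i j)
        \<le> (\<Sum>i<K. \<Sum>j<K. (if i = j then (w i)\<^sup>2 else 0) + \<delta> * (((w i)\<^sup>2 + (w j)\<^sup>2) / 2))"
      by (intro sum_mono) (use g in auto)
    also have "\<dots> = (\<Sum>i<K. (w i)\<^sup>2) + \<delta> * (\<Sum>i<K. \<Sum>j<K. ((w i)\<^sup>2 + (w j)\<^sup>2) / 2)"
      by (simp add: sum.distrib sum_distrib_left)
    also have "(\<Sum>i<K. \<Sum>j<K. ((w i)\<^sup>2 + (w j)\<^sup>2) / 2) = K * (\<Sum>i<K. (w i)\<^sup>2)"
      by (simp add: sum.distrib add_divide_distrib sum_divide_distrib[symmetric] sum_distrib_left[symmetric])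
    finally show ?thesis unfolding l_def by (simp add: algebra_simps)
  qed
  also have "measure M A - 2 * (\<Sum>i<K. w i * c i) + l * (\<Sum>i<K. (w i)\<^sup>2)
      = measure M A - (\<Sum>i<K. (c i)\<^sup>2) / l"
  proof -
    have "(\<Sum>i<K. w i * c i) = (\<Sum>i<K. (c i)\<^sup>2) / l"
      unfolding w_def by (simp add: sum_divide_distrib power2_eq_square)
    moreover have "l * (\<Sum>i<K. (w i)\<^sup>2) = (\<Sum>i<K. (c i)\<^sup>2) / l"
      unfolding w_def sum_distrib_left sum_divide_distrib using l
      by (intro sum.cong) (auto simp: power2_eq_square field_simps)
    ultimately show ?thesis by simp
  qed
  finally have "(\<Sum>i<K. (c i)\<^sup>2) / l \<le> measure M A" by simp
  also have "\<dots> \<le> 1" using bounded_measure[of A] tot by simp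
  finally show ?thesis using l unfolding c_def l_def by (simp add: pos_divide_le_eq)
qed

text \<open>
  Choose \<open>K\<close> times \<open>p\<^sub>i\<close> from the sequence so sparsely that the preimages of \<open>B\<close> under \<open>T\<close> to the powers \<open>p\<^sub>i\<close> are
  pairwise almost independent. For every \<open>n\<close> the preimages at the times \<open>n + p\<^sub>i\<close> then have the same correlations, so by
  Bessel's inequality the mean over \<open>i\<close> of the squared deviation at time \<open>n + p\<^sub>i\<close> is at most about \<open>1 / K\<close>. A mean over a
  long range of \<open>n\<close> hardly changes under the bounded shifts \<open>p\<^sub>i\<close>.
\<close>

lemma (in finite_measure) weakly_mixing_of_mixing_times:
  fixes m :: "nat \<Rightarrow> nat"
  assumes tot: "measure M (space M) = 1" and T: "T \<in> measurable M M" "distr M M T = M"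
    and mix: "\<And>A B. A \<in> sets M \<Longrightarrow> B \<in> sets M \<Longrightarrow>
      (\<lambda>k. measure M (A \<inter> ((T ^^ m k) -` B \<inter> space M))) \<longlonglongrightarrow> measure M A * measure M B"
  shows "weakly_mixing M T"
  unfolding weakly_mixing_def
proof (intro ballI)
  fix A B assume A: "A \<in> sets M" and B: "B \<in> sets M"
  define P where "P n = (T ^^ n) -` B \<inter> space M" for n
  define b where "b = measure M B"
  define u where "u n = \<bar>measure M (A \<inter> P n) - measure M A * b\<bar>" for n
  note Tn = funpow_preserving[OF T]
  have Ps: "P n \<in> sets M" for n unfolding P_def by (rule measurable_sets[OF Tn(1) B])
  have Pm: "measure M (P n) = b" for n unfolding P_def b_def
    by (rule measure_vimage_preserving[OF Tn B])
  have b01: "0 \<le> b" "b \<le> 1" unfolding b_def using bounded_measure[of B] tot by auto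
  have a01: "0 \<le> measure M A" "measure M A \<le> 1" using bounded_measure[of A] tot by auto
  have u0: "u n \<ge> 0" for n unfolding u_def by simp
  have u1: "u n \<le> 1" for n
  proof -
    have "0 \<le> measure M A * b" "measure M A * b \<le> 1" using a01 b01 by (auto intro: mult_le_one)
    moreover have "0 \<le> measure M (A \<inter> P n)" "measure M (A \<inter> P n) \<le> 1" using bounded_measure[of "A \<inter> P n"] tot by auto
    ultimately show ?thesis unfolding u_def by linarith
  qed
  have shift: "measure M (P (n + i) \<inter> P (n + j)) = measure M (P i \<inter> P j)" for n i j
  proof -
    have "(T ^^ n) x \<in> space M" if "x \<in> space M" for x using Tn(1)[of n] that by (rule measurable_space)
    hence "P (n + i) \<inter> P (n + j) = (T ^^ n) -` (P i \<inter> P j) \<inter> space M"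
      unfolding P_def by (auto simp: funpow_add add.commute[of n])
    thus ?thesis using measure_vimage_preserving[OF Tn, of "P i \<inter> P j" n] Ps by simp
  qed
  have sel: "\<exists>p :: nat \<Rightarrow> nat. \<forall>i<K. \<forall>j<K. i \<noteq> j \<longrightarrow> \<bar>measure M (P (p i) \<inter> P (p j)) - b\<^sup>2\<bar> \<le> \<delta>" if d: "\<delta> > 0" for \<delta> K
  proof (induction K)
    case (Suc K)
    then obtain p where p: "\<And>i j. i < K \<Longrightarrow> j < K \<Longrightarrow> i \<noteq> j \<Longrightarrow> \<bar>measure M (P (p i) \<inter> P (p j)) - b\<^sup>2\<bar> \<le> \<delta>" by blast
    have "\<forall>\<^sub>F k in sequentially. \<forall>i\<in>{..<K}. \<bar>measure M (P (p i) \<inter> P (m k)) - b\<^sup>2\<bar> < \<delta>"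
    proof (rule eventually_ball_finite)
      show "\<forall>i\<in>{..<K}. \<forall>\<^sub>F k in sequentially. \<bar>measure M (P (p i) \<inter> P (m k)) - b\<^sup>2\<bar> < \<delta>"
      proof
        fix i
        have "(\<lambda>k. measure M (P (p i) \<inter> P (m k))) \<longlonglongrightarrow> b\<^sup>2"
          using mix[OF Ps B, of "p i"] Pm unfolding P_def[of "m _"] b_def[symmetric] by (simp add: power2_eq_square)
        thus "\<forall>\<^sub>F k in sequentially. \<bar>measure M (P (p i) \<inter> P (m k)) - b\<^sup>2\<bar> < \<delta>"
          using d unfolding tendsto_iff dist_real_def by blast
      qed
    qed simp
    then obtain k where k: "\<And>i. i < K \<Longrightarrow> \<bar>measure M (P (p i) \<inter> P (m k)) - b\<^sup>2\<bar> < \<delta>"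
      unfolding eventually_sequentially by auto
    have "\<bar>measure M (P ((p(K := m k)) i) \<inter> P ((p(K := m k)) j)) - b\<^sup>2\<bar> \<le> \<delta>"
      if "i < Suc K" "j < Suc K" "i \<noteq> j" for i j
      using that p[of i j] k[of i] k[of j] by (auto simp: less_Suc_eq Int_commute)
    thus ?case by blast
  qed simp
  have main: "\<exists>C. \<forall>N. (\<Sum>n=1..N. (u n)\<^sup>2) \<le> N * (1 / K + \<delta>) + C" if d: "\<delta> > 0" and K: "K > 0" for \<delta> and K :: nat
  proof -
    obtain p where p: "\<And>i j. i < K \<Longrightarrow> j < K \<Longrightarrow> i \<noteq> j \<Longrightarrow> \<bar>measure M (P (p i) \<inter> P (p j)) - b\<^sup>2\<bar> \<le> \<delta>"
      using sel[OF d, of K] by blast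
    have bes: "(\<Sum>i<K. (u (n + p i))\<^sup>2) \<le> 1 + \<delta> * K" for n
      using bessel_events[OF A tot, of K "\<lambda>i. P (n + p i)" b \<delta>] Ps Pm d p shift unfolding u_def by auto
    define C where "C = (\<Sum>i<K. real (p i))"
    have "(\<Sum>n=1..N. (u n)\<^sup>2) \<le> N * (1 / K + \<delta>) + C / K" for N
    proof -
      have sh: "(\<Sum>n=1..N. (u n)\<^sup>2) \<le> (\<Sum>n=1..N. (u (n + p i))\<^sup>2) + real (p i)" for i
      proof -
        have "(\<Sum>n=1..N. (u n)\<^sup>2) \<le> (\<Sum>n\<in>{1..p i} \<union> {1 + p i..N + p i}. (u n)\<^sup>2)"
          by (intro sum_mono2) auto
        also have "\<dots> = (\<Sum>n=1..p i. (u n)\<^sup>2) + (\<Sum>n=1+p i..N + p i. (u n)\<^sup>2)"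
          by (rule sum.union_disjoint) auto
        also have "(\<Sum>n=1..p i. (u n)\<^sup>2) \<le> (\<Sum>n=1..p i. 1)"
          using u0 u1 by (intro sum_mono) (simp add: power_le_one)
        also have "(\<Sum>n=1+p i..N + p i. (u n)\<^sup>2) = (\<Sum>n=1..N. (u (n + p i))\<^sup>2)"
          by (rule sum.shift_bounds_cl_nat_ivl)
        finally show ?thesis by simp
      qed
      have "K * (\<Sum>n=1..N. (u n)\<^sup>2) = (\<Sum>i<K. \<Sum>n=1..N. (u n)\<^sup>2)" by simp
      also have "\<dots> \<le> (\<Sum>i<K. (\<Sum>n=1..N. (u (n + p i))\<^sup>2) + real (p i))" by (intro sum_mono sh)
      also have "\<dots> = (\<Sum>n=1..N. \<Sum>i<K. (u (n + p i))\<^sup>2) + C"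
        unfolding C_def sum.distrib by (subst sum.swap) simp
      also have "\<dots> \<le> (\<Sum>n=1..N. 1 + \<delta> * K) + C" by (intro add_right_mono sum_mono bes)
      finally have "K * (\<Sum>n=1..N. (u n)\<^sup>2) \<le> N * (1 + \<delta> * K) + C" by simp
      thus ?thesis using K by (simp add: field_simps)
    qed
    thus ?thesis by blast
  qed
  have "(\<lambda>N. (1 / real N) * (\<Sum>n=1..N. u n)) \<longlonglongrightarrow> 0"
  proof (rule LIMSEQ_I)
    fix e :: real assume e: "e > 0"
    define \<delta> where "\<delta> = (e / 4)\<^sup>2"
    have d: "\<delta> > 0" unfolding \<delta>_def using e by simp
    define K where "K = nat \<lceil>1 / \<delta>\<rceil> + 1"
    have "1 / \<delta> \<le> real K" unfolding K_def by linarith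
    moreover have "K > 0" unfolding K_def by simp
    ultimately have K: "1 / real K \<le> \<delta>" "K > 0" using d by (simp_all add: field_simps)
    obtain C where C: "\<And>N. (\<Sum>n=1..N. (u n)\<^sup>2) \<le> N * (1 / K + \<delta>) + C" using main[OF d K(2)] by blast
    define N0 where "N0 = nat \<lceil>\<bar>C\<bar> / \<delta>\<rceil> + 1"
    have "(1 / real N) * (\<Sum>n=1..N. u n) < e" if N: "N \<ge> N0" for N
    proof -
      have "\<bar>C\<bar> / \<delta> < real N" "N > 0" using N unfolding N0_def by linarith+
      hence CN: "C < real N * \<delta>" using d by (simp add: field_simps abs_less_iff)
      \<comment> \<open>This passes from squared deviations to absolute ones without the Cauchy-Schwarz inequality.\<close>
      have "u n \<le> e / 4 + (u n)\<^sup>2 / (e / 4)" for n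
      proof (cases "u n \<le> e / 4")
        case False
        hence "u n * (e / 4) \<le> u n * u n" using u0 by (intro mult_left_mono) auto
        hence "u n \<le> (u n)\<^sup>2 / (e / 4)" using e by (simp add: power2_eq_square field_simps)
        thus ?thesis using e by linarith
      qed (use e in \<open>simp add: add_increasing2\<close>)
      hence "(\<Sum>n=1..N. u n) \<le> (\<Sum>n=1..N. e / 4 + (u n)\<^sup>2 / (e / 4))" by (intro sum_mono)
      also have "\<dots> = N * (e / 4) + (\<Sum>n=1..N. (u n)\<^sup>2) / (e / 4)"
        by (simp only: sum.distrib sum_divide_distrib) simp
      also have "\<dots> < N * (e / 4) + N * (3 * \<delta>) / (e / 4)"
      proof (intro add_strict_left_mono divide_strict_right_mono)
        have "(\<Sum>n=1..N. (u n)\<^sup>2) \<le> N * (\<delta> + \<delta>) + C"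
          using C[of N] mult_left_mono[OF add_right_mono[OF K(1), of \<delta>], of "real N"] by simp
        also have "\<dots> < N * (3 * \<delta>)" using CN by (simp add: algebra_simps)
        finally show "(\<Sum>n=1..N. (u n)\<^sup>2) < N * (3 * \<delta>)" .
      qed (use e in simp)
      also have "\<dots> = N * e" unfolding \<delta>_def using e by (simp add: power2_eq_square field_simps)
      finally show ?thesis using \<open>N > 0\<close> by (simp add: pos_divide_less_eq mult.commute)
    qed
    moreover have "0 \<le> (1 / real N) * (\<Sum>n=1..N. u n)" for N using u0 by (simp add: sum_nonneg)
    ultimately show "\<exists>no. \<forall>n\<ge>no. norm ((1 / real n) * (\<Sum>i=1..n. u i) - 0) < e"
      by (intro exI[of _ N0]) (auto simp: abs_of_nonneg sum_nonneg u0)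
  qed
  thus "(\<lambda>N. (1 / real N) * (\<Sum>n=1..N. \<bar>measure M (A \<inter> ((T ^^ n) -` B \<inter> space M))
      - measure M A * measure M B\<bar>)) \<longlonglongrightarrow> 0"
    unfolding u_def P_def b_def .
qed

section \<open>Exchanges of equal intervals\<close>

definition block :: "int \<Rightarrow> int set \<Rightarrow> real set" where
  "block q S = {x. 0 \<le> x \<and> x < 1 \<and> \<lfloor>q * x\<rfloor> \<in> S}"

text \<open>
  Outside \<open>[0,1)\<close>, in particular at the right end point of \<open>[0,1]\<close>, the map is the identity, which makes it a bijection of
  \<open>[0,1]\<close> whenever \<open>\<sigma>\<close> is a permutation.
\<close>

definition interval_exchange :: "int \<Rightarrow> (int \<Rightarrow> int) \<Rightarrow> real \<Rightarrow> real" where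
  "interval_exchange q \<sigma> x =
    (if 0 \<le> x \<and> x < 1 then x + (\<sigma> \<lfloor>q * x\<rfloor> - \<lfloor>q * x\<rfloor>) / q else x)"

lemma floor_block_index:
  fixes q :: int and x :: real
  assumes "q > 0" "0 \<le> x" "x < 1"
  shows "\<lfloor>q * x\<rfloor> \<in> {0..<q}"
proof -
  have "q * x < q" using assms by simp
  thus ?thesis using assms by (simp add: floor_less_iff)
qed

lemma block_singleton:
  assumes "q > 0" "j \<in> {0..<q}"
  shows "block q {j} = {real_of_int j / q..<(real_of_int j + 1) / q}"
proof -
  have "\<lfloor>q * x\<rfloor> = j \<longleftrightarrow> real_of_int j / q \<le> x \<and> x < (real_of_int j + 1) / q" for x :: real
    using assms(1) by (simp add: floor_eq_iff field_simps)
  moreover have "0 \<le> real_of_int j / q" using assms by simp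
  moreover have "(real_of_int j + 1) / q \<le> 1" using assms by simp
  ultimately show ?thesis unfolding block_def by (auto intro: order_trans less_le_trans)
qed

lemma block_UN: "block q S = (\<Union>j\<in>S. block q {j})"
  unfolding block_def by auto

lemma block_borel [measurable]: "block q S \<in> sets borel"
  unfolding block_def by measurable

lemma block_full: "q > 0 \<Longrightarrow> block q {0..<q} = {0..<1}"
  unfolding block_def using floor_block_index by fastforce

lemma emeasure_block_Int:
  assumes "q > 0" "S \<subseteq> {0..<q}" "A \<in> sets borel"
  shows "emeasure lborel (A \<inter> block q S) = (\<Sum>j\<in>S. emeasure lborel (A \<inter> block q {j}))"
proof -
  have "A \<inter> block q S = (\<Union>j\<in>S. A \<inter> block q {j})" by (subst block_UN) auto
  also have "emeasure lborel \<dots> = (\<Sum>j\<in>S. emeasure lborel (A \<inter> block q {j}))"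
  proof (rule sum_emeasure[symmetric])
    show "disjoint_family_on (\<lambda>j. A \<inter> block q {j}) S"
      unfolding disjoint_family_on_def block_def by auto
    show "finite S" using assms(2) by (rule finite_subset) simp
  qed (use assms(3) block_borel in auto)
  finally show ?thesis .
qed

lemma space_unit [simp]: "space unit_measure = {0..1}"
  unfolding unit_measure_def by (simp add: space_restrict_space)

lemma sets_unit: "sets unit_measure = {A. A \<in> sets borel \<and> A \<subseteq> {0..1}}"
  unfolding unit_measure_def by (auto simp: sets_restrict_space_iff subset_iff)

lemma emeasure_unit: "A \<subseteq> {0..1} \<Longrightarrow> emeasure unit_measure A = emeasure lborel A"
  unfolding unit_measure_def by (subst emeasure_restrict_space) auto

lemma measure_unit: "A \<subseteq> {0..1} \<Longrightarrow> measure unit_measure A = measure lborel A"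
  by (simp add: measure_def emeasure_unit)

lemma finite_measure_unit: "finite_measure unit_measure"
  by standard (simp add: emeasure_unit)

interpretation unit: finite_measure unit_measure
  by (rule finite_measure_unit)

lemma measure_unit_space: "measure unit_measure {0..1} = 1"
  by (simp add: measure_unit)

lemma block_subset: "block q S \<subseteq> {0..<1}" "block q S \<subseteq> {0..1}"
  unfolding block_def by auto

lemma block_sets_unit [measurable]: "block q S \<in> sets unit_measure"
  using block_subset block_borel by (simp add: sets_unit)

lemma measure_block:
  assumes q: "q > 0" and S: "S \<subseteq> {0..<q}"
  shows "measure unit_measure (block q S) = card S / q"
proof -
  have "emeasure lborel (block q S) = (\<Sum>j\<in>S. emeasure lborel (block q {j}))"
    using emeasure_block_Int[OF q S, of UNIV] by simp
  also have "\<dots> = (\<Sum>j\<in>S. ennreal (1 / q))"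
  proof (rule sum.cong[OF refl])
    fix j assume j: "j \<in> S"
    have "real_of_int j / q \<le> (real_of_int j + 1) / q" using q by (simp add: divide_right_mono)
    thus "emeasure lborel (block q {j}) = ennreal (1 / q)"
      using j S q by (subst block_singleton) (auto simp: diff_divide_distrib[symmetric])
  qed
  also have "\<dots> = ennreal (card S / q)"
    using q by (simp add: ennreal_of_nat_eq_real_of_nat ennreal_mult'[symmetric])
  finally show ?thesis using q by (simp add: measure_def emeasure_unit[OF block_subset(2)])
qed

lemma interval_exchange_block:
  fixes q :: int and x :: real
  assumes q: "q > 0" and \<sigma>: "\<And>j. j \<in> {0..<q} \<Longrightarrow> \<sigma> j \<in> {0..<q}" and x: "0 \<le> x" "x < 1"
  shows "0 \<le> interval_exchange q \<sigma> x" "interval_exchange q \<sigma> x < 1"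
    "\<lfloor>q * interval_exchange q \<sigma> x\<rfloor> = \<sigma> \<lfloor>q * x\<rfloor>"
proof -
  let ?y = "interval_exchange q \<sigma> x"
  have s: "\<sigma> \<lfloor>q * x\<rfloor> \<in> {0..<q}" using \<sigma> floor_block_index[OF q x] by blast
  have y: "q * ?y = q * x - \<lfloor>q * x\<rfloor> + \<sigma> \<lfloor>q * x\<rfloor>"
    unfolding interval_exchange_def using x q by (simp add: field_simps)
  have f: "0 \<le> q * x - \<lfloor>q * x\<rfloor>" "q * x - \<lfloor>q * x\<rfloor> < 1" by linarith+
  show "\<lfloor>q * ?y\<rfloor> = \<sigma> \<lfloor>q * x\<rfloor>" unfolding y using f by (simp add: floor_eq_iff)
  have "0 \<le> q * ?y" unfolding y using f s by simp
  thus "0 \<le> ?y" using q by (simp add: zero_le_mult_iff)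
  have "q * ?y < \<sigma> \<lfloor>q * x\<rfloor> + 1" unfolding y using f by simp
  also have "\<dots> \<le> real_of_int q" using s
    by (metis atLeastLessThan_iff of_int_1 of_int_add of_int_le_iff zless_imp_add1_zle)
  finally show "?y < 1" using q by simp
qed

lemma interval_exchange_compose:
  fixes q :: int
  assumes q: "q > 0" and \<tau>: "\<And>j. j \<in> {0..<q} \<Longrightarrow> \<tau> j \<in> {0..<q}"
  shows "interval_exchange q \<sigma> (interval_exchange q \<tau> x) = interval_exchange q (\<lambda>j. \<sigma> (\<tau> j)) x"
proof (cases "0 \<le> x \<and> x < 1")
  case True
  have "interval_exchange q \<sigma> (interval_exchange q \<tau> x)
      = interval_exchange q \<tau> x + (\<sigma> (\<tau> \<lfloor>q * x\<rfloor>) - \<tau> \<lfloor>q * x\<rfloor>) / q"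
    using interval_exchange_block[OF q \<tau>, where x=x] True by (simp add: interval_exchange_def[of q \<sigma>])
  thus ?thesis using True unfolding interval_exchange_def by (simp add: diff_divide_distrib)
qed (auto simp: interval_exchange_def)

lemma interval_exchange_id:
  assumes "q > 0" "\<And>j. j \<in> {0..<q} \<Longrightarrow> \<sigma> j = j"
  shows "interval_exchange q \<sigma> x = x"
  using floor_block_index[OF assms(1), of x] assms(2) unfolding interval_exchange_def by simp

lemma interval_exchange_borel [measurable]: "interval_exchange q \<sigma> \<in> borel_measurable borel"
  unfolding interval_exchange_def[abs_def] by measurable

lemma interval_exchange_range:
  assumes "q > 0" "\<And>j. j \<in> {0..<q} \<Longrightarrow> \<sigma> j \<in> {0..<q}" "x \<in> {0..1}"
  shows "interval_exchange q \<sigma> x \<in> {0..1}"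
proof (cases "x < 1")
  case True
  thus ?thesis using interval_exchange_block[of q \<sigma> x] assms by auto
qed (use assms in \<open>auto simp: interval_exchange_def\<close>)

lemma interval_exchange_measurable:
  assumes "q > 0" "\<And>j. j \<in> {0..<q} \<Longrightarrow> \<sigma> j \<in> {0..<q}"
  shows "interval_exchange q \<sigma> \<in> measurable unit_measure unit_measure"
  unfolding unit_measure_def
proof (rule measurable_restrict_space3)
  show "interval_exchange q \<sigma> \<in> lborel \<rightarrow>\<^sub>M lborel" by simp
  show "interval_exchange q \<sigma> \<in> {0..1} \<rightarrow> {0..1}" using interval_exchange_range[OF assms(1), of \<sigma>] assms(2) by blast
qed

lemma interval_exchange_distr:
  assumes q: "q > 0" and \<sigma>: "bij_betw \<sigma> {0..<q} {0..<q}"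
  shows "distr unit_measure unit_measure (interval_exchange q \<sigma>) = unit_measure"
proof (rule measure_eqI)
  have s: "\<And>j. j \<in> {0..<q} \<Longrightarrow> \<sigma> j \<in> {0..<q}" using \<sigma> bij_betwE by blast
  note meas = interval_exchange_measurable[OF q s]
  show "sets (distr unit_measure unit_measure (interval_exchange q \<sigma>)) = sets unit_measure" by simp
  fix A assume "A \<in> sets (distr unit_measure unit_measure (interval_exchange q \<sigma>))"
  hence A': "A \<in> sets unit_measure" by simp
  hence A: "A \<in> sets borel" "A \<subseteq> {0..1}" by (auto simp: sets_unit)
  let ?T = "interval_exchange q \<sigma>"
  have nul: "emeasure lborel B = emeasure lborel (B \<inter> {0..<1})" if "B \<in> sets borel" "B \<subseteq> {0..1}" for B :: "real set"
  proof (rule emeasure_eq_AE)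
    show "AE x in lborel. (x \<in> B) = (x \<in> B \<inter> {0..<1})"
      using AE_lborel_singleton[of "1::real"] by eventually_elim (use that in force)
  qed (use that in auto)
  have TA: "?T -` A \<inter> {0..1} \<in> sets borel" 
  proof -
    have "?T -` A \<inter> space unit_measure \<in> sets unit_measure"
      by (rule measurable_sets[OF meas A'])
    thus ?thesis by (simp add: sets_unit)
  qed
  have "emeasure (distr unit_measure unit_measure ?T) A = emeasure unit_measure (?T -` A \<inter> {0..1})"
    by (subst emeasure_distr[OF meas]) (use A in \<open>auto simp: sets_unit\<close>)
  also have "\<dots> = emeasure lborel (?T -` A \<inter> {0..1})" by (subst emeasure_unit) auto
  also have "\<dots> = emeasure lborel ((?T -` A \<inter> {0..1}) \<inter> block q {0..<q})"
    unfolding block_full[OF q] by (rule nul[OF TA]) auto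
  also have "\<dots> = (\<Sum>j\<in>{0..<q}. emeasure lborel ((?T -` A \<inter> {0..1}) \<inter> block q {j}))"
    by (rule emeasure_block_Int[OF q order_refl TA])
  also have "\<dots> = (\<Sum>j\<in>{0..<q}. emeasure lborel (A \<inter> block q {\<sigma> j}))"
  proof (rule sum.cong[OF refl])
    fix j assume j: "j \<in> {0..<q}"
    define d where "d = (real_of_int (\<sigma> j) - j) / q"
    have T: "?T x = d + x" if "x \<in> block q {j}" for x
      using that unfolding block_def interval_exchange_def d_def by auto
    have bl: "x \<in> block q {j} \<longleftrightarrow> d + x \<in> block q {\<sigma> j}" for x
      unfolding block_singleton[OF q j] block_singleton[OF q s[OF j]] d_def
      by (auto simp: add_divide_distrib diff_divide_distrib)
    have "(?T -` A \<inter> {0..1}) \<inter> block q {j} = (+) d -` (A \<inter> block q {\<sigma> j}) \<inter> space lborel"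
    proof (intro set_eqI)
      fix x show "x \<in> (?T -` A \<inter> {0..1}) \<inter> block q {j} \<longleftrightarrow> x \<in> (+) d -` (A \<inter> block q {\<sigma> j}) \<inter> space lborel"
        using T[of x] bl[of x] block_subset(2)[of q "{j}"] by auto
    qed
    hence "emeasure lborel ((?T -` A \<inter> {0..1}) \<inter> block q {j})
        = emeasure (distr lborel borel ((+) d)) (A \<inter> block q {\<sigma> j})"
      using A by (subst emeasure_distr) auto
    thus "emeasure lborel ((?T -` A \<inter> {0..1}) \<inter> block q {j}) = emeasure lborel (A \<inter> block q {\<sigma> j})"
      by (simp add: lborel_distr_plus)
  qed
  also have "\<dots> = (\<Sum>j\<in>{0..<q}. emeasure lborel (A \<inter> block q {j}))"
    by (rule sum.reindex_bij_betw[OF \<sigma>])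
  also have "\<dots> = emeasure lborel (A \<inter> block q {0..<q})"
    by (rule emeasure_block_Int[OF q order_refl A(1), symmetric])
  also have "\<dots> = emeasure lborel A" unfolding block_full[OF q] by (rule nul[OF A, symmetric])
  finally show "emeasure (distr unit_measure unit_measure ?T) A = emeasure unit_measure A"
    using A by (simp add: emeasure_unit)
qed

section \<open>Limits of measure-preserving actions of the integers\<close>

text \<open>
  If two orbits of \<open>x\<close> differ at time \<open>n + 1\<close> but not at time \<open>n\<close>, then the common point at time \<open>n\<close> lies in the set where
  the generators differ. Each time contributes the measure of that set, by invariance; negative times reduce to positive
  ones by following the orbit backwards.
\<close>

lemma (in finite_measure) measure_iterate_disagreement:
  fixes R R' :: "int \<Rightarrow> 'a \<Rightarrow> 'a"
  assumes R: "\<And>m. R m \<in> measurable M M" "\<And>m. distr M M (R m) = M"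
    and zero: "\<And>x. x \<in> space M \<Longrightarrow> R 0 x = x" "\<And>x. x \<in> space M \<Longrightarrow> R' 0 x = x"
    and add: "\<And>m n x. x \<in> space M \<Longrightarrow> R (m + n) x = R m (R n x)"
      "\<And>m n x. x \<in> space M \<Longrightarrow> R' (m + n) x = R' m (R' n x)"
    and meas: "\<And>m. {x\<in>space M. R' m x \<noteq> R m x} \<in> sets M"
    and d: "measure M {x\<in>space M. R' 1 x \<noteq> R 1 x} \<le> d"
  shows "measure M {x\<in>space M. R' m x \<noteq> R m x} \<le> real_of_int \<bar>m\<bar> * d"
proof -
  define D where "D m = {x\<in>space M. R' m x \<noteq> R m x}" for m
  have Ds: "D m \<in> sets M" for m unfolding D_def by (rule meas)
  have sp: "R m x \<in> space M" if "x \<in> space M" for m x using R(1) that by (rule measurable_space)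
  have pull: "measure M (R m -` D n \<inter> space M) = measure M (D n)" for m n
    by (rule measure_vimage_preserving[OF R Ds])
  have nat: "measure M (D (int n)) \<le> n * d" for n
  proof (induction n)
    case 0
    have "D 0 = {}" unfolding D_def using zero by auto
    thus ?case by simp
  next
    case (Suc n)
    have "D (int (Suc n)) \<subseteq> D (int n) \<union> (R (int n) -` D 1 \<inter> space M)"
    proof
      fix x assume x: "x \<in> D (int (Suc n))"
      have xs: "x \<in> space M" using x unfolding D_def by simp
      have e: "int (Suc n) = 1 + int n" by simp
      have "R' 1 (R' (int n) x) \<noteq> R 1 (R (int n) x)"
      proof -
        have "R' (1 + int n) x \<noteq> R (1 + int n) x" using x unfolding D_def e by blast
        thus ?thesis by (simp only: add(1)[OF xs] add(2)[OF xs] not_False_eq_True)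
      qed
      thus "x \<in> D (int n) \<union> (R (int n) -` D 1 \<inter> space M)" using xs sp unfolding D_def by auto
    qed
    hence "measure M (D (int (Suc n))) \<le> measure M (D (int n) \<union> (R (int n) -` D 1 \<inter> space M))"
      using Ds measurable_sets[OF R(1) Ds] by (intro finite_measure_mono) auto
    also have "\<dots> \<le> measure M (D (int n)) + measure M (R (int n) -` D 1 \<inter> space M)"
      using Ds measurable_sets[OF R(1) Ds] by (intro measure_Un_le) auto
    also have "\<dots> \<le> n * d + d" using Suc d unfolding pull by (simp add: D_def)
    finally show ?case by (simp add: algebra_simps)
  qed
  show ?thesis
  proof (cases "m \<ge> 0")
    case True
    thus ?thesis using nat[of "nat m"] unfolding D_def by simp
  next
    case False
    define n where "n = nat (- m)"
    have m: "m = - int n" unfolding n_def using False by simp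
    have "D m \<subseteq> R m -` D (int n) \<inter> space M"
    proof
      fix x assume x: "x \<in> D m"
      have xs: "x \<in> space M" using x unfolding D_def by simp
      define y where "y = R m x"
      have ys: "y \<in> space M" unfolding y_def by (rule sp[OF xs])
      have ret: "R (int n) y = x" unfolding y_def using add(1)[OF xs, of "int n" m] zero(1)[OF xs] m by simp
      have "R' (int n) y \<noteq> R (int n) y"
      proof
        assume "R' (int n) y = R (int n) y"
        hence "R' m x = R' m (R' (int n) y)" using ret by simp
        also have "\<dots> = y" using add(2)[OF ys, of m "int n"] zero(2)[OF ys] m by simp
        finally show False using x unfolding D_def y_def by simp
      qed
      thus "x \<in> R m -` D (int n) \<inter> space M" using xs ys unfolding D_def y_def by auto
    qed
    hence "measure M (D m) \<le> measure M (R m -` D (int n) \<inter> space M)"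
      by (intro finite_measure_mono measurable_sets[OF R(1) Ds])
    also have "\<dots> \<le> n * d" unfolding pull by (rule nat)
    finally show ?thesis unfolding D_def m by simp
  qed
qed

text \<open>
  The set \<open>X\<close> of points \<open>x\<close> such that every \<open>R k m x\<close> is eventually constant in \<open>k\<close> has full measure by the
  Borel-Cantelli argument. It is invariant under the limit action \<open>E\<close>, because \<open>R l n (E m x) = R l (n + m) x\<close> for all
  large \<open>l\<close>. Hence the limit on \<open>X\<close>, continued by the identity, is a genuine bijection and no set of measure zero
  has to be repaired.
\<close>

lemma aut_of_stabilising_actions:
  fixes R :: "nat \<Rightarrow> int \<Rightarrow> real \<Rightarrow> real" and d :: "nat \<Rightarrow> real"
  assumes R: "\<And>k m. R k m \<in> measurable unit_measure unit_measure" "\<And>k m. distr unit_measure unit_measure (R k m) = unit_measure"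
    and zero: "\<And>k x. x \<in> {0..1} \<Longrightarrow> R k 0 x = x"
    and add: "\<And>k m n x. x \<in> {0..1} \<Longrightarrow> R k (m + n) x = R k m (R k n x)"
    and d: "\<And>k. measure unit_measure {x\<in>{0..1}. R (Suc k) 1 x \<noteq> R k 1 x} \<le> d k" and sd: "summable d"
  obtains T where "T \<in> Aut unit_measure"
    "\<And>m k. {x\<in>{0..1}. int_iter unit_measure T m x \<noteq> R k m x} \<in> sets unit_measure"
    "\<And>m k. measure unit_measure {x\<in>{0..1}. int_iter unit_measure T m x \<noteq> R k m x} \<le> real_of_int \<bar>m\<bar> * (\<Sum>l. d (l + k))"
proof -
  let ?M = "unit_measure"
  have Rb [measurable]: "R k m \<in> borel_measurable ?M" for k m
    using R(1)[of k m] unfolding unit_measure_def by (simp add: measurable_restrict_space2_iff)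
  have Rsp: "R k m x \<in> {0..1}" if "x \<in> {0..1}" for k m x
    using measurable_space[OF R(1), of x k m] that by simp
  have sub: "S \<in> sets ?M \<Longrightarrow> S \<subseteq> {0..1}" for S using sets.sets_into_space[of S ?M] by simp
  have neqs: "{x\<in>{0..1}. f x \<noteq> g x} \<in> sets ?M"
    if "f \<in> borel_measurable ?M" "g \<in> borel_measurable ?M" for f g :: "real \<Rightarrow> real"
  proof -
    have "{x\<in>space ?M. f x \<noteq> g x} \<in> sets ?M" using that by measurable
    thus ?thesis by simp
  qed
  define D where "D m k = {x\<in>{0..1}. R (Suc k) m x \<noteq> R k m x}" for m k
  have Ds: "D m k \<in> sets ?M" for m k unfolding D_def by (rule neqs) measurable
  have Dm: "measure ?M (D m k) \<le> real_of_int \<bar>m\<bar> * d k" for m k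
    using unit.measure_iterate_disagreement[of "R k" "R (Suc k)" "d k" m] R zero add d Ds
    unfolding D_def by simp
  define s where "s k = (\<Sum>l. d (l + k))" for k
  have sdk: "summable (\<lambda>l. d (l + k))" for k using sd by (rule summable_ignore_initial_segment)
  have s_lim: "s \<longlonglongrightarrow> 0"
  proof -
    have "s = (\<lambda>k. suminf d - sum d {..<k})" unfolding s_def using suminf_minus_initial_segment[OF sd] by auto
    moreover have "(\<lambda>k. suminf d - sum d {..<k}) \<longlonglongrightarrow> suminf d - suminf d"
      by (intro tendsto_diff tendsto_const summable_LIMSEQ sd)
    ultimately show ?thesis by (simp only: diff_self)
  qed
  define V where "V m k = (\<Union>l. D m (l + k))" for m k
  have Vs: "V m k \<in> sets ?M" for m k unfolding V_def using Ds by auto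
  have Vm: "measure ?M (V m k) \<le> real_of_int \<bar>m\<bar> * s k" for m k
  proof -
    have sm: "summable (\<lambda>l. real_of_int \<bar>m\<bar> * d (l + k))" using sdk by (rule summable_mult)
    have su: "summable (\<lambda>l. measure ?M (D m (l + k)))"
      by (rule summable_comparison_test'[OF sm]) (use Dm in \<open>simp add: measure_nonneg\<close>)
    have "measure ?M (V m k) \<le> (\<Sum>l. measure ?M (D m (l + k)))" unfolding V_def
      by (rule unit.finite_measure_subadditive_countably) (use Ds su in auto)
    also have "\<dots> \<le> (\<Sum>l. real_of_int \<bar>m\<bar> * d (l + k))" by (rule suminf_le[OF Dm su sm])
    also have "\<dots> = real_of_int \<bar>m\<bar> * s k" unfolding s_def by (rule suminf_mult[OF sdk])
    finally show ?thesis .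
  qed
  have const: "R l m x = R k m x" if x: "x \<in> {0..1}" "x \<notin> V m k" and l: "l \<ge> k" for l m k x
    using l
  proof (induction l rule: dec_induct)
    case (step l)
    have "x \<notin> D m l" using x(2) step(1) unfolding V_def by (metis UN_I UNIV_I le_add_diff_inverse2)
    thus ?case using x(1) step unfolding D_def by auto
  qed simp
  define Z where "Z = (\<Union>m. \<Inter>k. V m k)"
  have Zm: "measure ?M (\<Inter>k. V m k) = 0" for m
  proof -
    have "measure ?M (\<Inter>k. V m k) \<le> real_of_int \<bar>m\<bar> * s k" for k
      by (rule order_trans[OF unit.finite_measure_mono Vm]) (use Vs in auto)
    moreover have "(\<lambda>k. real_of_int \<bar>m\<bar> * s k) \<longlonglongrightarrow> real_of_int \<bar>m\<bar> * 0" by (intro tendsto_mult tendsto_const s_lim)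
    ultimately have "measure ?M (\<Inter>k. V m k) \<le> real_of_int \<bar>m\<bar> * 0" by (intro LIMSEQ_le_const) auto
    thus ?thesis using measure_nonneg[of ?M] by (simp add: order_antisym)
  qed
  have Zn: "Z \<in> null_sets ?M" unfolding Z_def
  proof (rule null_sets_UN)
    fix m show "(\<Inter>k. V m k) \<in> null_sets ?M"
      using Zm Vs by (auto simp: null_sets_def unit.emeasure_eq_measure)
  qed
  have Zs: "Z \<in> sets ?M" using Zn by auto
  define X where "X = {x\<in>{0..1}. \<forall>m. \<exists>k. \<forall>l\<ge>k. R l m x = R k m x}"
  have XZ: "{0..1} - Z \<subseteq> X" unfolding X_def Z_def using const by blast
  have Xs: "X \<in> sets ?M"
  proof -
    have "{x\<in>space ?M. \<forall>m. \<exists>k. \<forall>l\<ge>k. R l m x = R k m x} \<in> sets ?M" by measurable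
    thus ?thesis unfolding X_def by simp
  qed
  define E where "E m x = (if x \<in> X then lim (\<lambda>k. R k m x) else x)" for m x
  have Eev: "\<forall>\<^sub>F l in sequentially. R l m x = E m x" if x: "x \<in> X" for m x
  proof -
    obtain k where k: "\<And>l. l \<ge> k \<Longrightarrow> R l m x = R k m x" using x unfolding X_def by blast
    have ev: "\<forall>\<^sub>F l in sequentially. R l m x = R k m x"
      unfolding eventually_sequentially using k by blast
    hence "(\<lambda>l. R l m x) \<longlonglongrightarrow> R k m x" by (rule tendsto_eventually)
    hence "lim (\<lambda>l. R l m x) = R k m x" by (rule limI)
    hence "E m x = R k m x" unfolding E_def using x by (simp only: if_True)
    thus ?thesis using ev by (simp only:)
  qed
  have Esp: "E m x \<in> {0..1}" if x: "x \<in> {0..1}" for m x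
  proof (cases "x \<in> X")
    case True
    then obtain l where "R l m x = E m x" using Eev[of x m] eventually_sequentially by auto
    thus ?thesis using Rsp[OF x] by metis
  qed (use x in \<open>simp add: E_def\<close>)
  have E0: "E 0 x = x" if x: "x \<in> {0..1}" for x
  proof (cases "x \<in> X")
    case True
    then obtain l where "R l 0 x = E 0 x" using Eev[of x 0] eventually_sequentially by auto
    thus ?thesis using zero[OF x] by metis
  qed (simp add: E_def)
  have comp: "\<forall>\<^sub>F l in sequentially. R l n (E m x) = E (n + m) x" if x: "x \<in> X" for m n x
  proof -
    have x1: "x \<in> {0..1}" using x unfolding X_def by blast
    show ?thesis using Eev[OF x, of m] Eev[OF x, of "n + m"]
      by eventually_elim (metis add[OF x1])
  qed
  have EX: "E m x \<in> X" if x: "x \<in> X" for m x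
  proof -
    have "x \<in> {0..1}" using x unfolding X_def by blast
    hence "E m x \<in> {0..1}" by (rule Esp)
    moreover have "\<exists>k. \<forall>l\<ge>k. R l n (E m x) = R k n (E m x)" for n
    proof -
      obtain k where "\<And>l. l \<ge> k \<Longrightarrow> R l n (E m x) = E (n + m) x"
        using comp[OF x, of n m] unfolding eventually_sequentially by blast
      hence "\<forall>l\<ge>k. R l n (E m x) = R k n (E m x)" by (metis order_refl)
      thus ?thesis by blast
    qed
    ultimately show ?thesis unfolding X_def by blast
  qed
  have Eadd: "E n (E m x) = E (n + m) x" if x: "x \<in> {0..1}" for m n x
  proof (cases "x \<in> X")
    case True
    have "\<forall>\<^sub>F l in sequentially. E n (E m x) = E (n + m) x"
      using Eev[OF EX[OF True], of n m] comp[OF True, of n m] by eventually_elim simp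
    thus ?thesis by simp
  qed (simp add: E_def)
  have Eb [measurable]: "E m \<in> borel_measurable ?M" for m
  proof (rule borel_measurable_LIMSEQ_real)
    fix x show "(\<lambda>k. if x \<in> X then R k m x else x) \<longlonglongrightarrow> E m x"
    proof (cases "x \<in> X")
      case True
      thus ?thesis using tendsto_eventually[OF Eev[OF True, of m]] by simp
    qed (simp add: E_def)
  next
    fix k
    have idb: "(\<lambda>x. x) \<in> borel_measurable ?M" unfolding unit_measure_def by (rule measurable_restrict_space1) simp
    have eq: "{x \<in> space ?M. x \<in> X} = X" using sub[OF Xs] by auto
    show "(\<lambda>x. if x \<in> X then R k m x else x) \<in> borel_measurable ?M"
      by (rule measurable_If[OF Rb idb]) (simp only: eq Xs)
  qed
  have EM: "E m \<in> measurable ?M ?M" for m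
    using Eb[of m] Esp unfolding unit_measure_def
    by (subst measurable_restrict_space2_iff) (auto simp: space_restrict_space)
  have Edis: "{x\<in>{0..1}. E m x \<noteq> R k m x} \<in> sets ?M" for m k by (rule neqs) measurable
  have Eclose: "measure ?M {x\<in>{0..1}. E m x \<noteq> R k m x} \<le> real_of_int \<bar>m\<bar> * s k" for m k
  proof -
    have "{x\<in>{0..1}. E m x \<noteq> R k m x} \<subseteq> Z \<union> V m k"
    proof (rule subsetI, rule ccontr)
      fix x assume x: "x \<in> {x\<in>{0..1}. E m x \<noteq> R k m x}" "x \<notin> Z \<union> V m k"
      hence xX: "x \<in> X" using XZ by auto
      obtain l0 where l0: "\<And>l. l \<ge> l0 \<Longrightarrow> R l m x = E m x"
        using Eev[OF xX, of m] unfolding eventually_sequentially by blast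
      have "R (max l0 k) m x = R k m x" by (rule const) (use x in auto)
      thus False using l0[of "max l0 k"] x by simp
    qed
    hence "measure ?M {x\<in>{0..1}. E m x \<noteq> R k m x} \<le> measure ?M (Z \<union> V m k)"
      using Zs Vs by (intro unit.finite_measure_mono) auto
    also have "\<dots> \<le> measure ?M Z + measure ?M (V m k)" using Zs Vs by (intro measure_Un_le) auto
    also have "measure ?M Z = 0" using Zn by (simp add: measure_def null_sets_def)
    finally show ?thesis using Vm[of m k] by simp
  qed
  have Edistr: "distr ?M ?M (E m) = ?M" for m
  proof (rule measure_eqI)
    fix A assume "A \<in> sets (distr ?M ?M (E m))"
    hence A: "A \<in> sets ?M" by simp
    have vs: "E m -` A \<inter> space ?M \<in> sets ?M" "R k m -` A \<inter> space ?M \<in> sets ?M" for k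
      by (rule measurable_sets[OF EM A], rule measurable_sets[OF R(1) A])
    have "\<bar>measure ?M (E m -` A \<inter> space ?M) - measure ?M A\<bar> \<le> real_of_int \<bar>m\<bar> * s k" for k
    proof -
      let ?D = "{x\<in>{0..1}. E m x \<noteq> R k m x}"
      have 1: "measure ?M P \<le> measure ?M Q + measure ?M ?D"
        if "P \<subseteq> Q \<union> ?D" "Q \<in> sets ?M" for P Q
        by (rule order_trans[OF unit.finite_measure_mono[OF that(1) sets.Un[OF that(2) Edis]]
              measure_Un_le[OF that(2) Edis]])
      have "measure ?M (E m -` A \<inter> space ?M) \<le> measure ?M (R k m -` A \<inter> space ?M) + measure ?M ?D"
        by (rule 1[OF _ vs(2)]) auto
      moreover have "measure ?M (R k m -` A \<inter> space ?M) \<le> measure ?M (E m -` A \<inter> space ?M) + measure ?M ?D"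
        by (rule 1[OF _ vs(1)]) auto
      moreover have "measure ?M (R k m -` A \<inter> space ?M) = measure ?M A"
        by (rule measure_vimage_preserving[OF R A])
      ultimately show ?thesis using Eclose[of m k] by linarith
    qed
    moreover have "(\<lambda>k. real_of_int \<bar>m\<bar> * s k) \<longlonglongrightarrow> real_of_int \<bar>m\<bar> * 0" by (intro tendsto_mult tendsto_const s_lim)
    ultimately have "\<bar>measure ?M (E m -` A \<inter> space ?M) - measure ?M A\<bar> \<le> real_of_int \<bar>m\<bar> * 0"
      by (intro LIMSEQ_le_const) auto
    hence "measure ?M (E m -` A \<inter> space ?M) = measure ?M A" by simp
    thus "emeasure (distr ?M ?M (E m)) A = emeasure ?M A"
      using A by (simp add: emeasure_distr[OF EM] unit.emeasure_eq_measure)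
  qed simp
  define T where "T = E 1"
  have inv1: "E (-1) (T x) = x" "T (E (-1) x) = x" if "x \<in> {0..1}" for x
    unfolding T_def using Eadd[OF that] E0[OF that] by simp_all
  have bij: "bij_betw T {0..1} {0..1}"
  proof (rule bij_betw_byWitness[where f' = "E (-1)"])
    show "\<forall>x\<in>{0..1}. E (-1) (T x) = x" "\<forall>x\<in>{0..1}. T (E (-1) x) = x" using inv1 by blast+
    show "T ` {0..1} \<subseteq> {0..1}" "E (-1) ` {0..1} \<subseteq> {0..1}" unfolding T_def using Esp by blast+
  qed
  have inv: "inv_into {0..1} T x = E (-1) x" if x: "x \<in> {0..1}" for x
    by (rule inv_into_f_eq[OF bij_betw_imp_inj_on[OF bij] Esp[OF x] inv1(2)[OF x]])
  have "inv_into (space ?M) T \<in> measurable ?M ?M"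
  proof (subst measurable_cong)
    show "inv_into (space ?M) T x = E (-1) x" if "x \<in> space ?M" for x using inv[of x] that by simp
  qed (rule EM)
  hence aut: "T \<in> Aut ?M" unfolding Aut_def using bij EM Edistr by (simp add: T_def)
  have pos: "(T ^^ n) x = E (int n) x" if x: "x \<in> {0..1}" for n x
  proof (induction n)
    case (Suc n)
    have "(T ^^ Suc n) x = E 1 (E (int n) x)" using Suc by (simp add: T_def)
    also have "\<dots> = E (1 + int n) x" by (rule Eadd[OF x])
    finally show ?case by simp
  qed (simp add: E0[OF x])
  have neg: "(inv_into {0..1} T ^^ n) x = E (- int n) x" if x: "x \<in> {0..1}" for n x
  proof (induction n)
    case (Suc n)
    have "(inv_into {0..1} T ^^ Suc n) x = E (-1) (E (- int n) x)" using Suc inv[OF Esp[OF x]] by simp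
    also have "\<dots> = E (-1 + - int n) x" by (rule Eadd[OF x])
    finally show ?case by (simp add: algebra_simps)
  qed (simp add: E0[OF x])
  have it: "int_iter ?M T m x = E m x" if x: "x \<in> {0..1}" for m x
    unfolding int_iter_def using pos[OF x, of "nat m"] neg[OF x, of "nat (- m)"] by simp
  have eq: "{x\<in>{0..1}. int_iter ?M T m x \<noteq> R k m x} = {x\<in>{0..1}. E m x \<noteq> R k m x}" for m k
    using it by auto
  show ?thesis
  proof (rule that[OF aut])
    fix m k
    show "{x\<in>{0..1}. int_iter ?M T m x \<noteq> R k m x} \<in> sets ?M" unfolding eq by (rule Edis)
    show "measure ?M {x\<in>{0..1}. int_iter ?M T m x \<noteq> R k m x} \<le> real_of_int \<bar>m\<bar> * (\<Sum>l. d (l + k))"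
      unfolding eq s_def[symmetric] by (rule Eclose)
  qed
qed

section \<open>Cyclic interval exchanges and their refinement\<close>

lemma (in finite_measure) measure_diff_le_sym_diff:
  assumes "P \<in> sets M" "Q \<in> sets M"
  shows "\<bar>measure M P - measure M Q\<bar> \<le> measure M (sym_diff P Q)"
proof -
  have 1: "measure M P \<le> measure M Q + measure M (sym_diff P Q)" if "P \<in> sets M" "Q \<in> sets M" for P Q
  proof -
    have "measure M P \<le> measure M (Q \<union> sym_diff P Q)" using that by (intro finite_measure_mono) auto
    also have "\<dots> \<le> measure M Q + measure M (sym_diff P Q)" using that by (intro measure_Un_le) auto
    finally show ?thesis .
  qed
  show ?thesis using 1[OF assms] 1[OF assms(2,1)] by (simp add: Un_commute abs_le_iff)
qed

text \<open>
  The enumeration \<open>c\<close> lists the positions of the \<open>q\<close> intervals in the order in which the cycle visits them.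
  Making the exponent an argument gives an action of the integers directly, without iterating an inverse.
\<close>

definition cyclic_action :: "int \<Rightarrow> (int \<Rightarrow> int) \<Rightarrow> int \<Rightarrow> real \<Rightarrow> real" where
  "cyclic_action q c m = interval_exchange q (\<lambda>j. c ((inv_into {0..<q} c j + m) mod q))"

context
  fixes q :: int and c :: "int \<Rightarrow> int"
  assumes q: "q > 0" and c: "bij_betw c {0..<q} {0..<q}"
begin

lemma enumeration_inverse:
  shows "j \<in> {0..<q} \<Longrightarrow> inv_into {0..<q} c j \<in> {0..<q}"
    and "j \<in> {0..<q} \<Longrightarrow> c (inv_into {0..<q} c j) = j"
    and "i \<in> {0..<q} \<Longrightarrow> inv_into {0..<q} c (c i) = i"
    and "i \<in> {0..<q} \<Longrightarrow> c i \<in> {0..<q}"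
  using c by (auto simp: bij_betw_def inv_into_into f_inv_into_f inv_into_f_f)
     (metis atLeastLessThan_iff inv_into_into)+

lemma cyclic_index_range: "j \<in> {0..<q} \<Longrightarrow> c ((inv_into {0..<q} c j + m) mod q) \<in> {0..<q}"
  using q by (intro enumeration_inverse(4)) simp

lemma cyclic_index_bij: "bij_betw (\<lambda>j. c ((inv_into {0..<q} c j + m) mod q)) {0..<q} {0..<q}"
proof (rule bij_betw_byWitness[where f' = "\<lambda>j. c ((inv_into {0..<q} c j - m) mod q)"])
  have r: "i mod q \<in> {0..<q}" for i using q by simp
  show "\<forall>a\<in>{0..<q}. c ((inv_into {0..<q} c (c ((inv_into {0..<q} c a + m) mod q)) - m) mod q) = a"
    "\<forall>a\<in>{0..<q}. c ((inv_into {0..<q} c (c ((inv_into {0..<q} c a - m) mod q)) + m) mod q) = a"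
    using enumeration_inverse(1,2) by (auto simp: enumeration_inverse(3)[OF r] mod_simps)
qed (use cyclic_index_range[of _ m] cyclic_index_range[of _ "- m"] in auto)

lemma cyclic_action_measurable: "cyclic_action q c m \<in> measurable unit_measure unit_measure"
  unfolding cyclic_action_def by (rule interval_exchange_measurable[OF q cyclic_index_range])

lemma cyclic_action_distr: "distr unit_measure unit_measure (cyclic_action q c m) = unit_measure"
  unfolding cyclic_action_def by (rule interval_exchange_distr[OF q cyclic_index_bij])

lemma cyclic_action_zero: "cyclic_action q c 0 x = x"
  unfolding cyclic_action_def
proof (rule interval_exchange_id[OF q])
  fix j assume "j \<in> {0..<q}"
  thus "c ((inv_into {0..<q} c j + 0) mod q) = j" using enumeration_inverse(1,2)[of j] by simp
qed

lemma cyclic_action_add: "cyclic_action q c (m + n) x = cyclic_action q c m (cyclic_action q c n x)"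
proof -
  have r: "i mod q \<in> {0..<q}" for i using q by simp
  show ?thesis unfolding cyclic_action_def
    by (subst interval_exchange_compose[OF q cyclic_index_range])
       (simp_all add: enumeration_inverse(3)[OF r] mod_add_left_eq mod_add_right_eq algebra_simps)
qed

end

text \<open>
  The exceptional set of the first part consists of the slips of \<open>\<pi>\<close>, the last index, and the fibre over \<open>q - 1\<close>, whose
  successor labels are not aligned; the last two have relative size at most \<open>2 / q\<close> together.
\<close>

lemma cyclic_action_refinement:
  fixes q r :: int and c c' \<pi> :: "int \<Rightarrow> int"
  assumes q: "q > 0" and r: "r > 0" and c: "bij_betw c {0..<q} {0..<q}"
    and c': "bij_betw c' {0..<q * r} {0..<q * r}"
    and pix: "\<And>i. i \<in> {0..<q * r} \<Longrightarrow> \<pi> i \<in> {0..<q}"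
    and fib: "\<And>a. a \<in> {0..<q} \<Longrightarrow> card {i\<in>{0..<q * r}. \<pi> i = a} = nat r"
    and dv: "\<And>i. i \<in> {0..<q * r} \<Longrightarrow> c' i div r = c (\<pi> i)"
    and md: "\<And>i. i \<in> {0..<q * r} \<Longrightarrow> i + 1 < q * r \<Longrightarrow> \<pi> (i + 1) = \<pi> i + 1 \<Longrightarrow> c' (i + 1) mod r = c' i mod r"
  shows "measure unit_measure {x\<in>{0..1}. cyclic_action (q * r) c' 1 x \<noteq> cyclic_action q c 1 x}
      \<le> card {i\<in>{0..<q * r}. \<pi> ((i + 1) mod (q * r)) \<noteq> (\<pi> i + 1) mod q} / (q * r) + 2 / q"
    and "A \<subseteq> {0..<q} \<Longrightarrow> B \<subseteq> {0..<q} \<Longrightarrow>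
      measure unit_measure (block q (c ` A) \<inter> (cyclic_action (q * r) c' m -` block q (c ` B) \<inter> {0..1}))
      = card {i\<in>{0..<q * r}. \<pi> i \<in> A \<and> \<pi> ((i + m) mod (q * r)) \<in> B} / (q * r)"
proof -
  define Q where "Q = q * r"
  have Q: "Q > 0" unfolding Q_def using q r by simp
  have cQ: "bij_betw c' {0..<Q} {0..<Q}" unfolding Q_def by (rule c')
  note inv = enumeration_inverse[OF q c] and inv' = enumeration_inverse[OF Q cQ]
  define j' where "j' x = inv_into {0..<Q} c' \<lfloor>Q * x\<rfloor>" for x :: real
  have j': "j' x \<in> {0..<Q}" "c' (j' x) = \<lfloor>Q * x\<rfloor>" if "0 \<le> x" "x < 1" for x :: real
    using floor_block_index[OF Q that] inv'(1,2) unfolding j'_def by blast+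
  have fl: "\<lfloor>q * x\<rfloor> = c (\<pi> (j' x))" if x: "0 \<le> x" "x < 1" for x :: real
  proof -
    have "q * x = (Q * x) / r" unfolding Q_def using r by simp
    hence "\<lfloor>q * x\<rfloor> = \<lfloor>Q * x\<rfloor> div r" using r by (metis floor_divide_real_eq_div less_imp_le)
    thus ?thesis using dv[of "j' x"] j'[OF x] unfolding Q_def by simp
  qed
  have mb: "measure unit_measure (block Q (c' ` S)) = card S / Q" if S: "S \<subseteq> {0..<Q}" for S
  proof -
    have "card (c' ` S) = card S"
      using cQ S by (intro card_image) (auto simp: bij_betw_def intro: inj_on_subset)
    thus ?thesis using measure_block[OF Q, of "c' ` S"] cQ S by (auto simp: bij_betw_def)
  qed
  have inblock: "x \<in> block Q (c' ` S) \<longleftrightarrow> 0 \<le> x \<and> x < 1 \<and> j' x \<in> S" if S: "S \<subseteq> {0..<Q}" for S x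
  proof (cases "0 \<le> x \<and> x < 1")
    case True
    have "inj_on c' {0..<Q}" using cQ by (simp add: bij_betw_def)
    hence "c' (j' x) \<in> c' ` S \<longleftrightarrow> j' x \<in> S"
      using j'(1)[of x] True S by (intro inj_on_image_mem_iff) auto
    thus ?thesis unfolding block_def using True j'(2)[of x] by simp
  qed (auto simp: block_def)
  show "measure unit_measure {x\<in>{0..1}. cyclic_action (q * r) c' 1 x \<noteq> cyclic_action q c 1 x}
      \<le> card {i\<in>{0..<q * r}. \<pi> ((i + 1) mod (q * r)) \<noteq> (\<pi> i + 1) mod q} / (q * r) + 2 / q"
  proof -
    define S1 where "S1 = {i\<in>{0..<Q}. \<pi> ((i + 1) mod Q) \<noteq> (\<pi> i + 1) mod q}"
    define S2 where "S2 = {i\<in>{0..<Q}. \<pi> i = q - 1}"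
    define S where "S = S1 \<union> S2 \<union> {Q - 1}"
    have SQ: "S \<subseteq> {0..<Q}" unfolding S_def S1_def S2_def using Q by auto
    have "{x\<in>{0..1}. cyclic_action Q c' 1 x \<noteq> cyclic_action q c 1 x} \<subseteq> block Q (c' ` S)"
    proof (rule subsetI, rule ccontr)
      fix x assume x: "x \<in> {x\<in>{0..1}. cyclic_action Q c' 1 x \<noteq> cyclic_action q c 1 x}"
        and nb: "x \<notin> block Q (c' ` S)"
      have "x \<noteq> 1" using x unfolding cyclic_action_def interval_exchange_def by auto
      hence x01: "0 \<le> x" "x < 1" using x by auto
      define i where "i = j' x"
      have i: "i \<in> {0..<Q}" "c' i = \<lfloor>Q * x\<rfloor>" unfolding i_def by (rule j'[OF x01])+
      have nS: "i \<notin> S" using nb inblock[OF SQ] x01 unfolding i_def by blast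
      have i1: "i + 1 \<in> {0..<Q}" "(i + 1) mod Q = i + 1" using nS i unfolding S_def by auto
      have "\<pi> i \<in> {0..<q}" "\<pi> i \<noteq> q - 1" using pix[of i] i nS unfolding S_def S2_def Q_def by auto
      hence "(\<pi> i + 1) mod q = \<pi> i + 1" by simp
      hence p1: "\<pi> (i + 1) = \<pi> i + 1" "c ((\<pi> i + 1) mod q) = c (\<pi> (i + 1))"
        using nS i i1 unfolding S_def S1_def by auto
      have m: "c' (i + 1) mod r = c' i mod r"
        by (rule md) (use i i1 p1 in \<open>auto simp: Q_def\<close>)
      have "c' (i + 1) = c (\<pi> (i + 1)) * r + c' (i + 1) mod r" "c' i = c (\<pi> i) * r + c' i mod r"
        using dv[of "i + 1"] dv[of i] i i1 unfolding Q_def by (metis div_mult_mod_eq)+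
      hence diff: "c' (i + 1) - c' i = (c (\<pi> (i + 1)) - c (\<pi> i)) * r"
        unfolding m by (simp add: algebra_simps)
      have "cyclic_action Q c' 1 x = x + (c' (i + 1) - c' i) / Q"
        unfolding cyclic_action_def interval_exchange_def using x01 i i1 inv'(3)[OF i(1)]
        by (simp flip: i(2))
      also have "real_of_int (c' (i + 1) - c' i) / Q = (c (\<pi> (i + 1)) - c (\<pi> i)) / q"
        unfolding diff Q_def using r by simp
      also have "x + (c (\<pi> (i + 1)) - c (\<pi> i)) / q = cyclic_action q c 1 x"
        using x01 fl[OF x01] inv(3)[of "\<pi> i"] pix[of i] i p1
        unfolding cyclic_action_def interval_exchange_def i_def[symmetric] Q_def by simp
      finally show False using x by simp
    qed
    hence "measure unit_measure {x\<in>{0..1}. cyclic_action Q c' 1 x \<noteq> cyclic_action q c 1 x}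
        \<le> measure unit_measure (block Q (c' ` S))"
      by (rule unit.finite_measure_mono) (rule block_sets_unit)
    also have "\<dots> = card S / Q" by (rule mb[OF SQ])
    also have "\<dots> \<le> (card S1 + nat r + 1) / Q"
    proof (rule divide_right_mono)
      have "card S \<le> card S1 + card S2 + card {Q - 1}" unfolding S_def
        by (meson card_Un_le add_right_mono order_trans)
      moreover have "card S2 = nat r" unfolding S2_def Q_def using fib[of "q - 1"] q by simp
      ultimately show "real (card S) \<le> real (card S1 + nat r + 1)" by simp
    qed (use Q in simp)
    also have "\<dots> = card S1 / Q + (r + 1) / Q" using r by (simp add: add_divide_distrib)
    also have "(r + 1) / Q \<le> 2 / q"
    proof -
      have "real_of_int (r + 1) \<le> 2 * r" using r by simp
      hence "real_of_int (r + 1) / Q \<le> (2 * r) / Q" using Q by (intro divide_right_mono) auto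
      thus ?thesis unfolding Q_def using r by simp
    qed
    finally show ?thesis unfolding S1_def Q_def by simp
  qed
  assume AB: "A \<subseteq> {0..<q}" "B \<subseteq> {0..<q}"
  define S where "S = {i\<in>{0..<Q}. \<pi> i \<in> A \<and> \<pi> ((i + m) mod Q) \<in> B}"
  have SQ: "S \<subseteq> {0..<Q}" unfolding S_def by auto
  have cim: "c a \<in> c ` Y \<longleftrightarrow> a \<in> Y" if "a \<in> {0..<q}" "Y \<subseteq> {0..<q}" for a Y
    using c that by (intro inj_on_image_mem_iff) (auto simp: bij_betw_def)
  have "block q (c ` A) \<inter> (cyclic_action Q c' m -` block q (c ` B) \<inter> {0..1}) = block Q (c' ` S)"
  proof (rule set_eqI)
    fix x
    show "x \<in> block q (c ` A) \<inter> (cyclic_action Q c' m -` block q (c ` B) \<inter> {0..1}) \<longleftrightarrow> x \<in> block Q (c' ` S)"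
    proof (cases "0 \<le> x \<and> x < 1")
      case True
      hence x: "0 \<le> x" "x < 1" by auto
      define i where "i = j' x"
      have i: "i \<in> {0..<Q}" "c' i = \<lfloor>Q * x\<rfloor>" unfolding i_def by (rule j'[OF x])+
      define y where "y = cyclic_action Q c' m x"
      have im: "(i + m) mod Q \<in> {0..<Q}" using Q by simp
      have y: "0 \<le> y" "y < 1" "\<lfloor>Q * y\<rfloor> = c' ((i + m) mod Q)"
        using interval_exchange_block[of Q "\<lambda>j. c' ((inv_into {0..<Q} c' j + m) mod Q)" x,
            OF Q cyclic_index_range[OF Q cQ] x] inv'(3)[OF i(1)]
        unfolding y_def cyclic_action_def by (simp_all flip: i(2))
      have jy: "j' y = (i + m) mod Q" unfolding j'_def y(3) by (rule inv'(3)[OF im])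
      have "x \<in> block q (c ` A) \<longleftrightarrow> \<pi> i \<in> A"
        unfolding block_def using x fl[OF x] cim[OF pix AB(1), of i] i by (simp add: i_def Q_def)
      moreover have "y \<in> block q (c ` B) \<longleftrightarrow> \<pi> ((i + m) mod Q) \<in> B"
        unfolding block_def using y fl[OF y(1,2)] cim[OF pix AB(2), of "(i + m) mod Q"] im jy by (simp add: Q_def)
      ultimately show ?thesis unfolding inblock[OF SQ] using x i unfolding S_def y_def i_def by auto
    qed (auto simp: block_def)
  qed
  thus "measure unit_measure (block q (c ` A) \<inter> (cyclic_action (q * r) c' m -` block q (c ` B) \<inter> {0..1}))
      = card {i\<in>{0..<q * r}. \<pi> i \<in> A \<and> \<pi> ((i + m) mod (q * r)) \<in> B} / (q * r)"
    using mb[OF SQ] unfolding S_def Q_def by simp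
qed

text \<open>
  The two alternatives are the limits required for \<open>\<xi>\<^sub>j = 0\<close> and for \<open>\<xi>\<^sub>j = 1\<close>.
\<close>

definition block_deviation :: "bool \<Rightarrow> int \<Rightarrow> (real \<Rightarrow> real) \<Rightarrow> int set \<Rightarrow> int set \<Rightarrow> real" where
  "block_deviation rigid q f A B =
    \<bar>measure unit_measure (block q A \<inter> (f -` block q B \<inter> {0..1}))
      - (if rigid then measure unit_measure (block q A \<inter> block q B)
         else measure unit_measure (block q A) * measure unit_measure (block q B))\<bar>"

text \<open>
  The new length \<open>q'\<close> may be taken as large as desired after \<open>n\<close> is known. This is needed to make the term \<open>2 / q\<close> of
  the following step small compared with \<open>1 / \<bar>\<phi>\<^sub>j(n)\<bar>\<close>.
\<close>

lemma cyclic_refinement_step: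
  fixes N :: nat and \<phi> :: "nat \<Rightarrow> nat \<Rightarrow> int" and \<xi> :: "nat \<Rightarrow> int" and q :: int and \<epsilon> \<eta> :: real
  assumes ind: "asymptotically_independent N \<phi>" and q: "q > 0" and c: "bij_betw c {0..<q} {0..<q}"
    and eps: "\<epsilon> > 0" and eta: "\<eta> > 0" and xi: "\<And>j. j \<in> {1..N} \<Longrightarrow> \<xi> j \<in> {0, 1}"
  shows "\<forall>\<^sub>F n in sequentially. \<forall>C::int. \<exists>q' c'. q' > 0 \<and> q' \<ge> C \<and> bij_betw c' {0..<q'} {0..<q'} \<and>
     measure unit_measure {x\<in>{0..1}. cyclic_action q' c' 1 x \<noteq> cyclic_action q c 1 x} \<le> \<epsilon> + 2 / q \<and>
     (\<forall>j\<in>{1..N}. \<forall>A\<subseteq>{0..<q}. \<forall>B\<subseteq>{0..<q}.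
       block_deviation (\<xi> j = 0) q (cyclic_action q' c' (\<phi> j n)) A B \<le> \<eta>)"
proof -
  define \<delta> where "\<delta> = \<eta> / (5 * q)"
  have del: "\<delta> > 0" "5 * \<delta> * q = \<eta>" unfolding \<delta>_def using q eta by simp_all
  have ab: "1 / real_of_int q < (1 + \<epsilon> / 3) / q" using q eps by (simp add: divide_strict_right_mono)
  from simultaneous_approximation[OF ind ab del(1)]
  show ?thesis
  proof (rule eventually_mono, intro allI)
    fix n C
    assume ap: "\<forall>\<beta>. \<exists>x\<in>{1 / real_of_int q..(1 + \<epsilon> / 3) / q}. \<forall>j\<in>{1..N}. \<exists>z::int.
      \<bar>x * of_int (\<phi> j n) - \<beta> j - of_int z\<bar> \<le> \<delta>"
    have "\<exists>x\<in>{1 / real_of_int q..(1 + \<epsilon> / 3) / q}. \<forall>j\<in>{1..N}. \<exists>z::int.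
      \<bar>x * of_int (\<phi> j n) - \<xi> j * s / q - of_int z\<bar> \<le> \<delta>" for s :: int
      using ap[rule_format, of "\<lambda>j. \<xi> j * s / q"] by simp
    then obtain x where x: "\<And>s::int. x s \<in> {1 / real_of_int q..(1 + \<epsilon> / 3) / q}"
      "\<And>s j. j \<in> {1..N} \<Longrightarrow> \<exists>z::int. \<bar>x s * of_int (\<phi> j n) - \<xi> j * s / q - of_int z\<bar> \<le> \<delta>" by metis
    have e3: "\<epsilon> / 3 > 0" using eps by simp
    obtain r \<pi> where r: "r > 0" "q * r \<ge> C" and pix: "\<And>i. i \<in> {0..<q * r} \<Longrightarrow> \<pi> i \<in> {0..<q}"
      and fib: "\<And>a. a \<in> {0..<q} \<Longrightarrow> card {i\<in>{0..<q * r}. \<pi> i = a} = nat r"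
      and slip: "card {i\<in>{0..<q * r}. \<pi> ((i + 1) mod (q * r)) \<noteq> (\<pi> i + 1) mod q} \<le> 3 * (\<epsilon> / 3) * (q * r)"
      and mixed: "\<And>j A B. j \<in> {1..N} \<Longrightarrow> A \<subseteq> {0..<q} \<Longrightarrow> B \<subseteq> {0..<q} \<Longrightarrow>
      \<bar>card {i\<in>{0..<q * r}. \<pi> i \<in> A \<and> \<pi> ((i + \<phi> j n) mod (q * r)) \<in> B} / (q * r)
        - (if \<xi> j = 0 then card (A \<inter> B) / q else (card A / q) * (card B / q))\<bar> \<le> 5 * \<delta> * q"
    proof (rule drift_coding[of q "\<epsilon> / 3" \<delta> N \<xi> x "\<lambda>j. \<phi> j n" C])
      show "1 / real_of_int q \<le> x s \<and> x s \<le> (1 + \<epsilon> / 3) / q" for s using x(1)[of s] by simp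
      show "\<exists>z::int. \<bar>x s * real_of_int (\<phi> j n) - real_of_int (\<xi> j * s) / real_of_int q - real_of_int z\<bar> \<le> \<delta>"
        if "j \<in> {1..N}" for s j using x(2)[OF that, of s] by simp
    qed (use q e3 del xi in auto)
    obtain c' where c': "bij_betw c' {0..<q * r} {0..<q * r}"
      "\<And>i. i \<in> {0..<q * r} \<Longrightarrow> c' i div r = c (\<pi> i)"
      "\<And>i. i \<in> {0..<q * r} \<Longrightarrow> i + 1 < q * r \<Longrightarrow> \<pi> (i + 1) = \<pi> i + 1 \<Longrightarrow> c' (i + 1) mod r = c' i mod r"
      using refine_enumeration[OF q r(1) c pix fib] by blast
    have qr: "q * r > 0" using q r by simp
    have "measure unit_measure {x\<in>{0..1}. cyclic_action (q * r) c' 1 x \<noteq> cyclic_action q c 1 x}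
      \<le> card {i\<in>{0..<q * r}. \<pi> ((i + 1) mod (q * r)) \<noteq> (\<pi> i + 1) mod q} / (q * r) + 2 / q"
      by (rule cyclic_action_refinement(1)[OF q r(1) c c'(1)]) (fact pix fib c'(2) c'(3))+
    also have "card {i\<in>{0..<q * r}. \<pi> ((i + 1) mod (q * r)) \<noteq> (\<pi> i + 1) mod q} / (q * r) \<le> \<epsilon>"
    proof -
      have "real_of_int (q * r) > 0" using qr by (simp only: of_int_0_less_iff)
      thus ?thesis using slip by (simp only: pos_divide_le_eq)
    qed
    finally have g1: "measure unit_measure {x\<in>{0..1}. cyclic_action (q * r) c' 1 x \<noteq> cyclic_action q c 1 x} \<le> \<epsilon> + 2 / q"
      by simp
    have g2: "block_deviation (\<xi> j = 0) q (cyclic_action (q * r) c' (\<phi> j n)) A B \<le> \<eta>"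
      if j: "j \<in> {1..N}" and AB: "A \<subseteq> {0..<q}" "B \<subseteq> {0..<q}" for j A B
    proof -
      have pull: "\<exists>A'. A' \<subseteq> {0..<q} \<and> c ` A' = A" if "A \<subseteq> {0..<q}" for A
        using that c by (metis bij_betw_imp_surj_on subset_imageE)
      obtain A' B' where A': "A' \<subseteq> {0..<q}" "c ` A' = A" and B': "B' \<subseteq> {0..<q}" "c ` B' = B"
        using pull AB by meson
      have ci: "inj_on c {0..<q}" using c by (simp add: bij_betw_def)
      have ABi: "A' \<inter> B' \<subseteq> {0..<q}" using A'(1) by blast
      have cards: "card A' = card A" "card B' = card B" "card (A' \<inter> B') = card (A \<inter> B)"
        using A' B' card_image[OF inj_on_subset[OF ci], of A'] card_image[OF inj_on_subset[OF ci], of B']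
          card_image[OF inj_on_subset[OF ci], of "A' \<inter> B'"] inj_on_image_Int[OF ci A'(1) B'(1)] ABi by auto
      have bi: "block q A \<inter> block q B = block q (A \<inter> B)" unfolding block_def by auto
      have AiB: "A \<inter> B \<subseteq> {0..<q}" using AB by auto
      have "measure unit_measure (block q (c ` A') \<inter> (cyclic_action (q * r) c' (\<phi> j n) -` block q (c ` B') \<inter> {0..1}))
        = card {i\<in>{0..<q * r}. \<pi> i \<in> A' \<and> \<pi> ((i + \<phi> j n) mod (q * r)) \<in> B'} / (q * r)"
        by (rule cyclic_action_refinement(2)[OF q r(1) c c'(1) _ _ _ _ A'(1) B'(1)]) (fact pix fib c'(2) c'(3))+
      thus ?thesis using mixed[OF j A'(1) B'(1)]
        unfolding block_deviation_def A'(2) B'(2) bi measure_block[OF q AB(1)] measure_block[OF q AB(2)] measure_block[OF q AiB] cards del(2)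
        by simp
    qed
    show "\<exists>q' c'. q' > 0 \<and> q' \<ge> C \<and> bij_betw c' {0..<q'} {0..<q'} \<and>
     measure unit_measure {x\<in>{0..1}. cyclic_action q' c' 1 x \<noteq> cyclic_action q c 1 x} \<le> \<epsilon> + 2 / q \<and>
     (\<forall>j\<in>{1..N}. \<forall>A\<subseteq>{0..<q}. \<forall>B\<subseteq>{0..<q}.
       block_deviation (\<xi> j = 0) q (cyclic_action q' c' (\<phi> j n)) A B \<le> \<eta>)"
      using qr r(2) c'(1) g1 g2 by (intro exI[of _ "q * r"] exI[of _ c'] conjI ballI allI impI)
  qed
qed

text \<open>
  The function \<open>D\<close> measures how small the later changes must be for the behaviour at the times belonging to
  \<open>n k\<close> to survive. In the recursion the state carries \<open>q \<ge> 4 * 2\<^sup>k * D n\<close>: half of the admitted change is spent on the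
  term \<open>2 / q\<close> and half on the tolerance \<open>\<epsilon>\<close> of the step.
\<close>

lemma cyclic_refinement_chain:
  fixes N :: nat and \<phi> :: "nat \<Rightarrow> nat \<Rightarrow> int" and \<sigma> :: "'i \<Rightarrow> nat \<Rightarrow> int" and D :: "nat \<Rightarrow> real"
  assumes ind: "asymptotically_independent N \<phi>" and fin: "finite I"
    and chi: "\<And>i j. i \<in> I \<Longrightarrow> j \<in> {1..N} \<Longrightarrow> \<sigma> i j \<in> {0, 1}" and D: "\<And>n. D n \<ge> 1"
  obtains n :: "nat \<Rightarrow> nat" and q :: "nat \<Rightarrow> 'i \<Rightarrow> int" and c :: "nat \<Rightarrow> 'i \<Rightarrow> int \<Rightarrow> int"
  where "strict_mono n" "\<And>k. n k \<ge> 1"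
    "\<And>k i. i \<in> I \<Longrightarrow> q k i > 0 \<and> bij_betw (c k i) {0..<q k i} {0..<q k i} \<and> real_of_int (q k i) \<ge> 2 ^ k"
    "\<And>k i. i \<in> I \<Longrightarrow> measure unit_measure
      {x\<in>{0..1}. cyclic_action (q (Suc k) i) (c (Suc k) i) 1 x \<noteq> cyclic_action (q k i) (c k i) 1 x} \<le> (1/2) ^ k / D (n k)"
    "\<And>k i j A B. i \<in> I \<Longrightarrow> j \<in> {1..N} \<Longrightarrow> A \<subseteq> {0..<q k i} \<Longrightarrow> B \<subseteq> {0..<q k i} \<Longrightarrow>
      block_deviation (\<sigma> i j = 0) (q k i) (cyclic_action (q (Suc k) i) (c (Suc k) i) (\<phi> j (n (Suc k)))) A B \<le> (1/2) ^ k"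
proof -
  define P where "P k s = (case s of (n, q, c) \<Rightarrow> n \<ge> 1 \<and> (\<forall>i\<in>I. q i > 0 \<and>
      bij_betw (c i) {0..<q i} {0..<q i} \<and> real_of_int (q i) \<ge> 4 * 2 ^ k * D n))"
    for k and s :: "nat \<times> ('i \<Rightarrow> int) \<times> ('i \<Rightarrow> int \<Rightarrow> int)"
  define near where "near k m n i q c q' c' = (q' > 0 \<and> bij_betw c' {0..<q'} {0..<q'} \<and>
      real_of_int q' \<ge> 4 * 2 ^ Suc k * D n \<and>
      measure unit_measure {x\<in>{0..1}. cyclic_action q' c' 1 x \<noteq> cyclic_action q c 1 x} \<le> (1/2) ^ k / D m \<and>
      (\<forall>j\<in>{1..N}. \<forall>A\<subseteq>{0..<q}. \<forall>B\<subseteq>{0..<q}.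
       block_deviation (\<sigma> i j = 0) q (cyclic_action q' c' (\<phi> j n)) A B \<le> (1/2) ^ k))"
    for k m n :: nat and i :: 'i and q :: int and c and q' :: int and c'
  define S where "S k s t = (case s of (m, q, c) \<Rightarrow> case t of (n, q', c') \<Rightarrow>
      m < n \<and> (\<forall>i\<in>I. near k m n i (q i) (c i) (q' i) (c' i)))"
    for k and s t :: "nat \<times> ('i \<Rightarrow> int) \<times> ('i \<Rightarrow> int \<Rightarrow> int)"
  have init: "\<exists>s. P 0 s"
  proof -
    define a where "a = \<lceil>4 * D 1\<rceil>"
    have "real_of_int a \<ge> 4 * D 1" unfolding a_def by linarith
    moreover from this D[of 1] have "a > 0" by linarith
    ultimately have "P 0 (1, \<lambda>_. a, \<lambda>_ x. x)" unfolding P_def by (simp add: bij_betw_def)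
    thus ?thesis by blast
  qed
  have step: "\<exists>t. P (Suc k) t \<and> S k s t" if Ps: "P k s" for k s
  proof -
    obtain m q c where s: "s = (m, q, c)" by (cases s)
    have st: "q i > 0" "bij_betw (c i) {0..<q i} {0..<q i}" "real_of_int (q i) \<ge> 4 * 2 ^ k * D m" if "i \<in> I" for i
      using Ps that unfolding s P_def by auto
    define e where "e = (1/2) ^ k / (2 * D m)"
    have D0: "D m > 0" using D[of m] by linarith
    have e0: "e > 0" unfolding e_def using D0 by simp
    have e2: "e + 2 / real_of_int (q i) \<le> (1/2) ^ k / D m" if i: "i \<in> I" for i
    proof -
      have "2 / real_of_int (q i) \<le> 2 / (4 * 2 ^ k * D m)"
        using st(3)[OF i] D0 by (intro frac_le) auto
      also have "\<dots> = e" unfolding e_def by (simp add: power_divide)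
      finally show ?thesis unfolding e_def by simp
    qed
    have "\<forall>\<^sub>F n in sequentially. n > m \<and> (\<forall>i\<in>I. \<exists>p. near k m n i (q i) (c i) (fst p) (snd p))"
    proof (intro eventually_conj eventually_gt_at_top eventually_ball_finite[OF fin] ballI)
      fix i assume i: "i \<in> I"
      have pw: "(1/2 :: real) ^ k > 0" by simp
      show "\<forall>\<^sub>F n in sequentially. \<exists>p. near k m n i (q i) (c i) (fst p) (snd p)"
      proof (rule eventually_mono[OF cyclic_refinement_step[where \<xi> = "\<sigma> i", OF ind st(1,2)[OF i] e0 pw]], goal_cases)
        case (1 j)
        thus ?case by (rule chi[OF i])
      next
        case (2 n)
        obtain q' c' where qc: "q' > 0" "q' \<ge> \<lceil>4 * 2 ^ Suc k * D n\<rceil>" "bij_betw c' {0..<q'} {0..<q'}"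
          "measure unit_measure {x\<in>{0..1}. cyclic_action q' c' 1 x \<noteq> cyclic_action (q i) (c i) 1 x} \<le> e + 2 / q i"
          "\<forall>j\<in>{1..N}. \<forall>A\<subseteq>{0..<q i}. \<forall>B\<subseteq>{0..<q i}.
           block_deviation (\<sigma> i j = 0) (q i) (cyclic_action q' c' (\<phi> j n)) A B \<le> (1/2) ^ k"
          using 2[rule_format, of "\<lceil>4 * 2 ^ Suc k * D n\<rceil>"] by (elim exE conjE)
        have "near k m n i (q i) (c i) q' c'" unfolding near_def
        proof (intro conjI qc(1,3,5))
          show "4 * 2 ^ Suc k * D n \<le> real_of_int q'" using qc(2) by (simp only: ceiling_le_iff)
          show "measure unit_measure {x\<in>{0..1}. cyclic_action q' c' 1 x \<noteq> cyclic_action (q i) (c i) 1 x} \<le> (1/2) ^ k / D m"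
            by (rule order_trans[OF qc(4) e2[OF i]])
        qed
        thus ?case by (intro exI[of _ "(q', c')"]) simp
      qed
    qed
    then obtain n where n: "n > m" and all: "\<forall>i\<in>I. \<exists>p. near k m n i (q i) (c i) (fst p) (snd p)"
      using eventually_happens'[OF sequentially_bot] by blast
    obtain p where p: "\<forall>i\<in>I. near k m n i (q i) (c i) (fst (p i)) (snd (p i))"
      using bchoice[OF all] by blast
    have "P (Suc k) (n, \<lambda>i. fst (p i), \<lambda>i. snd (p i))" unfolding P_def using p n by (auto simp: near_def)
    moreover have "S k s (n, \<lambda>i. fst (p i), \<lambda>i. snd (p i))" unfolding S_def s using n p by simp
    ultimately show ?thesis by blast
  qed
  obtain f where f: "\<And>k. P k (f k)" "\<And>k. S k (f k) (f (Suc k))"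
    using dependent_nat_choice[of P S] init step by blast
  define n where "n k = fst (f k)" for k
  define q where "q k = fst (snd (f k))" for k
  define c where "c k = snd (snd (f k))" for k
  have fk: "f k = (n k, q k, c k)" for k unfolding n_def q_def c_def by simp
  have nr: "near k (n k) (n (Suc k)) i (q k i) (c k i) (q (Suc k) i) (c (Suc k) i)" if "i \<in> I" for k i
    using f(2)[of k] that unfolding fk S_def by simp
  show ?thesis
  proof (rule that[of n q c])
    show "strict_mono n" using f(2) unfolding fk S_def by (intro strict_monoI_Suc) simp
    show "n k \<ge> 1" for k using f(1)[of k] unfolding fk P_def by simp
    show "q k i > 0 \<and> bij_betw (c k i) {0..<q k i} {0..<q k i} \<and> real_of_int (q k i) \<ge> 2 ^ k" if i: "i \<in> I" for k i
    proof -
      have p: "q k i > 0" "bij_betw (c k i) {0..<q k i} {0..<q k i}" "real_of_int (q k i) \<ge> 4 * 2 ^ k * D (n k)"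
        using f(1)[of k] i unfolding fk P_def by auto
      have "(2::real) ^ k * 1 \<le> 2 ^ k * (4 * D (n k))" using D[of "n k"] by (intro mult_left_mono) auto
      also have "\<dots> = 4 * 2 ^ k * D (n k)" by simp
      finally have "(2::real) ^ k \<le> real_of_int (q k i)" using p(3) by linarith
      thus ?thesis using p(1,2) by blast
    qed
  qed (use nr in \<open>unfold near_def, blast+\<close>)
qed

section \<open>Passage from blocks to Borel sets\<close>

text \<open>
  The sets approximable by unions of blocks of all large levels form a \<open>\<sigma>\<close>-algebra. It contains the half lines, because the
  boundary point of a half line spoils only one block.
\<close>

lemma block_approximation:
  fixes q :: "nat \<Rightarrow> int"
  assumes q: "\<And>k. q k > 0" and lim: "(\<lambda>k. 1 / real_of_int (q k)) \<longlonglongrightarrow> 0"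
    and A: "A \<in> sets (borel :: real measure)" and e: "e > 0"
  shows "\<forall>\<^sub>F k in sequentially. \<exists>S\<subseteq>{0..<q k}. measure unit_measure (sym_diff (A \<inter> {0..1}) (block (q k) S)) < e"
proof -
  have bs: "X \<inter> {0..1} \<in> sets unit_measure" if "X \<in> sets borel" for X :: "real set"
    using that by (simp add: sets_unit)
  have sub01: "measure unit_measure X \<le> measure unit_measure Y"
    if "X \<subseteq> Y" "Y \<in> sets unit_measure" for X Y using that by (rule unit.finite_measure_mono)
  have one: "measure unit_measure {1} = 0" by (subst measure_unit) auto
  have ones: "{1} \<in> sets unit_measure" by (simp add: sets_unit)
  have "A \<in> sigma_sets UNIV (range (\<lambda>a::real. {..a}))"
    using A by (simp add: borel_eq_atMost)
  thus ?thesis using e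
  proof (induction arbitrary: e rule: sigma_sets.induct)
    case (Basic X)
    then obtain a where X: "X = {..a}" by blast
    have "\<forall>\<^sub>F k in sequentially. 1 / real_of_int (q k) < e" using order_tendstoD(2)[OF lim Basic(2)] .
    thus ?case
    proof (rule eventually_mono)
      fix k assume k: "1 / real_of_int (q k) < e"
      define S where "S = {j\<in>{0..<q k}. j \<le> \<lfloor>q k * a\<rfloor>}"
      define b where "b = {\<lfloor>q k * a\<rfloor>} \<inter> {0..<q k}"
      have "sym_diff (X \<inter> {0..1}) (block (q k) S) \<subseteq> {1} \<union> block (q k) b"
      proof
        fix x assume x: "x \<in> sym_diff (X \<inter> {0..1}) (block (q k) S)"
        show "x \<in> {1} \<union> block (q k) b"
        proof (cases "x \<in> {0..<1}")
          case True
          hence fl: "\<lfloor>q k * x\<rfloor> \<in> {0..<q k}" using floor_block_index[OF q] by auto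
          have "\<not> x \<le> a"
          proof
            assume xa: "x \<le> a"
            hence "\<lfloor>q k * x\<rfloor> \<le> \<lfloor>q k * a\<rfloor>" using q[of k] by (intro floor_mono) simp
            hence "x \<in> block (q k) S" using True fl unfolding block_def S_def by auto
            moreover have "x \<in> X \<inter> {0..1}" using xa X True by simp
            ultimately show False using x by blast
          qed
          hence "x \<notin> X" using X by simp
          hence xS: "x \<in> block (q k) S" "x > a" using x \<open>\<not> x \<le> a\<close> by (blast, simp)
          hence "\<lfloor>q k * x\<rfloor> \<le> \<lfloor>q k * a\<rfloor>" unfolding block_def S_def by auto
          moreover have "\<lfloor>q k * a\<rfloor> \<le> \<lfloor>q k * x\<rfloor>" using q[of k] xS by (intro floor_mono) simp
          ultimately show ?thesis using fl True unfolding block_def b_def by auto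
        next
          case False
          hence "x \<notin> block (q k) S" using block_subset(1) by blast
          hence "x \<in> {0..1}" using x by blast
          thus ?thesis using False by simp
        qed
      qed
      hence "measure unit_measure (sym_diff (X \<inter> {0..1}) (block (q k) S)) \<le> measure unit_measure ({1} \<union> block (q k) b)"
        by (rule sub01) (intro sets.Un ones block_sets_unit)
      also have "\<dots> \<le> measure unit_measure {1} + measure unit_measure (block (q k) b)"
        by (rule measure_Un_le[OF ones block_sets_unit])
      also have "\<dots> = card b / q k" unfolding one using measure_block[OF q, of b k] by (simp add: b_def)
      also have "\<dots> \<le> 1 / q k"
      proof (rule divide_right_mono)
        have "card b \<le> card {\<lfloor>q k * a\<rfloor>}" unfolding b_def by (rule card_mono) auto
        thus "real (card b) \<le> 1" by simp
      qed (use q[of k] in simp)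
      finally show "\<exists>S\<subseteq>{0..<q k}. measure unit_measure (sym_diff (X \<inter> {0..1}) (block (q k) S)) < e"
        using k by (intro exI[of _ S]) (auto simp: S_def)
    qed
  next
    case Empty
    have "block (q k) {} = {}" for k by (simp add: block_def)
    thus ?case using Empty by (intro always_eventually allI exI[of _ "{}"]) simp
  next
    case (Compl X)
    have X: "X \<in> sets borel" using Compl(1) by (simp add: borel_eq_atMost)
    from Compl.IH[OF Compl.prems] show ?case
    proof (rule eventually_mono, elim exE conjE)
      fix k S assume S: "S \<subseteq> {0..<q k}" "measure unit_measure (sym_diff (X \<inter> {0..1}) (block (q k) S)) < e"
      let ?S = "{0..<q k} - S"
      have co: "x \<in> block (q k) ?S \<longleftrightarrow> x \<notin> block (q k) S" if "x \<in> {0..<1}" for x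
        using that floor_block_index[OF q, of x k] unfolding block_def by auto
      have "sym_diff ((UNIV - X) \<inter> {0..1}) (block (q k) ?S) \<subseteq> {1} \<union> sym_diff (X \<inter> {0..1}) (block (q k) S)"
      proof
        fix x assume x: "x \<in> sym_diff ((UNIV - X) \<inter> {0..1}) (block (q k) ?S)"
        show "x \<in> {1} \<union> sym_diff (X \<inter> {0..1}) (block (q k) S)"
        proof (cases "x \<in> {0..<1}")
          case True
          hence "x \<in> {0..1}" by simp
          thus ?thesis using x co[OF True] by blast
        next
          case False
          hence "x \<notin> block (q k) ?S" using block_subset(1) by blast
          hence "x \<in> {0..1}" using x by blast
          thus ?thesis using False by simp
        qed
      qed
      hence "measure unit_measure (sym_diff ((UNIV - X) \<inter> {0..1}) (block (q k) ?S))
          \<le> measure unit_measure ({1} \<union> sym_diff (X \<inter> {0..1}) (block (q k) S))"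
        by (rule sub01) (intro sets.Un sets.Diff ones block_sets_unit bs X)
      also have "\<dots> \<le> measure unit_measure {1} + measure unit_measure (sym_diff (X \<inter> {0..1}) (block (q k) S))"
        by (rule measure_Un_le) (intro sets.Un sets.Diff ones block_sets_unit bs X)+
      finally show "\<exists>S\<subseteq>{0..<q k}. measure unit_measure (sym_diff ((UNIV - X) \<inter> {0..1}) (block (q k) S)) < e"
        using S(2) one by (intro exI[of _ ?S]) auto
    qed
  next
    case (Union X)
    have X: "X i \<in> sets borel" for i using Union(1)[of i] by (simp add: borel_eq_atMost)
    define U where "U m = (\<Union>i<m. X i \<inter> {0..1})" for m
    have Us: "U m \<in> sets unit_measure" for m unfolding U_def using bs X by auto
    have UN: "(\<Union>m. U m) = (\<Union>i. X i) \<inter> {0..1}" unfolding U_def by auto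
    have "(\<lambda>m. measure unit_measure (U m)) \<longlonglongrightarrow> measure unit_measure (\<Union>m. U m)"
    proof (rule unit.finite_Lim_measure_incseq)
      show "incseq U" unfolding U_def by (intro monoI UN_mono) auto
    qed (use Us in auto)
    hence "\<forall>\<^sub>F m in sequentially. measure unit_measure (\<Union>m. U m) - e / 2 < measure unit_measure (U m)"
      by (rule order_tendstoD(1)) (use Union.prems in simp)
    then obtain m where m: "measure unit_measure (\<Union>m. U m) - e / 2 < measure unit_measure (U m)"
      unfolding eventually_sequentially by blast
    define d where "d = e / (2 * (real m + 1))"
    have d: "d > 0" unfolding d_def using Union.prems by simp
    have "\<forall>\<^sub>F k in sequentially. \<forall>i\<in>{..<m}. \<exists>S\<subseteq>{0..<q k}. measure unit_measure (sym_diff (X i \<inter> {0..1}) (block (q k) S)) < d"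
      by (rule eventually_ball_finite) (use Union.IH d in auto)
    thus ?case
    proof (rule eventually_mono)
      fix k assume "\<forall>i\<in>{..<m}. \<exists>S\<subseteq>{0..<q k}. measure unit_measure (sym_diff (X i \<inter> {0..1}) (block (q k) S)) < d"
      then obtain S where S: "\<And>i. i < m \<Longrightarrow> S i \<subseteq> {0..<q k}"
        "\<And>i. i < m \<Longrightarrow> measure unit_measure (sym_diff (X i \<inter> {0..1}) (block (q k) (S i))) < d" by (metis lessThan_iff)
      define W where "W = (\<Union>i<m. S i)"
      define Y where "Y i = sym_diff (X i \<inter> {0..1}) (block (q k) (S i))" for i
      have Ys: "Y i \<in> sets unit_measure" for i unfolding Y_def by (intro sets.Un sets.Diff block_sets_unit bs X)
      have bW: "block (q k) W = (\<Union>i<m. block (q k) (S i))" unfolding W_def block_def by auto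
      have "sym_diff ((\<Union>i. X i) \<inter> {0..1}) (block (q k) W) \<subseteq> ((\<Union>m. U m) - U m) \<union> (\<Union>i<m. Y i)"
      proof
        fix x assume x: "x \<in> sym_diff ((\<Union>i. X i) \<inter> {0..1}) (block (q k) W)"
        show "x \<in> ((\<Union>m. U m) - U m) \<union> (\<Union>i<m. Y i)"
        proof (cases "x \<in> block (q k) W")
          case True
          then obtain i where i: "i < m" "x \<in> block (q k) (S i)" unfolding bW by blast
          have "x \<notin> X i \<inter> {0..1}" using x True by blast
          hence "x \<in> Y i" unfolding Y_def using i(2) by blast
          thus ?thesis using i(1) by blast
        next
          case False
          hence xU: "x \<in> (\<Union>m. U m)" unfolding UN using x by blast
          show ?thesis
          proof (cases "x \<in> U m")
            case True
            then obtain i where i: "i < m" "x \<in> X i \<inter> {0..1}" unfolding U_def by blast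
            have "x \<notin> block (q k) (S i)" using False i(1) unfolding bW by blast
            hence "x \<in> Y i" unfolding Y_def using i(2) by blast
            thus ?thesis using i(1) by blast
          qed (use xU in blast)
        qed
      qed
      hence "measure unit_measure (sym_diff ((\<Union>i. X i) \<inter> {0..1}) (block (q k) W))
          \<le> measure unit_measure (((\<Union>m. U m) - U m) \<union> (\<Union>i<m. Y i))"
        by (rule sub01) (use Us Ys in auto)
      also have "\<dots> \<le> measure unit_measure ((\<Union>m. U m) - U m) + measure unit_measure (\<Union>i<m. Y i)"
        by (rule measure_Un_le) (use Us Ys in auto)
      also have "measure unit_measure ((\<Union>m. U m) - U m) < e / 2"
      proof -
        have "U m \<subseteq> (\<Union>m. U m)" by blast
        moreover have "(\<Union>m. U m) \<in> sets unit_measure" using Us by blast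
        ultimately have "measure unit_measure ((\<Union>m. U m) - U m) = measure unit_measure (\<Union>m. U m) - measure unit_measure (U m)"
          using unit.finite_measure_Diff[OF _ Us] by blast
        thus ?thesis using m by linarith
      qed
      also have "measure unit_measure (\<Union>i<m. Y i) \<le> (\<Sum>i<m. measure unit_measure (Y i))"
        by (rule measure_UNION_le) (use Ys in auto)
      also have "\<dots> \<le> (\<Sum>i<m. d)" using S(2) unfolding Y_def by (intro sum_mono less_imp_le) simp
      also have "\<dots> \<le> e / 2" unfolding d_def using Union.prems by (simp add: field_simps)
      finally show "\<exists>S\<subseteq>{0..<q k}. measure unit_measure (sym_diff ((\<Union>i. X i) \<inter> {0..1}) (block (q k) S)) < e"
        using S(1) by (intro exI[of _ W]) (auto simp: W_def)
    qed
  qed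
qed

section \<open>Enlarging an independent family\<close>

text \<open>
  The new sequence exceeds every fixed multiple of \<open>\<Sum>\<^sub>j \<bar>\<phi>\<^sub>j(n)\<bar>\<close> by an amount tending to infinity, so it dominates any
  combination in which it occurs.
\<close>

lemma asymptotically_independent_extend:
  assumes ind: "asymptotically_independent N \<phi>"
    and old: "\<And>j. j \<in> {1..N} \<Longrightarrow> \<psi> j = \<phi> j"
    and new: "\<And>n. \<psi> (Suc N) n = int n * (1 + (\<Sum>j\<in>{1..N}. \<bar>\<phi> j n\<bar>))"
  shows "asymptotically_independent (Suc N) \<psi>"
  unfolding asymptotically_independent_def
proof (intro allI impI)
  fix a :: "nat \<Rightarrow> int" assume nz: "\<exists>j\<in>{1..Suc N}. a j \<noteq> 0"
  have split: "(\<Sum>j=1..Suc N. a j * \<psi> j n) = (\<Sum>j=1..N. a j * \<phi> j n) + a (Suc N) * \<psi> (Suc N) n" for n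
  proof -
    have "(\<Sum>j=1..N. a j * \<psi> j n) = (\<Sum>j=1..N. a j * \<phi> j n)"
      by (rule sum.cong[OF refl]) (simp only: old)
    thus ?thesis by simp
  qed
  show "filterlim (\<lambda>n. \<bar>\<Sum>j=1..Suc N. a j * \<psi> j n\<bar>) at_top sequentially"
  proof (cases "a (Suc N) = 0")
    case True
    obtain j where "j \<in> {1..Suc N}" "a j \<noteq> 0" using nz by blast
    moreover from this True have "j \<noteq> Suc N" by blast
    ultimately have "j \<in> {1..N}" "a j \<noteq> 0" by simp_all
    hence "\<exists>j\<in>{1..N}. a j \<noteq> 0" by blast
    hence "filterlim (\<lambda>n. \<bar>\<Sum>j=1..N. a j * \<phi> j n\<bar>) at_top sequentially"
      using ind[unfolded asymptotically_independent_def, rule_format, of a] by blast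
    thus ?thesis unfolding split using True by simp
  next
    case False
    define K where "K = (\<Sum>j\<in>{1..N}. \<bar>a j\<bar>)"
    have K0: "K \<ge> 0" unfolding K_def by (simp add: sum_nonneg)
    have low: "int n - K \<le> \<bar>\<Sum>j=1..Suc N. a j * \<psi> j n\<bar>" if n: "int n \<ge> K" for n
    proof -
      define s where "s = (\<Sum>j\<in>{1..N}. \<bar>\<phi> j n\<bar>)"
      have s0: "s \<ge> 0" unfolding s_def by (simp add: sum_nonneg)
      have "\<bar>\<Sum>j=1..N. a j * \<phi> j n\<bar> \<le> (\<Sum>j=1..N. \<bar>a j\<bar> * \<bar>\<phi> j n\<bar>)"
        by (rule order_trans[OF sum_abs]) (simp add: abs_mult)
      also have "\<dots> \<le> (\<Sum>j=1..N. K * \<bar>\<phi> j n\<bar>)"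
        unfolding K_def by (intro sum_mono mult_right_mono) (auto intro: member_le_sum)
      also have "\<dots> = K * s" unfolding s_def by (simp add: sum_distrib_left)
      finally have u: "\<bar>\<Sum>j=1..N. a j * \<phi> j n\<bar> \<le> K * s" .
      have "\<psi> (Suc N) n \<ge> 0" unfolding new s_def[symmetric] using s0 by simp
      hence "1 * \<psi> (Suc N) n \<le> \<bar>a (Suc N)\<bar> * \<psi> (Suc N) n" using False by (intro mult_right_mono) auto
      also have "\<dots> = \<bar>a (Suc N) * \<psi> (Suc N) n\<bar>" using \<open>\<psi> (Suc N) n \<ge> 0\<close> by (simp add: abs_mult)
      finally have v: "int n * (1 + s) \<le> \<bar>a (Suc N) * \<psi> (Suc N) n\<bar>" unfolding new s_def[symmetric] by simp
      have "K * s \<le> int n * s" using n s0 by (rule mult_right_mono)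
      hence "int n - K \<le> int n * (1 + s) - K * s" using K0 by (simp add: algebra_simps)
      also have "\<dots> \<le> \<bar>\<Sum>j=1..Suc N. a j * \<psi> j n\<bar>" unfolding split using u v by linarith
      finally show ?thesis .
    qed
    show ?thesis unfolding filterlim_at_top
    proof
      fix Z :: int
      have "\<forall>\<^sub>F n in sequentially. n \<ge> nat (\<bar>Z\<bar> + K)" by (rule eventually_ge_at_top)
      thus "\<forall>\<^sub>F n in sequentially. Z \<le> \<bar>\<Sum>j=1..Suc N. a j * \<psi> j n\<bar>"
      proof (rule eventually_mono)
        fix n assume "n \<ge> nat (\<bar>Z\<bar> + K)"
        hence "int n \<ge> \<bar>Z\<bar> + K" by linarith
        thus "Z \<le> \<bar>\<Sum>j=1..Suc N. a j * \<psi> j n\<bar>" using low[of n] by linarith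
      qed
    qed
  qed
qed

section \<open>Existence of the transformations\<close>

lemma (in finite_measure) measure_Int_diff_le:
  assumes "P \<in> sets M" "P' \<in> sets M" "Q \<in> sets M" "Q' \<in> sets M"
  shows "\<bar>measure M (P \<inter> Q) - measure M (P' \<inter> Q')\<bar>
    \<le> measure M (sym_diff P P') + measure M (sym_diff Q Q')"
proof -
  have s: "sym_diff P P' \<in> sets M" "sym_diff Q Q' \<in> sets M" using assms by auto
  have "\<bar>measure M (P \<inter> Q) - measure M (P' \<inter> Q')\<bar> \<le> measure M (sym_diff (P \<inter> Q) (P' \<inter> Q'))"
    using assms by (intro measure_diff_le_sym_diff) auto
  also have "\<dots> \<le> measure M (sym_diff P P' \<union> sym_diff Q Q')"
    by (rule finite_measure_mono) (use s in auto)
  also have "\<dots> \<le> measure M (sym_diff P P') + measure M (sym_diff Q Q')"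
    by (rule measure_Un_le[OF s])
  finally show ?thesis .
qed

lemma int_iter_measurable:
  assumes "T \<in> Aut M"
  shows "int_iter M T m \<in> measurable M M"
  using assms unfolding Aut_def int_iter_def by (auto intro: measurable_compose_n)

text \<open>
  At time \<open>p (k + 1)\<close> the iterate of \<open>T\<close> is replaced by that of the \<open>(k + 1)\<close>-st approximation, and the sets by unions of
  blocks of level \<open>k\<close>, for which the estimate \<open>est\<close> is available.
\<close>

lemma limit_along_refinements:
  fixes q :: "nat \<Rightarrow> int" and R :: "nat \<Rightarrow> int \<Rightarrow> real \<Rightarrow> real" and p :: "nat \<Rightarrow> int" and rigid :: bool
  assumes q: "\<And>k. q k > 0" "(\<lambda>k. 1 / real_of_int (q k)) \<longlonglongrightarrow> 0"
    and R: "\<And>k m. R k m \<in> measurable unit_measure unit_measure" "\<And>k m. distr unit_measure unit_measure (R k m) = unit_measure"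
    and T: "T \<in> Aut unit_measure"
    and dis: "\<And>k. {x\<in>{0..1}. int_iter unit_measure T (p k) x \<noteq> R k (p k) x} \<in> sets unit_measure"
      "\<And>k. measure unit_measure {x\<in>{0..1}. int_iter unit_measure T (p k) x \<noteq> R k (p k) x} \<le> \<delta> k" "\<delta> \<longlonglongrightarrow> 0"
    and est: "\<And>k A B. A \<subseteq> {0..<q k} \<Longrightarrow> B \<subseteq> {0..<q k} \<Longrightarrow>
      block_deviation rigid (q k) (R (Suc k) (p (Suc k))) A B \<le> (1/2) ^ k"
    and A: "A \<in> sets unit_measure" and B: "B \<in> sets unit_measure"
  shows "(\<lambda>k. measure unit_measure (A \<inter> iter_vimage unit_measure T (p k) B)) \<longlonglongrightarrow>
    (if rigid then measure unit_measure (A \<inter> B) else measure unit_measure A * measure unit_measure B)"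
proof (rule LIMSEQ_imp_Suc, rule tendstoI)
  fix e :: real assume e: "e > 0"
  let ?M = unit_measure
  let ?lim = "\<lambda>X Y. if rigid then measure ?M (X \<inter> Y) else measure ?M X * measure ?M Y"
  have e8: "e / 8 > 0" using e by simp
  have AB: "A \<inter> {0..1} = A" "B \<inter> {0..1} = B" "A \<in> sets borel" "B \<in> sets borel" using A B by (auto simp: sets_unit)
  have "(\<lambda>k. (1/2 :: real) ^ k) \<longlonglongrightarrow> 0" by (rule LIMSEQ_realpow_zero) simp_all
  hence "\<forall>\<^sub>F k in sequentially. (1/2 :: real) ^ k < e / 8" by (rule order_tendstoD(2)[OF _ e8])
  moreover have "\<forall>\<^sub>F k in sequentially. \<delta> (Suc k) < e / 8"
    by (rule order_tendstoD(2)[OF LIMSEQ_Suc[OF dis(3)] e8])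
  moreover note block_approximation[OF q AB(3) e8, unfolded AB(1)] block_approximation[OF q AB(4) e8, unfolded AB(2)]
  ultimately show "\<forall>\<^sub>F k in sequentially.
    dist (measure ?M (A \<inter> iter_vimage ?M T (p (Suc k)) B)) (?lim A B) < e"
  proof eventually_elim
    case (elim k)
    obtain A0 B0 where A0: "A0 \<subseteq> {0..<q k}" "measure ?M (sym_diff A (block (q k) A0)) < e / 8"
      and B0: "B0 \<subseteq> {0..<q k}" "measure ?M (sym_diff B (block (q k) B0)) < e / 8" using elim by blast
    define A' where "A' = block (q k) A0"
    define B' where "B' = block (q k) B0"
    have a': "measure ?M (sym_diff A A') < e / 8" and b': "measure ?M (sym_diff B B') < e / 8"
      unfolding A'_def B'_def by (rule A0(2), rule B0(2))
    have s': "A' \<in> sets ?M" "B' \<in> sets ?M" unfolding A'_def B'_def by (rule block_sets_unit)+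
    define f where "f = R (Suc k) (p (Suc k))"
    define g where "g = int_iter ?M T (p (Suc k))"
    define V where "V h X = h -` X \<inter> {0..1}" for h :: "real \<Rightarrow> real" and X :: "real set"
    have fs: "V f X \<in> sets ?M" if "X \<in> sets ?M" for X
      using measurable_sets[OF R(1) that] unfolding V_def f_def by simp
    have gs: "V g X \<in> sets ?M" if "X \<in> sets ?M" for X
      using measurable_sets[OF int_iter_measurable[OF T] that] unfolding V_def g_def by simp
    have z: "measure ?M (sym_diff A A) = 0" by simp
    have "sym_diff (V g B) (V f B) \<subseteq> {x\<in>{0..1}. g x \<noteq> f x}" unfolding V_def by auto
    hence "measure ?M (sym_diff (V g B) (V f B)) \<le> \<delta> (Suc k)"
      using unit.finite_measure_mono[OF _ dis(1)[of "Suc k"]] dis(2)[of "Suc k"]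
      unfolding f_def g_def by (meson order_trans)
    hence 1: "\<bar>measure ?M (A \<inter> V g B) - measure ?M (A \<inter> V f B)\<bar> < e / 8"
      using unit.measure_Int_diff_le[OF A A gs[OF B] fs[OF B]] z elim by linarith
    have pre: "measure ?M (sym_diff (V f B) (V f B')) = measure ?M (sym_diff B B')"
    proof -
      have "sym_diff (V f B) (V f B') = f -` sym_diff B B' \<inter> space ?M" unfolding V_def by auto
      moreover have "sym_diff B B' \<in> sets ?M" using B s' by auto
      ultimately show ?thesis using measure_vimage_preserving[OF R] unfolding f_def by metis
    qed
    have 2: "\<bar>measure ?M (A \<inter> V f B) - measure ?M (A' \<inter> V f B')\<bar> < 2 * (e / 8)"
      using unit.measure_Int_diff_le[OF A s'(1) fs[OF B] fs[OF s'(2)]] a' b'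
      unfolding pre by linarith
    have 3: "\<bar>measure ?M (A' \<inter> V f B') - ?lim A' B'\<bar> < e / 8"
      using est[OF A0(1) B0(1)] elim(1) unfolding block_deviation_def A'_def B'_def f_def V_def by linarith
    have 4: "\<bar>?lim A' B' - ?lim A B\<bar> < 2 * (e / 8)"
    proof (cases rigid)
      case True
      have "\<bar>measure ?M (A \<inter> B) - measure ?M (A' \<inter> B')\<bar> < 2 * (e / 8)"
        using unit.measure_Int_diff_le[OF A s'(1) B s'(2)] a' b' by linarith
      thus ?thesis using True by (simp add: abs_minus_commute)
    next
      case False
      have le1: "measure ?M X \<le> 1" for X using unit.bounded_measure[of X] measure_unit_space by simp
      have da: "\<bar>measure ?M A' - measure ?M A\<bar> < e / 8"
        using unit.measure_diff_le_sym_diff[OF A s'(1)] a' by linarith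
      have db: "\<bar>measure ?M B' - measure ?M B\<bar> < e / 8"
        using unit.measure_diff_le_sym_diff[OF B s'(2)] b' by linarith
      have "measure ?M A' * measure ?M B' - measure ?M A * measure ?M B
         = (measure ?M A' - measure ?M A) * measure ?M B' + measure ?M A * (measure ?M B' - measure ?M B)"
        by (simp add: algebra_simps)
      also have "\<bar>\<dots>\<bar> \<le> \<bar>measure ?M A' - measure ?M A\<bar> * measure ?M B' + measure ?M A * \<bar>measure ?M B' - measure ?M B\<bar>"
        by (rule order_trans[OF abs_triangle_ineq]) (simp add: abs_mult)
      also have "\<dots> \<le> \<bar>measure ?M A' - measure ?M A\<bar> * 1 + 1 * \<bar>measure ?M B' - measure ?M B\<bar>"
        by (intro add_mono mult_left_mono mult_right_mono le1) auto
      also have "\<dots> < 2 * (e / 8)" using da db unfolding mult_1 mult_1_right by linarith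
      finally show ?thesis using False by simp
    qed
    have iv: "iter_vimage ?M T (p (Suc k)) B = V g B" unfolding iter_vimage_def V_def g_def by simp
    show ?case unfolding iv dist_real_def using 1 2 3 4 e by linarith
  qed
qed

theorem theorem1p6:
  fixes N :: nat and \<phi> :: "nat \<Rightarrow> nat \<Rightarrow> int"
  assumes "N \<ge> 1"
    and "asymptotically_independent N \<phi>"
  shows "\<exists>n :: nat \<Rightarrow> nat. strict_mono_on {1..} n \<and> (\<forall>k\<ge>1. n k \<ge> 1) \<and>
    (\<forall>\<xi> \<in> {1..N} \<rightarrow>\<^sub>E {0, 1 :: real}.
      \<exists>T \<in> Aut unit_measure. weakly_mixing unit_measure T \<and>
        (\<forall>j\<in>{1..N}. \<forall>A\<in>sets unit_measure. \<forall>B\<in>sets unit_measure.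
          (\<lambda>k. measure unit_measure (A \<inter> iter_vimage unit_measure T (\<phi> j (n k)) B))
            \<longlonglongrightarrow> (1 - \<xi> j) * measure unit_measure (A \<inter> B)
              + \<xi> j * (measure unit_measure A * measure unit_measure B)))"
proof -
  define \<psi> where "\<psi> j n = (if j = Suc N then int n * (1 + (\<Sum>j\<in>{1..N}. \<bar>\<phi> j n\<bar>)) else \<phi> j n)" for j n
  have ind: "asymptotically_independent (Suc N) \<psi>"
    by (rule asymptotically_independent_extend[OF assms(2)]) (auto simp: \<psi>_def)
  define I where "I = ({1..N} \<rightarrow>\<^sub>E {0, 1 :: real})"
  have finI: "finite I" unfolding I_def by (rule finite_PiE) auto
  define \<sigma> where "\<sigma> \<xi> j = (if j \<in> {1..N} \<and> \<xi> j = 0 then 0 else 1 :: int)" for \<xi> :: "nat \<Rightarrow> real" and j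
  \<comment> \<open>Summing over all \<open>l \<le> n\<close> makes \<open>D\<close> monotone, so a change admissible for \<open>n k\<close> is admissible for all earlier times.\<close>
  define D where "D n = 1 + (\<Sum>l\<le>n. \<Sum>j\<in>{1..Suc N}. \<bar>real_of_int (\<psi> j l)\<bar>)" for n
  have D1: "D n \<ge> 1" for n unfolding D_def by (simp add: sum_nonneg)
  have Dmono: "D a \<le> D b" if "a \<le> b" for a b
    unfolding D_def by (intro add_left_mono sum_mono2) (use that in \<open>auto intro: sum_nonneg\<close>)
  have Dpsi: "\<bar>real_of_int (\<psi> j n)\<bar> \<le> D n" if j: "j \<in> {1..Suc N}" for j n
  proof -
    have "\<bar>real_of_int (\<psi> j n)\<bar> \<le> (\<Sum>j\<in>{1..Suc N}. \<bar>real_of_int (\<psi> j n)\<bar>)"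
      by (rule member_le_sum[OF j]) auto
    also have "\<dots> \<le> (\<Sum>l\<le>n. \<Sum>j\<in>{1..Suc N}. \<bar>real_of_int (\<psi> j l)\<bar>)"
      by (rule member_le_sum[of n "{..n}"]) (auto intro: sum_nonneg)
    finally show ?thesis unfolding D_def by simp
  qed
  have s01: "\<And>\<xi> j. \<xi> \<in> I \<Longrightarrow> j \<in> {1..Suc N} \<Longrightarrow> \<sigma> \<xi> j \<in> {0, 1}" unfolding \<sigma>_def by simp
  obtain n q c where n: "strict_mono n" "\<And>k. n k \<ge> 1"
    and qc: "\<And>k \<xi>. \<xi> \<in> I \<Longrightarrow> q k \<xi> > 0 \<and> bij_betw (c k \<xi>) {0..<q k \<xi>} {0..<q k \<xi>} \<and> real_of_int (q k \<xi>) \<ge> 2 ^ k"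
    and near: "\<And>k \<xi>. \<xi> \<in> I \<Longrightarrow> measure unit_measure
      {x\<in>{0..1}. cyclic_action (q (Suc k) \<xi>) (c (Suc k) \<xi>) 1 x \<noteq> cyclic_action (q k \<xi>) (c k \<xi>) 1 x} \<le> (1/2) ^ k / D (n k)"
    and est: "\<And>k \<xi> j A B. \<xi> \<in> I \<Longrightarrow> j \<in> {1..Suc N} \<Longrightarrow> A \<subseteq> {0..<q k \<xi>} \<Longrightarrow> B \<subseteq> {0..<q k \<xi>} \<Longrightarrow>
      block_deviation (\<sigma> \<xi> j = 0) (q k \<xi>) (cyclic_action (q (Suc k) \<xi>) (c (Suc k) \<xi>) (\<psi> j (n (Suc k)))) A B \<le> (1/2) ^ k"
  proof -
    note result = that
    show thesis
    proof (rule cyclic_refinement_chain[where \<sigma> = \<sigma> and D = D, OF ind finI], goal_cases)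
      case (1 \<xi> j)
      thus ?case by (rule s01)
    next
      case (2 n)
      show ?case by (rule D1)
    next
      case (3 n q c)
      show ?case by (rule result) (fact 3)+
    qed
  qed
  have nmono: "n a \<le> n b" if "a \<le> b" for a b using n(1) that by (simp add: strict_mono_less_eq)
  have "\<exists>T \<in> Aut unit_measure. weakly_mixing unit_measure T \<and>
        (\<forall>j\<in>{1..N}. \<forall>A\<in>sets unit_measure. \<forall>B\<in>sets unit_measure.
          (\<lambda>k. measure unit_measure (A \<inter> iter_vimage unit_measure T (\<phi> j (n k)) B))
            \<longlonglongrightarrow> (1 - \<xi> j) * measure unit_measure (A \<inter> B)
              + \<xi> j * (measure unit_measure A * measure unit_measure B))" if xi: "\<xi> \<in> I" for \<xi>
  proof -
    have q0: "q k \<xi> > 0" and cb: "bij_betw (c k \<xi>) {0..<q k \<xi>} {0..<q k \<xi>}" and q2: "real_of_int (q k \<xi>) \<ge> 2 ^ k" for k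
      using qc[OF xi] by blast+
    define R where "R k = cyclic_action (q k \<xi>) (c k \<xi>)" for k
    define d where "d k = (1/2) ^ k / D (n k)" for k
    have R: "R k m \<in> measurable unit_measure unit_measure" "distr unit_measure unit_measure (R k m) = unit_measure" for k m
      unfolding R_def using cyclic_action_measurable[OF q0 cb] cyclic_action_distr[OF q0 cb] by blast+
    have dle: "d (l + k) \<le> (1/2) ^ l * ((1/2) ^ k / D (n k))" for l k
    proof -
      have "D (n k) \<le> D (n (l + k))" by (intro Dmono nmono) simp
      hence "(1/2) ^ (l + k) / D (n (l + k)) \<le> (1/2) ^ (l + k) / D (n k)"
        using D1[of "n k"] by (intro divide_left_mono) auto
      thus ?thesis unfolding d_def by (simp add: power_add)
    qed
    have d0: "d k \<ge> 0" for k unfolding d_def using D1[of "n k"] by simp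
    have geo: "(\<lambda>l. (1/2 :: real) ^ l * r) sums (2 * r)" for r
      using sums_mult2[OF geometric_sums[of "1/2 :: real"], of r] by simp
    have sd: "summable d"
    proof (rule summable_comparison_test')
      show "summable (\<lambda>l. (1/2 :: real) ^ l * ((1/2) ^ 0 / D (n 0)))" using geo by (rule sums_summable)
      show "norm (d l) \<le> (1/2) ^ l * ((1/2) ^ 0 / D (n 0))" if "l \<ge> 0" for l
        using dle[of l 0] d0[of l] by simp
    qed
    obtain T where T: "T \<in> Aut unit_measure"
      and Ts: "\<And>m k. {x\<in>{0..1}. int_iter unit_measure T m x \<noteq> R k m x} \<in> sets unit_measure"
      and Tm: "\<And>m k. measure unit_measure {x\<in>{0..1}. int_iter unit_measure T m x \<noteq> R k m x}
        \<le> real_of_int \<bar>m\<bar> * (\<Sum>l. d (l + k))"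
    proof (rule aut_of_stabilising_actions[OF R])
      show "R k 0 x = x" for k x unfolding R_def by (rule cyclic_action_zero[OF q0 cb])
      show "R k (m + m') x = R k m (R k m' x)" for k m m' x unfolding R_def by (rule cyclic_action_add[OF q0 cb])
      show "measure unit_measure {x\<in>{0..1}. R (Suc k) 1 x \<noteq> R k 1 x} \<le> d k" for k
        unfolding R_def d_def by (rule near[OF xi])
    qed (use sd in auto)
    have tail: "(\<Sum>l. d (l + k)) \<le> 2 * ((1/2) ^ k / D (n k))" for k
    proof -
      have "(\<Sum>l. d (l + k)) \<le> (\<Sum>l. (1/2 :: real) ^ l * ((1/2) ^ k / D (n k)))"
        by (rule suminf_le[OF dle]) (use summable_ignore_initial_segment[OF sd] sums_summable[OF geo] in auto)
      also have "\<dots> = 2 * ((1/2) ^ k / D (n k))" by (rule sums_unique[OF geo, symmetric])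
      finally show ?thesis .
    qed
    have close: "measure unit_measure {x\<in>{0..1}. int_iter unit_measure T (\<psi> j (n k)) x \<noteq> R k (\<psi> j (n k)) x}
        \<le> 2 * (1/2) ^ k" if j: "j \<in> {1..Suc N}" for j k
    proof -
      have "real_of_int \<bar>\<psi> j (n k)\<bar> * (\<Sum>l. d (l + k)) \<le> D (n k) * (2 * ((1/2) ^ k / D (n k)))"
        using Dpsi[OF j, of "n k"] D1[of "n k"] tail[of k] d0 summable_ignore_initial_segment[OF sd, of k]
        by (intro mult_mono) (auto intro: suminf_nonneg)
      also have "\<dots> = 2 * (1/2) ^ k" using D1[of "n k"] by simp
      finally show ?thesis using Tm[of "\<psi> j (n k)" k] by linarith
    qed
    have pow: "(\<lambda>k. (1/2 :: real) ^ k) \<longlonglongrightarrow> 0" by (rule LIMSEQ_realpow_zero) simp_all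
    have qlim: "(\<lambda>k. 1 / real_of_int (q k \<xi>)) \<longlonglongrightarrow> 0"
    proof (rule tendsto_sandwich[OF _ _ tendsto_const pow])
      show "\<forall>\<^sub>F k in sequentially. 0 \<le> 1 / real_of_int (q k \<xi>)" using q0 by (simp add: less_imp_le)
      show "\<forall>\<^sub>F k in sequentially. 1 / real_of_int (q k \<xi>) \<le> (1/2) ^ k"
      proof (rule always_eventually, rule allI)
        fix k
        have "1 / real_of_int (q k \<xi>) \<le> 1 / 2 ^ k" using q2[of k] by (intro frac_le) auto
        thus "1 / real_of_int (q k \<xi>) \<le> (1/2) ^ k" by (simp add: power_one_over)
      qed
    qed
    have dl: "(\<lambda>k. 2 * (1/2 :: real) ^ k) \<longlonglongrightarrow> 0" using tendsto_mult[OF tendsto_const pow, of 2] by simp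
    have lim: "(\<lambda>k. measure unit_measure (A \<inter> iter_vimage unit_measure T (\<psi> j (n k)) B)) \<longlonglongrightarrow>
      (if \<sigma> \<xi> j = 0 then measure unit_measure (A \<inter> B) else measure unit_measure A * measure unit_measure B)"
      if j: "j \<in> {1..Suc N}" and AB: "A \<in> sets unit_measure" "B \<in> sets unit_measure" for j A B
      by (rule limit_along_refinements[where R = R and q = "\<lambda>k. q k \<xi>", OF q0 qlim R T Ts close[OF j] dl _ AB])
         (unfold R_def, rule est[OF xi j])
    have "weakly_mixing unit_measure T"
    proof (rule finite_measure.weakly_mixing_of_mixing_times[OF finite_measure_unit, where m = "\<lambda>k. nat (\<psi> (Suc N) (n k))"])
      show "measure unit_measure (space unit_measure) = 1" by (simp add: measure_unit_space)
      show "T \<in> measurable unit_measure unit_measure" "distr unit_measure unit_measure T = unit_measure"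
        using T unfolding Aut_def by auto
      fix A B assume AB: "A \<in> sets unit_measure" "B \<in> sets unit_measure"
      have "\<psi> (Suc N) (n k) \<ge> 0" for k unfolding \<psi>_def by (simp add: sum_nonneg)
      hence "iter_vimage unit_measure T (\<psi> (Suc N) (n k)) B
          = (T ^^ nat (\<psi> (Suc N) (n k))) -` B \<inter> space unit_measure" for k
        unfolding iter_vimage_def int_iter_def by simp
      thus "(\<lambda>k. measure unit_measure (A \<inter> ((T ^^ nat (\<psi> (Suc N) (n k))) -` B \<inter> space unit_measure)))
          \<longlonglongrightarrow> measure unit_measure A * measure unit_measure B"
        using lim[of "Suc N" A B] AB by (simp add: \<sigma>_def)
    qed
    moreover have "(\<lambda>k. measure unit_measure (A \<inter> iter_vimage unit_measure T (\<phi> j (n k)) B))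
            \<longlonglongrightarrow> (1 - \<xi> j) * measure unit_measure (A \<inter> B)
              + \<xi> j * (measure unit_measure A * measure unit_measure B)"
      if j: "j \<in> {1..N}" and AB: "A \<in> sets unit_measure" "B \<in> sets unit_measure" for j A B
    proof -
      have "\<xi> j \<in> {0, 1}" using xi j unfolding I_def by (rule PiE_mem)
      moreover have "\<psi> j (n k) = \<phi> j (n k)" for k unfolding \<psi>_def using j by auto
      moreover have "j \<in> {1..Suc N}" using j by simp
      ultimately show ?thesis using lim[of j A B] AB j by (auto simp: \<sigma>_def)
    qed
    ultimately show ?thesis using T by blast
  qed
  moreover have "strict_mono_on {1..} n" using n(1) by (auto simp: strict_mono_def intro: strict_mono_onI)
  ultimately show ?thesis unfolding I_def using n(2) by (intro exI[of _ n] conjI) blast+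
qed

end
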